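(* Let $\psi:(\mathbb{R}^n,0)\to(\mathbb{R}^p,0)$ be a real-analytic map germ and let $f$ be an element of $\int\langle\psi\rangle$. Let $\mathcal{K}_f$ be the Fitting ideal associated with $\psi$ and $\nabla f$, as defined in the context. Let $Y$ be a germ of closed set at the origin of $\mathbb{R}^n$ and let $\theta$ be an admissible function. Assume that the ideal $\mathcal{K}_f$ contains a germ $g$ whose complex zero set $Z_g$ satisfies the generalized Łojasiewicz inequality $$\operatorname{dist}(x,Z_g)\geq \theta\big(\operatorname{dist}(x,Y)\big)\quad\text{for any real point } x \text{ (near the origin)}.$$ Then, for any non-quasianalytic tame sequence $M$, we have $$f+\Big(\int\langle\psi\rangle\Big)\,\underline{m}^\infty_{Y,M}\subset f\circ\mathcal{R}_{M^{(\theta)}}.$$ In other words, for every $u\in\big(\int\langle\psi\rangle\big)\underline{m}^\infty_{Y,M}$ there is $\Phi\in\mathcal{R}_{M^{(\theta)}}$ such that $f+u=f\circ\Phi$ as germs at $0$.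
   Context: **Germs and ideals.** $\mathcal{E}_n$ is the ring of real-valued $C^\infty$ function germs at the origin of $\mathbb{R}^n$, and $\mathcal{O}_n\subset\mathcal{E}_n$ is the subring of real-analytic germs. For a real-analytic map germ $\phi=(\phi_1,\ldots,\phi_q)$, $\langle\phi\rangle$ is the ideal of $\mathcal{O}_n$ generated by $\phi_1,\ldots,\phi_q$. For an ideal $\mathcal{I}$ of $\mathcal{O}_n$, its primitive ideal $\int\mathcal{I}$ is the ideal of those elements of $\mathcal{I}$ all of whose first order partial derivatives also belong to $\mathcal{I}$. If $\mathcal{I}$ is an ideal of $\mathcal{O}_n$ and $\mathcal{N}$ is a module over a ring $\mathcal{B}$ with $\mathcal{O}_n\subset\mathcal{B}\subset\mathcal{E}_n$, then $\mathcal{I}\mathcal{N}$ is the submodule of finite sums of products $ab$ with $a\in\mathcal{I}$, $b\in\mathcal{N}$. All properties are understood in the sense of germs at the origin, i.e. for sufficiently small representatives. The germ $Y$ contains the origin. **The Fitting ideal.** Let $\psi:(\mathbb{R}^n,0)\to(\mathbb{R}^p,0)$ be a real-analytic map germ and $\varphi=(\varphi_1,\ldots,\varphi_q)$ a $q$-tuple of real-analytic germs with $\langle\varphi\rangle\subset\langle\psi\rangle$. Let $\sigma:\mathcal{O}_n^p\to\mathcal{O}_n$, $\sigma(f_1,\ldots,f_p)=\sum_{i=1}^p f_i\psi_i$, and $\mathcal{M}=\sigma^{-1}(\langle\varphi\rangle)$. Choose $h^1,\ldots,h^q\in\mathcal{O}_n^p$ with $\sigma(h^j)=\varphi_j$,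 and a system of generators $k^1,\ldots,k^r$ of the module $\ker\sigma$. Then $\mathcal{M}$ is generated by $h^1,\ldots,h^q,k^1,\ldots,k^r$. Let $\mathcal{K}$ be the ideal of $\mathcal{O}_n$ generated by the maximal ($p\times p$) minors of the $p\times(q+r)$ matrix with columns $h^1,\ldots,h^q,k^1,\ldots,k^r$. This is the Fitting ideal $\mathsf{Fitt}_0(\mathcal{O}_n^p/\mathcal{M})$ and depends only on $\psi$ and $\varphi$. For $f\in\int\langle\psi\rangle$ one has $\langle\nabla f\rangle\subset\langle\psi\rangle$, where $\nabla f=(\partial f/\partial x_1,\ldots,\partial f/\partial x_n)$; $\mathcal{K}_f$ denotes the ideal $\mathcal{K}$ obtained with $q=n$ and $\varphi=\nabla f$. **Complex zero set.** For $g\in\mathcal{O}_n$, $Z_g$ is the germ at $0\in\mathbb{C}^n$ of the zero set of the holomorphic extension of $g$. Distances are Euclidean, with $\mathbb{R}^n\subset\mathbb{C}^n$; $\operatorname{dist}(x,\emptyset)=+\infty$. **Tame sequences.** ("Increasing"/"decreasing" are in the wide sense.) A sequence $M=(M_j)_{j\ge0}$ of real numbers is tame if: $M$ is increasing with $M_0=1$; $(M_{j+1}/M_j)_{j\ge0}$ is increasing; and there is $A>0$ with $M_{j+k}\le A^{j+k}M_jM_k$ for all $(j,k)\in\mathbb{N}^2$. It is non-quasianalytic if $\sum_{j\ge0}\frac{M_j}{(j+1)M_{j+1}}<\infty$. For $t\ge0$ put $h_M(t)=\inf_{j\ge0}t^jM_j$. **Admissible functions and $M^{(\theta)}$.** A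 continuous increasing function $\theta$ on $[0,\varepsilon[$ (some $\varepsilon>0$) with $\theta(0)=0$ is admissible if $t\mapsto\theta(t)/t$ is increasing on $]0,\varepsilon[$ and there is $s\ge1$ such that $t\mapsto\theta(t)/t^s$ is decreasing on $]0,\varepsilon[$. It is a known fact that, for $M$ tame and $\theta$ admissible, there is a tame sequence $M^{(\theta)}$ for which there exist constants $c,c'>0$ such that $h_M(ct)\le h_{M^{(\theta)}}(\theta(t))\le h_M(c't)$ for all sufficiently small $t>0$. This sequence is unique modulo the equivalence $M'\sim M''$ meaning that $C^{-j}M''_j\le M'_j\le C^jM''_j$ for all $j$, for some constant $C\ge1$. The classes below depend only on the equivalence class of the sequence. **Denjoy-Carleman classes.** $\mathcal{C}_{n,M}$ is the set of $u\in\mathcal{E}_n$ for which there are a neighborhood $U$ of $0$ in $\mathbb{R}^n$ and a constant $C>0$ such that $|D^Ju(x)|\le C^{j+1}j!M_j$ for every $x\in U$ and every multi-index $J\in\mathbb{N}^n$, where $j=|J|$ is the length of $J$. $\underline{m}^\infty_{Y,M}$ is the ideal of germs in $\mathcal{C}_{n,M}$ that are flat on $Y$ (all derivatives of all orders, including order $0$, vanish at every point of $Y$ near $0$). **Diffeomorphisms.** $\mathcal{R}$ is the group of germs of $C^\infty$-diffeomorphisms $(\mathbb{R}^n,0)\to(\mathbb{R}^n,0)$, $\mathcal{R}_M$ is the set of elements of $\mathcal{R}$ whose components belong to $\mathcal{C}_{n,M}$, and $f\circ\mathcal{R}_M=\{f\circ\Phi:\Phi\in\mathcal{R}_M\}$.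 *)

theory Defs
  imports "HOL-Analysis.Analysis"
begin

text \<open>
  Germs at the origin are handled through representatives: a germ is given by a total function,
  equality of germs is equality on a neighbourhood of 0, and each set of germs below is a set of
  functions that is closed under equality of germs.
\<close>

definition germ_eq :: "('a::{topological_space,zero} \<Rightarrow> 'b) \<Rightarrow> ('a \<Rightarrow> 'b) \<Rightarrow> bool" where
  "germ_eq u v \<longleftrightarrow> (\<forall>\<^sub>F x in nhds 0. u x = v x)"


subsection \<open>Partial derivatives and smooth germs\<close>

definition partial :: "'n::finite \<Rightarrow> (real^'n \<Rightarrow> real) \<Rightarrow> real^'n \<Rightarrow> real" where
  "partial i f x = deriv (\<lambda>t. f (x + t *\<^sub>R axis i 1)) 0"

definition iter_partial :: "'n::finite list \<Rightarrow> (real^'n \<Rightarrow> real) \<Rightarrow> real^'n \<Rightarrow> real" where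
  "iter_partial l f = foldr partial l f"

text \<open>
  Since differentiability implies continuity, the following says that the iterated partial
  derivatives of all orders exist and are continuous on the open set \<open>U\<close>.
\<close>

definition smooth_on :: "(real^'n::finite) set \<Rightarrow> (real^'n \<Rightarrow> real) \<Rightarrow> bool" where
  "smooth_on U f \<longleftrightarrow> open U \<and> (\<forall>l. \<forall>x\<in>U. iter_partial l f differentiable (at x))"

definition smooth_germs :: "(real^'n::finite \<Rightarrow> real) set" where
  "smooth_germs = {f. \<exists>U. 0 \<in> U \<and> smooth_on U f}"

definition mlength :: "('n::finite \<Rightarrow> nat) \<Rightarrow> nat" where
  "mlength J = (\<Sum>i\<in>UNIV. J i)"

text \<open>
  The operator \<open>D\<^sup>J\<close> differentiates \<open>J i\<close> times in direction \<open>i\<close>. The index type carries no order,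
  so some order of differentiation is picked; it is irrelevant at points where \<open>f\<close> is smooth.
\<close>

definition mderiv :: "('n::finite \<Rightarrow> nat) \<Rightarrow> (real^'n \<Rightarrow> real) \<Rightarrow> real^'n \<Rightarrow> real" where
  "mderiv J f = iter_partial (SOME l. \<forall>i. count_list l i = J i) f"

definition grad :: "(real^'n::finite \<Rightarrow> real) \<Rightarrow> real^'n \<Rightarrow> real^'n" where
  "grad f x = (\<chi> i. partial i f x)"


subsection \<open>Analytic germs and holomorphic extensions\<close>

text \<open>
  For \<open>'a = real\<close> these are the real-analytic germs, for \<open>'a = complex\<close> the holomorphic germs.
  The sum ranges over all multi-indices and is unconditionally convergent.
\<close>

definition analytic_germs :: "('a::real_normed_field^'n::finite \<Rightarrow> 'a) set" where
  "analytic_germs = {f. \<exists>a :: ('n \<Rightarrow> nat) \<Rightarrow> 'a. \<forall>\<^sub>F x in nhds 0.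
     ((\<lambda>J. a J * (\<Prod>i\<in>UNIV. (x $ i) ^ J i)) has_sum f x) UNIV}"

definition analytic_map_germs :: "(real^'n::finite \<Rightarrow> real^'p::finite) set" where
  "analytic_map_germs = {v. \<forall>i. (\<lambda>x. v x $ i) \<in> analytic_germs}"

definition complex_vec :: "real^'n::finite \<Rightarrow> complex^'n" where
  "complex_vec x = (\<chi> i. complex_of_real (x $ i))"

definition holomorphic_extension ::
    "(real^'n::finite \<Rightarrow> real) \<Rightarrow> (complex^'n \<Rightarrow> complex) \<Rightarrow> bool" where
  "holomorphic_extension g G \<longleftrightarrow>
     G \<in> analytic_germs \<and> (\<forall>\<^sub>F x in nhds 0. G (complex_vec x) = complex_of_real (g x))"

text \<open>
  The distance to a set, with value \<open>\<infinity>\<close> for the empty set (whereas \<open>infdist x {} = 0\<close>).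
\<close>

definition set_dist :: "'a::metric_space \<Rightarrow> 'a set \<Rightarrow> ereal" where
  "set_dist x A = (INF a\<in>A. ereal (dist x a))"


subsection \<open>Submodules over the ring of analytic germs\<close>

text \<open>
  The submodule generated by \<open>S\<close> over the ring of real-analytic germs; for \<open>'b = real\<close> and
  \<open>S\<close> consisting of analytic germs this is the ideal generated by \<open>S\<close>.
\<close>

definition generated :: "(real^'n::finite \<Rightarrow> 'b::real_vector) set \<Rightarrow> (real^'n \<Rightarrow> 'b) set" where
  "generated S = {v. \<exists>T a. finite T \<and> T \<subseteq> S \<and> (\<forall>s\<in>T. a s \<in> analytic_germs) \<and>
     germ_eq v (\<lambda>x. \<Sum>s\<in>T. a s x *\<^sub>R s x)}"

definition component_ideal ::
    "(real^'n::finite \<Rightarrow> real^'q::finite) \<Rightarrow> (real^'n \<Rightarrow> real) set" where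
  "component_ideal \<phi> = generated (range (\<lambda>j x. \<phi> x $ j))"

definition primitive_ideal :: "(real^'n::finite \<Rightarrow> real) set \<Rightarrow> (real^'n \<Rightarrow> real) set" where
  "primitive_ideal I = {f \<in> I. \<forall>i. partial i f \<in> I}"

definition product_module ::
    "(real^'n::finite \<Rightarrow> real) set \<Rightarrow> (real^'n \<Rightarrow> real) set \<Rightarrow> (real^'n \<Rightarrow> real) set" where
  "product_module I N = {u. \<exists>(m::nat) a b. (\<forall>i<m. a i \<in> I \<and> b i \<in> N) \<and>
     germ_eq u (\<lambda>x. \<Sum>i<m. a i x * b i x)}"


subsection \<open>The Fitting ideal\<close>

definition sigma_map ::
    "(real^'n::finite \<Rightarrow> real^'p::finite) \<Rightarrow> (real^'n \<Rightarrow> real^'p) \<Rightarrow> real^'n \<Rightarrow> real" where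
  "sigma_map \<psi> v x = (\<Sum>i\<in>UNIV. v x $ i * \<psi> x $ i)"

definition sigma_kernel ::
    "(real^'n::finite \<Rightarrow> real^'p::finite) \<Rightarrow> (real^'n \<Rightarrow> real^'p) set" where
  "sigma_kernel \<psi> = {v \<in> analytic_map_germs. germ_eq (sigma_map \<psi> v) (\<lambda>x. 0)}"

text \<open>
  The maximal minors of the matrix with columns \<open>h j\<close> (\<open>j :: 'q\<close>) and \<open>k i\<close> (\<open>i < r\<close>): the map
  \<open>c\<close> selects distinct columns. Selecting them in another order only changes the sign.
\<close>

definition maximal_minors ::
    "('q::finite \<Rightarrow> real^'n::finite \<Rightarrow> real^'p::finite) \<Rightarrow> nat \<Rightarrow> (nat \<Rightarrow> real^'n \<Rightarrow> real^'p)
      \<Rightarrow> (real^'n \<Rightarrow> real) set" where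
  "maximal_minors h r k =
     {(\<lambda>x. det (\<chi> i l. case_sum h k (c l) x $ i)) | c :: 'p \<Rightarrow> 'q + nat.
        inj c \<and> range c \<subseteq> UNIV <+> {..<r}}"

text \<open>
  \<open>K\<close> is obtained from some choice of \<open>h\<close> and of generators \<open>k\<close> of the kernel. The resulting ideal
  does not depend on the choice, so this relation determines \<open>K\<close> from \<open>\<psi>\<close> and \<open>\<phi>\<close>.
\<close>

definition is_fitting_ideal ::
    "(real^'n::finite \<Rightarrow> real^'p::finite) \<Rightarrow> (real^'n \<Rightarrow> real^'q::finite)
      \<Rightarrow> (real^'n \<Rightarrow> real) set \<Rightarrow> bool" where
  "is_fitting_ideal \<psi> \<phi> K \<longleftrightarrow>
     (\<exists>(h :: 'q \<Rightarrow> real^'n \<Rightarrow> real^'p) (r::nat) k.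
        (\<forall>j. h j \<in> analytic_map_germs \<and> germ_eq (sigma_map \<psi> (h j)) (\<lambda>x. \<phi> x $ j)) \<and>
        (\<forall>i<r. k i \<in> analytic_map_germs) \<and>
        generated (k ` {..<r}) = sigma_kernel \<psi> \<and>
        K = generated (maximal_minors h r k))"


subsection \<open>Tame sequences and admissible functions\<close>

definition tame :: "(nat \<Rightarrow> real) \<Rightarrow> bool" where
  "tame M \<longleftrightarrow> incseq M \<and> M 0 = 1 \<and> incseq (\<lambda>j. M (j + 1) / M j) \<and>
     (\<exists>A>0. \<forall>j k. M (j + k) \<le> A ^ (j + k) * M j * M k)"

definition non_quasianalytic :: "(nat \<Rightarrow> real) \<Rightarrow> bool" where
  "non_quasianalytic M \<longleftrightarrow> summable (\<lambda>j. M j / ((real j + 1) * M (j + 1)))"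

definition h_seq :: "(nat \<Rightarrow> real) \<Rightarrow> real \<Rightarrow> real" where
  "h_seq M t = (INF j. t ^ j * M j)"

definition admissible :: "(real \<Rightarrow> real) \<Rightarrow> bool" where
  "admissible \<theta> \<longleftrightarrow> (\<exists>\<epsilon>>0. continuous_on {0..<\<epsilon>} \<theta> \<and> mono_on {0..<\<epsilon>} \<theta> \<and> \<theta> 0 = 0 \<and>
     mono_on {0<..<\<epsilon>} (\<lambda>t. \<theta> t / t) \<and>
     (\<exists>s\<ge>1. antimono_on {0<..<\<epsilon>} (\<lambda>t. \<theta> t / t powr s)))"

text \<open>
  \<open>N\<close> is a version of the sequence \<open>M\<^sup>(\<^sup>\<theta>\<^sup>)\<close>, which is unique up to a geometric factor.
\<close>

definition is_theta_transform ::
    "(nat \<Rightarrow> real) \<Rightarrow> (real \<Rightarrow> real) \<Rightarrow> (nat \<Rightarrow> real) \<Rightarrow> bool" where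
  "is_theta_transform M \<theta> N \<longleftrightarrow> tame N \<and> (\<exists>c>0. \<exists>c'>0. \<forall>\<^sub>F t in at_right 0.
     h_seq M (c * t) \<le> h_seq N (\<theta> t) \<and> h_seq N (\<theta> t) \<le> h_seq M (c' * t))"


subsection \<open>Denjoy-Carleman classes and diffeomorphisms\<close>

definition dc_class :: "(nat \<Rightarrow> real) \<Rightarrow> (real^'n::finite \<Rightarrow> real) set" where
  "dc_class M = {u. \<exists>U C. 0 \<in> U \<and> smooth_on U u \<and> C > 0 \<and>
     (\<forall>x\<in>U. \<forall>J. \<bar>mderiv J u x\<bar> \<le>
        C ^ (mlength J + 1) * fact (mlength J) * M (mlength J))}"

definition flat_ideal ::
    "(real^'n::finite) set \<Rightarrow> (nat \<Rightarrow> real) \<Rightarrow> (real^'n \<Rightarrow> real) set" where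
  "flat_ideal Y M = {u \<in> dc_class M. \<forall>\<^sub>F x in nhds 0. x \<in> Y \<longrightarrow> (\<forall>J. mderiv J u x = 0)}"

definition smooth_map_germs :: "(real^'n::finite \<Rightarrow> real^'n) set" where
  "smooth_map_germs = {\<Phi>. \<Phi> 0 = 0 \<and> (\<forall>i. (\<lambda>x. \<Phi> x $ i) \<in> smooth_germs)}"

definition diffeo_germs :: "(real^'n::finite \<Rightarrow> real^'n) set" where
  "diffeo_germs = {\<Phi> \<in> smooth_map_germs. \<exists>\<Psi> \<in> smooth_map_germs.
     germ_eq (\<Psi> \<circ> \<Phi>) id \<and> germ_eq (\<Phi> \<circ> \<Psi>) id}"

definition dc_diffeo_germs :: "(nat \<Rightarrow> real) \<Rightarrow> (real^'n::finite \<Rightarrow> real^'n) set" where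
  "dc_diffeo_germs M = {\<Phi> \<in> diffeo_germs. \<forall>i. (\<lambda>x. \<Phi> x $ i) \<in> dc_class M}"

end

theory Submission
  imports Defs "HOL-Complex_Analysis.Great_Picard"
begin

text \<open>
  The proof is a deformation argument. Put \<open>f\<^sub>t = f + t u\<close>. If vector fields \<open>Z\<^sub>t\<close> satisfy
  \<open>\<nabla>f\<^sub>t \<cdot> Z\<^sub>t = u\<close>, then \<open>f\<^sub>t\<close> is constant along the curves that follow \<open>Z\<^sub>t\<close> while \<open>t\<close> decreases
  from 1 to 0, and the resulting map \<open>\<Phi>\<close> satisfies \<open>f \<circ> \<Phi> = f + u\<close>. So the fields \<open>Z\<^sub>t\<close> have to be
  found in the class of \<open>N = M\<^sup>(\<^sup>\<theta>\<^sup>)\<close>, and the class has to survive integration.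

  The equation for \<open>Z\<^sub>t\<close> is solved as follows. By Cramer's rule every maximal minor, hence \<open>g\<close>,
  multiplies the components of \<open>\<psi>\<close> into the ideal of the gradient: \<open>g \<psi>\<^sub>k = \<Sum>\<^sub>j C\<^sub>k\<^sub>j \<partial>\<^sub>j f\<close>
  (\<open>fitting_multiplier\<close>). Since \<open>u\<close> comes from the primitive ideal, both \<open>u\<close> and its first order
  derivatives are combinations of the \<open>\<psi>\<^sub>k\<close> whose coefficients are sums of products of an analytic
  germ and a flat germ of class \<open>M\<close>. Such a flat germ is divisible by \<open>g\<close>, with a flat quotient of class \<open>N\<close>
  (\<open>flat_division\<close>). Thus \<open>u = g \<Sum>\<^sub>k e\<^sub>k \<psi>\<^sub>k\<close> and \<open>\<partial>\<^sub>j u = g \<Sum>\<^sub>k W\<^sub>j\<^sub>k \<psi>\<^sub>k\<close> with flat \<open>e\<close> and \<open>W\<close>, so that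
  \<open>g \<psi> = C \<nabla>f\<^sub>t - t g P \<psi>\<close> with the flat matrix \<open>P = C W\<close>. Near the origin \<open>P\<close> is small, and the
  Neumann series of \<open>(1 + t P)\<^sup>-\<^sup>1\<close> expresses \<open>u\<close> through \<open>\<nabla>f\<^sub>t\<close>; its partial sums of length \<open>Q\<close>
  solve the equation up to an error of order \<open>2\<^sup>-\<^sup>Q\<close> (\<open>neumann_telescope\<close>, \<open>neumann_dc_on\<close>).

  The division lemma is where \<open>\<theta>\<close> enters. At a real point \<open>x\<close> with \<open>d = dist(x, Y)\<close> the holomorphic
  extension of \<open>g\<close> has no zeros within \<open>\<rho> = \<theta>(d)\<close>, and it is at least a constant times a fixed power
  of the distance to its zero set (\<open>zero_distance_lower_bound\<close>). Cauchy's estimates then bound the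
  derivatives of order \<open>j\<close> of \<open>1/g\<close> by \<open>E\<^sup>j\<^sup>+\<^sup>1 j! \<rho>\<^sup>-\<^sup>(\<^sup>j\<^sup>+\<^sup>m\<^sup>)\<close> (\<open>reciprocal_bound\<close>). A flat function of class
  \<open>M\<close> carries in all its derivatives a factor \<open>h\<^sub>M(E d)\<close> (\<open>flat_decay\<close>), which is at most
  \<open>h\<^sub>N(E' \<rho>) \<le> (E' \<rho>)\<^sup>k N\<^sub>k\<close> for every \<open>k\<close>; a suitable choice of \<open>k\<close> cancels the negative powers of \<open>\<rho>\<close>.

  For the integration, every function is measured by bounds \<open>D R\<^sup>j w\<^sub>j N\<^sub>j\<close> on its derivatives of order
  \<open>j\<close>. On small balls a flat germ admits arbitrarily small \<open>D\<close> for one fixed \<open>R\<close>, and this smallness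
  keeps the bounds from deteriorating when compositions with near-identity maps are repeated
  (\<open>compose_bound\<close>). Euler polygons with step \<open>1/m\<close> therefore obey bounds that are uniform in \<open>m\<close>;
  a subsequence converges by the theorem of Arzela and Ascoli, pointwise limits inherit the bounds
  (\<open>dc_on_limit\<close>), and the errors in \<open>f \<circ> \<Phi> = f + u\<close> tend to 0 (\<open>euler_flow\<close>). The same composition
  bound, applied to the iteration that inverts \<open>x + \<xi>(x)\<close>, yields a smooth inverse
  (\<open>near_identity_inverse\<close>).
\<close>

section \<open>Partial derivatives and smooth functions\<close>

text \<open>
  The base field is left open, so that one calculus serves real functions and their holomorphic
  extensions.
\<close>

definition pd :: "'n::finite \<Rightarrow> ('a::real_normed_field^'n \<Rightarrow> 'a) \<Rightarrow> 'a^'n \<Rightarrow> 'a" where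
  "pd i f x = deriv (\<lambda>t. f (x + axis i t)) 0"

definition pds :: "'n::finite list \<Rightarrow> ('a::real_normed_field^'n \<Rightarrow> 'a) \<Rightarrow> 'a^'n \<Rightarrow> 'a" where
  "pds l f = foldr pd l f"

text \<open>
  Frechet differentiability with a derivative that is linear over the base field; over the complex
  numbers this is holomorphy.
\<close>

definition has_grad :: "('a::real_normed_field^'n::finite \<Rightarrow> 'a) \<Rightarrow> 'a^'n \<Rightarrow> bool" where
  "has_grad f x \<longleftrightarrow> (f has_derivative (\<lambda>h. \<Sum>i\<in>UNIV. h $ i * pd i f x)) (at x)"

text \<open>
  The finite order makes closure properties provable by induction: the derivative of a product, a
  reciprocal or a composition is built from functions of one order less.
\<close>

definition smooth_upto :: "nat \<Rightarrow> ('a::real_normed_field^'n::finite) set \<Rightarrow> ('a^'n \<Rightarrow> 'a) \<Rightarrow> bool" where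
  "smooth_upto k U f \<longleftrightarrow> open U \<and> (\<forall>l. length l \<le> k \<longrightarrow> (\<forall>x\<in>U. has_grad (pds l f) x))"

definition smooth :: "('a::real_normed_field^'n::finite) set \<Rightarrow> ('a^'n \<Rightarrow> 'a) \<Rightarrow> bool" where
  "smooth U f \<longleftrightarrow> open U \<and> (\<forall>l. \<forall>x\<in>U. has_grad (pds l f) x)"

lemma pds_Nil [simp]: "pds [] f = f"
  and pds_Cons: "pds (i # l) f = pd i (pds l f)"
  and pds_append: "pds (l @ l') f = pds l (pds l' f)"
  by (simp_all add: pds_def)

lemma pds_snoc: "pds (l @ [i]) f = pds l (pd i f)"
  by (simp add: pds_def)

lemma smooth_iff_upto: "smooth U f \<longleftrightarrow> (\<forall>k. smooth_upto k U f)"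
  unfolding smooth_def smooth_upto_def by auto

lemma norm_axis: "norm (axis i (t::'a::real_normed_field)) = norm t"
proof -
  have "(\<Sum>j\<in>UNIV. (norm (axis i t $ j))\<^sup>2) = (\<Sum>j\<in>UNIV. if j = i then (norm t)\<^sup>2 else 0)"
    by (rule sum.cong) (auto simp: axis_def)
  thus ?thesis by (simp add: norm_vec_def L2_set_def sum.delta)
qed

lemma bounded_linear_axis: "bounded_linear (axis i :: 'a::real_normed_field \<Rightarrow> 'a^'n::finite)"
proof (rule bounded_linear_intro[where K=1])
  show "axis i (x + y) = axis i x + (axis i y :: 'a^'n)" for x y by (simp add: axis_def vec_eq_iff)
  show "axis i (r *\<^sub>R x) = r *\<^sub>R (axis i x :: 'a^'n)" for r x by (simp add: axis_def vec_eq_iff)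
qed (simp add: norm_axis)

lemma sum_axis_mult: "(\<Sum>j\<in>UNIV. (axis i (t::'a::real_normed_field) :: 'a^'n::finite) $ j * c j) = t * c i"
  by (simp add: axis_def if_distrib if_distribR sum.delta' cong: if_cong)

lemma field_deriv_axis:
  fixes f :: "'a::real_normed_field^'n::finite \<Rightarrow> 'a"
  assumes "(f has_derivative (\<lambda>h. \<Sum>i\<in>UNIV. h $ i * c i)) (at (x + axis i s))"
  shows "((\<lambda>t. f (x + axis i t)) has_field_derivative c i) (at s)"
proof -
  have 1: "((\<lambda>t. x + axis i t) has_derivative (axis i)) (at s)"
    by (rule has_derivative_eq_rhs[OF has_derivative_add[OF has_derivative_const
          bounded_linear_imp_has_derivative[OF bounded_linear_axis]]]) auto
  have "((f \<circ> (\<lambda>t. x + axis i t)) has_derivative ((\<lambda>h. \<Sum>i\<in>UNIV. h $ i * c i) \<circ> axis i)) (at s)"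
    by (rule diff_chain_at[OF 1 assms])
  moreover have "((\<lambda>h. \<Sum>i\<in>UNIV. h $ i * c i) \<circ> axis i) = (*) (c i)"
    unfolding o_def sum_axis_mult by (simp add: fun_eq_iff mult.commute)
  ultimately show ?thesis unfolding has_field_derivative_def o_def by simp
qed

lemma pd_eqI:
  assumes "(f has_derivative (\<lambda>h. \<Sum>i\<in>UNIV. h $ i * c i)) (at x)"
  shows "pd i f x = c i"
  unfolding pd_def by (rule DERIV_imp_deriv, rule field_deriv_axis) (simp add: assms axis_def zero_vec_def[symmetric])

lemma has_gradI:
  assumes "(f has_derivative (\<lambda>h. \<Sum>i\<in>UNIV. h $ i * c i)) (at x)"
  shows "has_grad f x"
  unfolding has_grad_def using assms pd_eqI[OF assms] by simp

lemma pd_cong: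
  assumes "open U" "x \<in> U" "\<And>y. y \<in> U \<Longrightarrow> f y = g y"
  shows "pd i f x = pd i g x"
proof -
  have c: "continuous (at 0) (\<lambda>t. x + axis i t)"
    by (intro continuous_intros linear_continuous_at bounded_linear_axis)
  have "eventually (\<lambda>y. y \<in> U) (nhds (x + axis i 0))"
    using assms by (simp add: eventually_nhds axis_def zero_vec_def[symmetric]) blast
  hence "eventually (\<lambda>t. x + axis i t \<in> U) (at 0)"
    using c[unfolded continuous_at] unfolding filterlim_iff by (elim allE impE) auto
  moreover have "x + axis i 0 \<in> U" using assms by (simp add: axis_def zero_vec_def[symmetric])
  ultimately have "eventually (\<lambda>t. x + axis i t \<in> U) (nhds 0)"
    by (simp add: eventually_nhds_conv_at)
  hence "eventually (\<lambda>t. f (x + axis i t) = g (x + axis i t)) (nhds 0)"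
    by (rule eventually_mono) (use assms in auto)
  thus ?thesis unfolding pd_def by (intro deriv_cong_ev) auto
qed

lemma pds_cong:
  assumes "open U" "\<And>y. y \<in> U \<Longrightarrow> f y = g y" "x \<in> U"
  shows "pds l f x = pds l g x"
  using assms(3)
proof (induction l arbitrary: x)
  case Nil thus ?case using assms by simp
next
  case (Cons i l)
  show ?case unfolding pds_Cons by (rule pd_cong[OF assms(1) Cons.prems Cons.IH])
qed

lemma has_grad_cong:
  assumes "open U" "x \<in> U" "\<And>y. y \<in> U \<Longrightarrow> f y = g y"
  shows "has_grad f x \<longleftrightarrow> has_grad g x"
proof -
  have "has_grad g x" if "has_grad f x" "\<And>y. y \<in> U \<Longrightarrow> f y = g y" for f g
    by (rule has_gradI) (rule has_derivative_transform_within_open[OF that(1)[unfolded has_grad_def] assms(1,2) that(2)])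
  from this[of f g] this[of g f] assms(3) show ?thesis by auto
qed

lemma smooth_upto_cong:
  assumes "\<And>y. y \<in> U \<Longrightarrow> f y = g y"
  shows "smooth_upto k U f \<longleftrightarrow> smooth_upto k U g"
proof -
  have "has_grad (pds l f) x \<longleftrightarrow> has_grad (pds l g) x" if "open U" "x \<in> U" for l x
    by (rule has_grad_cong[OF that(1,2)]) (rule pds_cong[OF that(1) assms])
  thus ?thesis unfolding smooth_upto_def by blast
qed

lemma smooth_cong:
  assumes "\<And>y. y \<in> U \<Longrightarrow> f y = g y"
  shows "smooth U f \<longleftrightarrow> smooth U g"
  unfolding smooth_iff_upto using smooth_upto_cong[of U f g, OF assms] by blast

text \<open>
  The order is peeled off at the innermost derivative, because that is the one to which the product
  and chain rules apply.
\<close>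

lemma smooth_upto_Suc:
  "smooth_upto (Suc k) U f \<longleftrightarrow> smooth_upto 0 U f \<and> (\<forall>i. smooth_upto k U (pd i f))"
  (is "?L \<longleftrightarrow> ?R")
proof
  assume L: ?L
  have "smooth_upto 0 U f" using L unfolding smooth_upto_def by (metis le0 le_zero_eq)
  moreover have "smooth_upto k U (pd i f)" for i
    using L unfolding smooth_upto_def pds_snoc[symmetric] by simp
  ultimately show ?R by blast
next
  assume R: ?R
  have "has_grad (pds l f) x" if "length l \<le> Suc k" "x \<in> U" for l x
    using that R
    by (cases l rule: rev_cases) (auto simp: smooth_upto_def pds_snoc)
  thus ?L using R unfolding smooth_upto_def by blast
qed

lemma smooth_upto_mono: "smooth_upto k U f \<Longrightarrow> k' \<le> k \<Longrightarrow> smooth_upto k' U f"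
  unfolding smooth_upto_def by auto

lemma smooth_upto_0: "smooth_upto 0 U f \<longleftrightarrow> open U \<and> (\<forall>x\<in>U. has_grad f x)"
  unfolding smooth_upto_def by auto

lemma smooth_pds: "smooth U f \<Longrightarrow> smooth U (pds l f)"
  unfolding smooth_def pds_append[symmetric] by auto

lemma smooth_pd: "smooth U f \<Longrightarrow> smooth U (pd i f)"
  using smooth_pds[of U f "[i]"] by (simp add: pds_Cons)

lemma smooth_subset: "smooth U f \<Longrightarrow> open V \<Longrightarrow> V \<subseteq> U \<Longrightarrow> smooth V f"
  unfolding smooth_def by auto

lemma smooth_open: "smooth U f \<Longrightarrow> open U"
  unfolding smooth_def by auto

lemma smooth_has_grad: "smooth U f \<Longrightarrow> x \<in> U \<Longrightarrow> has_grad (pds l f) x"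
  unfolding smooth_def by auto

lemma smooth_has_grad0: "smooth U f \<Longrightarrow> x \<in> U \<Longrightarrow> has_grad f x"
  using smooth_has_grad[of U f x "[]"] by auto

lemma has_grad_isCont: "has_grad f x \<Longrightarrow> isCont f x"
  unfolding has_grad_def by (rule has_derivative_continuous)

lemma smooth_cont: "smooth U f \<Longrightarrow> continuous_on U f"
  using smooth_has_grad0 has_grad_isCont continuous_at_imp_continuous_on by metis

lemma has_grad_add:
  assumes "has_grad f x" "has_grad g x"
  shows "has_grad (\<lambda>x. f x + g x) x" "pd i (\<lambda>x. f x + g x) x = pd i f x + pd i g x"
proof -
  have *: "((\<lambda>x. f x + g x) has_derivative (\<lambda>h. \<Sum>i\<in>UNIV. h $ i * (pd i f x + pd i g x))) (at x)"
    using has_derivative_add[OF assms[unfolded has_grad_def]]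
    by (simp add: sum.distrib algebra_simps)
  show "has_grad (\<lambda>x. f x + g x) x" by (rule has_gradI[OF *])
  show "pd i (\<lambda>x. f x + g x) x = pd i f x + pd i g x" by (rule pd_eqI[OF *])
qed

lemma has_grad_const: "has_grad (\<lambda>x. c) x" "pd i (\<lambda>x. c) x = 0"
proof -
  have *: "((\<lambda>x. c) has_derivative (\<lambda>h. \<Sum>i\<in>UNIV. h $ i * 0)) (at x)"
    by simp
  show "has_grad (\<lambda>x. c) x" by (rule has_gradI[OF *])
  show "pd i (\<lambda>x. c) x = 0" by (rule pd_eqI[OF *])
qed

lemma has_grad_coord: "has_grad (\<lambda>x. x $ j) x" "pd i (\<lambda>x. x $ j) x = (if i = j then 1 else 0)"
proof -
  have "(\<Sum>i\<in>UNIV. h $ i * (if i = j then 1 else 0)) = h $ j" for h :: "'a^'b"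
    by (simp add: sum.delta if_distrib cong: if_cong)
  hence *: "((\<lambda>x. x $ j) has_derivative (\<lambda>h. \<Sum>i\<in>UNIV. h $ i * (if i = j then 1 else 0))) (at x)"
    by (simp add: bounded_linear_imp_has_derivative bounded_linear_vec_nth)
  show "has_grad (\<lambda>x. x $ j) x" by (rule has_gradI[OF *])
  show "pd i (\<lambda>x. x $ j) x = (if i = j then 1 else 0)" by (rule pd_eqI[OF *])
qed

lemma has_grad_mult:
  assumes "has_grad f x" "has_grad g x"
  shows "has_grad (\<lambda>x. f x * g x) x" "pd i (\<lambda>x. f x * g x) x = pd i f x * g x + f x * pd i g x"
proof -
  have *: "((\<lambda>x. f x * g x) has_derivative (\<lambda>h. \<Sum>i\<in>UNIV. h $ i * (pd i f x * g x + f x * pd i g x))) (at x)"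
    using has_derivative_mult[OF assms[unfolded has_grad_def]]
    by (rule has_derivative_eq_rhs)
      (auto simp: fun_eq_iff sum.distrib sum_distrib_left sum_distrib_right algebra_simps)
  show "has_grad (\<lambda>x. f x * g x) x" by (rule has_gradI[OF *])
  show "pd i (\<lambda>x. f x * g x) x = pd i f x * g x + f x * pd i g x" by (rule pd_eqI[OF *])
qed

lemma has_grad_inverse:
  assumes "has_grad f x" "f x \<noteq> 0"
  shows "has_grad (\<lambda>x. inverse (f x)) x"
    "pd i (\<lambda>x. inverse (f x)) x = - (pd i f x * (inverse (f x) * inverse (f x)))"
proof -
  have *: "((\<lambda>x. inverse (f x)) has_derivative (\<lambda>h. \<Sum>i\<in>UNIV. h $ i * - (pd i f x * (inverse (f x) * inverse (f x))))) (at x)"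
    using Deriv.has_derivative_inverse[OF assms(2) assms(1)[unfolded has_grad_def]]
    by (rule has_derivative_eq_rhs)
      (auto simp: fun_eq_iff sum_negf sum_distrib_left sum_distrib_right algebra_simps intro!: sum.cong)
  show "has_grad (\<lambda>x. inverse (f x)) x" by (rule has_gradI[OF *])
  show "pd i (\<lambda>x. inverse (f x)) x = - (pd i f x * (inverse (f x) * inverse (f x)))" by (rule pd_eqI[OF *])
qed

text \<open>
  The map \<open>\<phi>\<close> is recovered from its components as a sum of axis vectors, which turns
  differentiability of the components into differentiability of \<open>\<phi>\<close>.
\<close>

lemma has_grad_compose:
  fixes \<phi> :: "'a::real_normed_field^'n::finite \<Rightarrow> 'a^'m::finite"
  assumes "\<And>s. has_grad (\<lambda>x. \<phi> x $ s) x" "has_grad f (\<phi> x)"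
  shows "has_grad (\<lambda>x. f (\<phi> x)) x"
    "pd i (\<lambda>x. f (\<phi> x)) x = (\<Sum>s\<in>UNIV. pd s f (\<phi> x) * pd i (\<lambda>x. \<phi> x $ s) x)"
proof -
  have vec: "v = (\<Sum>s\<in>UNIV. axis s (v $ s))" for v :: "'a^'m"
    by (auto simp: vec_eq_iff axis_def if_distrib sum.delta cong: if_cong)
  have "((\<lambda>x. \<Sum>s\<in>UNIV. axis s (\<phi> x $ s)) has_derivative
      (\<lambda>h. \<Sum>s\<in>UNIV. axis s (\<Sum>i\<in>UNIV. h $ i * pd i (\<lambda>x. \<phi> x $ s) x))) (at x)"
    by (intro has_derivative_sum bounded_linear.has_derivative[OF bounded_linear_axis] assms(1)[unfolded has_grad_def])
  hence 1: "(\<phi> has_derivative (\<lambda>h. \<chi> s. \<Sum>i\<in>UNIV. h $ i * pd i (\<lambda>x. \<phi> x $ s) x)) (at x)"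
    unfolding vec[symmetric]
    by (rule has_derivative_eq_rhs) (auto simp: vec_eq_iff axis_def fun_eq_iff if_distrib sum.delta cong: if_cong)
  have *: "((\<lambda>x. f (\<phi> x)) has_derivative (\<lambda>h. \<Sum>i\<in>UNIV. h $ i * (\<Sum>s\<in>UNIV. pd s f (\<phi> x) * pd i (\<lambda>x. \<phi> x $ s) x))) (at x)"
    using has_derivative_compose[OF 1 assms(2)[unfolded has_grad_def]]
    apply (rule has_derivative_eq_rhs)
    apply (auto simp: fun_eq_iff sum_distrib_left sum_distrib_right)
    apply (subst sum.swap) 
    apply (auto simp: mult_ac intro!: sum.cong)
    done
  show "has_grad (\<lambda>x. f (\<phi> x)) x" by (rule has_gradI[OF *])
  show "pd i (\<lambda>x. f (\<phi> x)) x = (\<Sum>s\<in>UNIV. pd s f (\<phi> x) * pd i (\<lambda>x. \<phi> x $ s) x)" by (rule pd_eqI[OF *])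
qed

lemma pds_add:
  assumes "smooth_upto k U f" "smooth_upto k U g" "x \<in> U" "length l \<le> Suc k"
  shows "pds l (\<lambda>x. f x + g x) x = pds l f x + pds l g x"
  using assms(3,4)
proof (induction l arbitrary: x)
  case (Cons i l)
  have op: "open U" using assms(1) by (auto simp: smooth_upto_def)
  have "pds (i # l) (\<lambda>x. f x + g x) x = pd i (\<lambda>x. pds l f x + pds l g x) x"
    unfolding pds_Cons using Cons by (intro pd_cong[OF op]) auto
  also have "\<dots> = pd i (pds l f) x + pd i (pds l g) x"
    using assms Cons.prems by (intro has_grad_add) (auto simp: smooth_upto_def)
  finally show ?case by (simp add: pds_Cons)
qed simp

lemma smooth_upto_add:
  fixes f g :: "'a::real_normed_field^'n::finite \<Rightarrow> 'a"
  assumes "smooth_upto k U f" "smooth_upto k U g"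
  shows "smooth_upto k U (\<lambda>x. f x + g x)"
  unfolding smooth_upto_def
proof (intro conjI allI impI ballI)
  show op: "open U" using assms(1) by (auto simp: smooth_upto_def)
  fix l :: "'n list" and x assume lx: "length l \<le> k" "x \<in> U"
  have "has_grad (\<lambda>x. pds l f x + pds l g x) x"
    using assms lx by (intro has_grad_add) (auto simp: smooth_upto_def)
  thus "has_grad (pds l (\<lambda>x. f x + g x)) x"
    by (subst has_grad_cong[OF op lx(2), of _ "\<lambda>x. pds l f x + pds l g x"])
      (use pds_add[OF assms] lx in auto)
qed

lemma smooth_upto_const: "open U \<Longrightarrow> smooth_upto k U (\<lambda>x. c)"
proof (induction k arbitrary: c)
  case 0 thus ?case by (auto simp: smooth_upto_0 has_grad_const)
next
  case (Suc k)
  have "pd i (\<lambda>x::'a^'b. c) = (\<lambda>x. 0)" for i by (auto simp: has_grad_const)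
  thus ?case using Suc by (auto simp: smooth_upto_Suc smooth_upto_0 has_grad_const)
qed

lemma smooth_upto_sum:
  assumes "open U" "\<And>i. i \<in> I \<Longrightarrow> smooth_upto k U (f i)"
  shows "smooth_upto k U (\<lambda>x. \<Sum>i\<in>I. f i x)"
  using assms(2) by (induction I rule: infinite_finite_induct) (auto simp: smooth_upto_const assms(1) smooth_upto_add)

lemma smooth_upto_mult:
  "smooth_upto k U f \<Longrightarrow> smooth_upto k U g \<Longrightarrow> smooth_upto k U (\<lambda>x. f x * g x)"
proof (induction k arbitrary: f g)
  case 0 thus ?case by (auto simp: smooth_upto_0 has_grad_mult)
next
  case (Suc k)
  have "smooth_upto k U (\<lambda>x. pd i f x * g x + f x * pd i g x)" for i
    using Suc.prems smooth_upto_mono[of "Suc k" U _ k] by (intro smooth_upto_add Suc.IH) (auto simp: smooth_upto_Suc)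
  moreover have "smooth_upto k U (pd i (\<lambda>x. f x * g x)) = smooth_upto k U (\<lambda>x. pd i f x * g x + f x * pd i g x)" for i
    by (rule smooth_upto_cong) (use Suc.prems in \<open>auto simp: smooth_upto_Suc smooth_upto_0 has_grad_mult\<close>)
  ultimately show ?case using Suc.prems by (auto simp: smooth_upto_Suc smooth_upto_0 has_grad_mult)
qed

lemma smooth_upto_inverse:
  "smooth_upto k U f \<Longrightarrow> (\<And>x. x \<in> U \<Longrightarrow> f x \<noteq> 0) \<Longrightarrow> smooth_upto k U (\<lambda>x. inverse (f x))"
proof (induction k)
  case 0 thus ?case by (auto simp: smooth_upto_0 has_grad_inverse)
next
  case (Suc k)
  have op: "open U" using Suc.prems by (auto simp: smooth_upto_def)
  have "smooth_upto k U (\<lambda>x. (- 1) * (pd i f x * (inverse (f x) * inverse (f x))))" for i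
    using Suc.prems smooth_upto_mono[of "Suc k" U _ k]
    by (intro smooth_upto_mult Suc.IH smooth_upto_const op) (auto simp: smooth_upto_Suc)
  moreover have "smooth_upto k U (pd i (\<lambda>x. inverse (f x))) = smooth_upto k U (\<lambda>x. (- 1) * (pd i f x * (inverse (f x) * inverse (f x))))" for i
    by (rule smooth_upto_cong) (use Suc.prems in \<open>auto simp: smooth_upto_Suc smooth_upto_0 has_grad_inverse\<close>)
  ultimately show ?case using Suc.prems by (auto simp: smooth_upto_Suc smooth_upto_0 has_grad_inverse)
qed

lemma smooth_upto_compose:
  fixes \<phi> :: "'a::real_normed_field^'n::finite \<Rightarrow> 'a^'m::finite"
  assumes "\<And>s. smooth_upto k U (\<lambda>x. \<phi> x $ s)" "smooth_upto k V f" "\<And>x. x \<in> U \<Longrightarrow> \<phi> x \<in> V"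
  shows "smooth_upto k U (\<lambda>x. f (\<phi> x))"
  using assms(1,2)
proof (induction k arbitrary: f)
  case 0
  have "has_grad (\<lambda>x. f (\<phi> x)) x" if "x \<in> U" for x
    by (rule has_grad_compose) (use 0 assms(3) that in \<open>auto simp: smooth_upto_0\<close>)
  thus ?case using 0 by (auto simp: smooth_upto_0)
next
  case (Suc k)
  have op: "open U" using Suc.prems by (auto simp: smooth_upto_def)
  have \<phi>: "smooth_upto 0 U (\<lambda>x. \<phi> x $ s)" "smooth_upto k U (\<lambda>x. \<phi> x $ s)" "smooth_upto k U (pd i (\<lambda>x. \<phi> x $ s))" for s i
    using Suc.prems(1)[of s] smooth_upto_mono[OF Suc.prems(1)[of s], of k] by (simp_all add: smooth_upto_Suc)
  have f: "smooth_upto 0 V f" "smooth_upto k V (pd s f)" for s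
    using Suc.prems(2) by (simp_all add: smooth_upto_Suc)
  have 1: "smooth_upto k U (\<lambda>x. \<Sum>s\<in>UNIV. pd s f (\<phi> x) * pd i (\<lambda>x. \<phi> x $ s) x)" for i
    by (rule smooth_upto_sum[OF op]) (rule smooth_upto_mult[OF Suc.IH[OF \<phi>(2) f(2)] \<phi>(3)])
  have g: "has_grad (\<lambda>x. \<phi> x $ s) x" "has_grad f (\<phi> x)" if "x \<in> U" for x s
    using \<phi>(1)[of s] f(1) assms(3) that by (auto simp: smooth_upto_0)
  have "smooth_upto k U (pd i (\<lambda>x. f (\<phi> x)))" for i
    by (rule smooth_upto_cong[THEN iffD2, OF _ 1]) (rule has_grad_compose(2)[OF g(1) g(2)])
  moreover have "smooth_upto 0 U (\<lambda>x. f (\<phi> x))"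
    using op has_grad_compose(1)[OF g(1) g(2)] by (simp add: smooth_upto_0)
  ultimately show ?case by (simp add: smooth_upto_Suc)
qed

lemma smooth_add: "smooth U f \<Longrightarrow> smooth U g \<Longrightarrow> smooth U (\<lambda>x. f x + g x)"
  and smooth_mult: "smooth U f \<Longrightarrow> smooth U g \<Longrightarrow> smooth U (\<lambda>x. f x * g x)"
  and smooth_const: "open U \<Longrightarrow> smooth U (\<lambda>x. c)"
  and smooth_inverse: "smooth U f \<Longrightarrow> (\<And>x. x \<in> U \<Longrightarrow> f x \<noteq> 0) \<Longrightarrow> smooth U (\<lambda>x. inverse (f x))"
  and smooth_sum: "open U \<Longrightarrow> (\<And>i. i \<in> I \<Longrightarrow> smooth U (F i)) \<Longrightarrow> smooth U (\<lambda>x. \<Sum>i\<in>I. F i x)"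
  by (simp_all add: smooth_iff_upto smooth_upto_add smooth_upto_mult smooth_upto_const smooth_upto_inverse smooth_upto_sum)

lemma smooth_compose:
  fixes \<phi> :: "'a::real_normed_field^'n::finite \<Rightarrow> 'a^'m::finite"
  assumes "\<And>s. smooth U (\<lambda>x. \<phi> x $ s)" "smooth V f" "\<And>x. x \<in> U \<Longrightarrow> \<phi> x \<in> V"
  shows "smooth U (\<lambda>x. f (\<phi> x))"
  unfolding smooth_iff_upto
proof
  show "smooth_upto k U (\<lambda>x. f (\<phi> x))" for k
    by (rule smooth_upto_compose[of k U \<phi> V f]) (use assms in \<open>simp_all add: smooth_iff_upto\<close>)
qed

lemma smooth_coord: assumes "open U" shows "smooth U (\<lambda>x. x $ j)"
proof -
  have "pd i (\<lambda>x::'a^'b. x $ j) = (\<lambda>x. if i = j then 1 else 0)" for i by (auto simp: has_grad_coord)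
  hence "smooth_upto k U (\<lambda>x. x $ j)" for k
    using assms by (cases k) (auto simp: smooth_upto_Suc smooth_upto_0 has_grad_coord smooth_upto_const)
  thus ?thesis by (simp add: smooth_iff_upto)
qed

lemma smooth_pds_add:
  assumes "smooth U f" "smooth U g" "x \<in> U"
  shows "pds l (\<lambda>x. f x + g x) x = pds l f x + pds l g x"
  using pds_add[of "length l" U f g x l] assms by (auto simp: smooth_iff_upto)

lemma pds_zero: "pds l (\<lambda>x. 0) = (\<lambda>x. 0)"
  by (induction l) (auto simp: pds_Cons has_grad_const)

lemma smooth_pds_sum:
  assumes "open U" "\<And>i. i \<in> I \<Longrightarrow> smooth U (f i)" "x \<in> U"
  shows "pds l (\<lambda>x. \<Sum>i\<in>I. f i x) x = (\<Sum>i\<in>I. pds l (f i) x)"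
proof -
  show ?thesis using assms(2)
  proof (induction I rule: infinite_finite_induct)
    case (insert i F)
    have "pds l (\<lambda>x. f i x + (\<Sum>i\<in>F. f i x)) x = pds l (f i) x + pds l (\<lambda>x. \<Sum>i\<in>F. f i x) x"
      by (rule smooth_pds_add[OF _ smooth_sum[OF assms(1)] assms(3)]) (use insert.prems in auto)
    thus ?case using insert by simp
  qed (auto simp: pds_zero)
qed

text \<open>
  Pascal's rule for binomial convolutions; it is the induction step of the Leibniz rule.
\<close>

lemma binomial_sum_Suc:
  fixes a b :: "nat \<Rightarrow> 'a::comm_semiring_1"
  shows "(\<Sum>i\<le>Suc j. of_nat (Suc j choose i) * a i * b (Suc j - i)) =
    (\<Sum>i\<le>j. of_nat (j choose i) * a (Suc i) * b (j - i)) + (\<Sum>i\<le>j. of_nat (j choose i) * a i * b (Suc (j - i)))"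
proof -
  have s: "(\<Sum>i\<le>j. of_nat (j choose i) * a i * b (Suc (j - i))) = a 0 * b (Suc j) + (\<Sum>i\<le>j. of_nat (j choose Suc i) * a (Suc i) * b (j - i))"
  proof (cases j)
    case (Suc k)
    have "(\<Sum>i\<le>j. of_nat (j choose i) * a i * b (Suc (j - i))) = a 0 * b (Suc j) + (\<Sum>i\<le>k. of_nat (j choose Suc i) * a (Suc i) * b (Suc (j - Suc i)))"
      unfolding Suc by (subst sum.atMost_Suc_shift) (simp del: binomial_Suc_Suc)
    also have "(\<Sum>i\<le>k. of_nat (j choose Suc i) * a (Suc i) * b (Suc (j - Suc i))) = (\<Sum>i\<le>j. of_nat (j choose Suc i) * a (Suc i) * b (j - i))"
    proof -
      have "(\<Sum>i\<le>k. of_nat (j choose Suc i) * a (Suc i) * b (Suc (j - Suc i))) = (\<Sum>i\<le>k. of_nat (j choose Suc i) * a (Suc i) * b (j - i))"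
        by (rule sum.cong) (auto simp: Suc Suc_diff_le)
      thus ?thesis unfolding Suc sum.atMost_Suc by (simp add: binomial_eq_0 del: binomial_Suc_Suc)
    qed
    finally show ?thesis .
  qed simp
  show ?thesis unfolding s
    by (subst sum.atMost_Suc_shift) (simp add: algebra_simps sum.distrib)
qed

text \<open>
  The bounds are only asked for at the point \<open>x\<close> and up to the order of the list. Both restrictions
  matter: the quotient by \<open>g\<close> has bounds depending on \<open>x\<close>, and the induction for compositions knows
  bounds of lower order only.
\<close>

lemma leibniz_bound:
  assumes "smooth U f" "smooth U g" "x \<in> U"
    and "\<And>l'. length l' \<le> length l \<Longrightarrow> norm (pds l' f x) \<le> a (length l')"
    and "\<And>l'. length l' \<le> length l \<Longrightarrow> norm (pds l' g x) \<le> b (length l')"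
  shows "norm (pds l (\<lambda>x. f x * g x) x) \<le> (\<Sum>i\<le>length l. real (length l choose i) * a i * b (length l - i))"
  using assms(1,2,4,5)
proof (induction l arbitrary: f g a b rule: rev_induct)
  case Nil
  show ?case using Nil(3)[of "[]"] Nil(4)[of "[]"] by (auto simp: norm_mult intro!: mult_mono order_trans[OF norm_ge_zero])
next
  case (snoc i l)
  have op: "open U" using snoc by (auto simp: smooth_def)
  have A: "norm (pds l (\<lambda>x. pd i f x * g x) x) \<le> (\<Sum>i\<le>length l. real (length l choose i) * a (Suc i) * b (length l - i))"
    using snoc.prems(3)[of "_ @ [i]"] snoc.prems(4)
    by (intro snoc.IH[of _ _ "\<lambda>i. a (Suc i)"] smooth_pd snoc.prems) (auto simp: pds_snoc)
  have B: "norm (pds l (\<lambda>x. f x * pd i g x) x) \<le> (\<Sum>i\<le>length l. real (length l choose i) * a i * b (Suc (length l - i)))"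
    using snoc.prems(4)[of "_ @ [i]"] snoc.prems(3)
    by (intro snoc.IH[of _ _ _ "\<lambda>i. b (Suc i)"] smooth_pd snoc.prems) (auto simp: pds_snoc)
  have "pds (l @ [i]) (\<lambda>x. f x * g x) x = pds l (\<lambda>x. pd i f x * g x + f x * pd i g x) x"
    unfolding pds_snoc using snoc.prems assms(3)
    by (intro pds_cong[OF op] has_grad_mult smooth_has_grad0) auto
  also have "\<dots> = pds l (\<lambda>x. pd i f x * g x) x + pds l (\<lambda>x. f x * pd i g x) x"
    by (intro smooth_pds_add[OF _ _ assms(3)] smooth_mult smooth_pd snoc.prems)
  finally have "norm (pds (l @ [i]) (\<lambda>x. f x * g x) x) \<le> norm (pds l (\<lambda>x. pd i f x * g x) x) + norm (pds l (\<lambda>x. f x * pd i g x) x)"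
    by (simp add: norm_triangle_ineq)
  also have "\<dots> \<le> (\<Sum>i\<le>Suc (length l). real (Suc (length l) choose i) * a i * b (Suc (length l) - i))"
    unfolding binomial_sum_Suc by (rule add_mono[OF A B])
  finally show ?case by simp
qed

section \<open>Weighted bounds on all derivatives\<close>

text \<open>
  The cube keeps the weights stable under the two convolutions below, that of the product rule and
  that of the chain rule; with a square the second one would lose a logarithm.
\<close>

definition wt :: "nat \<Rightarrow> real" where
  "wt j = fact j / (real j + 1) ^ 3"

lemma sum_inverse_squares: "(\<Sum>i\<le>j. 1 / (real i + 1)\<^sup>2) \<le> 2 - 1 / (real j + 1)"
proof (induction j)
  case (Suc j)
  have "1 / (real (Suc j) + 1)\<^sup>2 \<le> 1 / (real j + 1) - 1 / (real (Suc j) + 1)"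
  proof -
    define a where "a = real j + 1"
    have "1 / (a + 1)\<^sup>2 \<le> 1 / (a * (a + 1))"
      by (rule divide_left_mono) (auto simp: a_def power2_eq_square)
    also have "\<dots> = 1 / a - 1 / (a + 1)" by (simp add: a_def divide_simps)
    finally show ?thesis by (simp add: a_def add_ac)
  qed
  with Suc show ?case by simp
qed simp

lemma sum_rev_atMost: "(\<Sum>i\<le>j. f (j - i)) = (\<Sum>i\<le>(j::nat). f i :: 'a::comm_monoid_add)"
  using sum.nat_diff_reindex[of f "Suc j"] by (simp add: lessThan_Suc_atMost)

text \<open>
  With \<open>a = i + 1\<close> and \<open>b = j - i + 1\<close> the sum \<open>a + b\<close> is constant, and \<open>(a + b)\<^sup>2 \<le> 2 (a\<^sup>2 + b\<^sup>2)\<close>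
  splits the product of reciprocals into a sum of two convergent series.
\<close>

lemma sum_square_convolution:
  "(\<Sum>i\<le>j. 1 / ((real i + 1)\<^sup>2 * (real (j - i) + 1)\<^sup>2)) \<le> 8 / (real j + 2)\<^sup>2"
proof -
  have t: "1 / (a\<^sup>2 * b\<^sup>2) \<le> 2 / (a + b)\<^sup>2 * (1 / a\<^sup>2 + 1 / b\<^sup>2)" if "a > 0" "b > 0" for a b :: real
  proof -
    have "(a + b)\<^sup>2 \<le> 2 * (a\<^sup>2 + b\<^sup>2)" using sum_squares_bound[of a b] by (simp add: power2_sum)
    moreover have "1 / a\<^sup>2 + 1 / b\<^sup>2 = (a\<^sup>2 + b\<^sup>2) / (a\<^sup>2 * b\<^sup>2)" using that by (simp add: field_simps)
    ultimately show ?thesis using that by (simp add: divide_simps)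
  qed
  have S: "(\<Sum>i\<le>j. 1 / (real i + 1)\<^sup>2) \<le> 2" using sum_inverse_squares[of j] 
    by (smt (verit) divide_nonneg_nonneg of_nat_0_le_iff)
  have "(\<Sum>i\<le>j. 1 / ((real i + 1)\<^sup>2 * (real (j - i) + 1)\<^sup>2)) \<le>
      (\<Sum>i\<le>j. 2 / (real j + 2)\<^sup>2 * (1 / (real i + 1)\<^sup>2 + 1 / (real (j - i) + 1)\<^sup>2))"
  proof (rule sum_mono)
    fix i assume "i \<in> {..j}"
    hence e: "real i + 1 + (real (j - i) + 1) = real j + 2" by (simp add: of_nat_diff)
    show "1 / ((real i + 1)\<^sup>2 * (real (j - i) + 1)\<^sup>2) \<le> 2 / (real j + 2)\<^sup>2 * (1 / (real i + 1)\<^sup>2 + 1 / (real (j - i) + 1)\<^sup>2)"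
      unfolding e[symmetric] by (rule t) auto
  qed
  also have "\<dots> = 2 / (real j + 2)\<^sup>2 * (2 * (\<Sum>i\<le>j. 1 / (real i + 1)\<^sup>2))"
    by (simp only: sum_distrib_left[symmetric] sum.distrib sum_rev_atMost[of "\<lambda>i. 1 / (real i + 1)\<^sup>2" j] mult_2)
  also have "\<dots> \<le> 2 / (real j + 2)\<^sup>2 * (2 * 2)"
    by (intro mult_left_mono S) auto
  finally show ?thesis by simp
qed

lemma sum_cube_convolution:
  "(\<Sum>i\<le>j. 1 / ((real i + 1)^3 * (real (j - i) + 1)^3)) \<le> 8 / (real j + 1)^3"
proof -
  have "(\<Sum>i\<le>j. 1 / ((real i + 1)^3 * (real (j - i) + 1)^3)) \<le>
      (\<Sum>i\<le>j. 1 / (real j + 1) * (1 / ((real i + 1)\<^sup>2 * (real (j - i) + 1)\<^sup>2)))"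
  proof (rule sum_mono)
    fix i assume "i \<in> {..j}"
    define a b where "a = real i + 1" and "b = real (j - i) + 1"
    have ab: "a \<ge> 1" "b \<ge> 1" "real j + 1 = a + b - 1" using \<open>i \<in> {..j}\<close> by (auto simp: a_def b_def of_nat_diff)
    have "0 \<le> (a - 1) * (b - 1)" using ab by simp
    hence "a + b - 1 \<le> a * b" by (simp add: algebra_simps)
    hence "1 / (a * b) \<le> 1 / (a + b - 1)" using ab by (intro divide_left_mono) auto
    hence "1 / (a * b) * (1 / (a\<^sup>2 * b\<^sup>2)) \<le> 1 / (a + b - 1) * (1 / (a\<^sup>2 * b\<^sup>2))"
      by (intro mult_right_mono) auto
    thus "1 / ((real i + 1)^3 * (real (j - i) + 1)^3) \<le> 1 / (real j + 1) * (1 / ((real i + 1)\<^sup>2 * (real (j - i) + 1)\<^sup>2))"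
      unfolding ab(3) a_def[symmetric] b_def[symmetric] by (simp add: power3_eq_cube power2_eq_square mult_ac)
  qed
  also have "\<dots> \<le> 1 / (real j + 1) * (8 / (real j + 2)\<^sup>2)"
    unfolding sum_distrib_left[symmetric] by (intro mult_left_mono sum_square_convolution) auto
  also have "\<dots> \<le> 1 / (real j + 1) * (8 / (real j + 1)\<^sup>2)"
    by (intro mult_left_mono divide_left_mono power_mono) auto
  finally show ?thesis by (simp add: power3_eq_cube power2_eq_square mult_ac)
qed

lemma wt_pos: "wt j > 0" by (simp add: wt_def)

lemma wt_0 [simp]: "wt 0 = 1" and wt_1 [simp]: "wt (Suc 0) = 1 / 8" by (simp_all add: wt_def)

lemma wt_le_fact: "wt j \<le> fact j"
proof -
  have "(1::real) \<le> (real j + 1) ^ 3" by (rule one_le_power) simp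
  thus ?thesis by (simp add: wt_def divide_simps mult_le_cancel_left1)
qed

lemma fact_le_wt: "fact j \<le> 8 ^ j * wt j"
proof -
  have "real j + 1 \<le> 2 ^ j" by (induction j) (auto intro: order_trans)
  hence "(real j + 1) ^ 3 \<le> (2 ^ j) ^ 3" by (intro power_mono) auto
  also have "\<dots> = 8 ^ j" by (simp add: power_mult[symmetric] mult.commute[of j]) (simp add: power_mult)
  finally show ?thesis by (simp add: wt_def field_simps)
qed

lemma wt_convolution: "(\<Sum>i\<le>j. real (j choose i) * wt i * wt (j - i)) \<le> 8 * wt j"
proof -
  have "(\<Sum>i\<le>j. real (j choose i) * wt i * wt (j - i)) = (\<Sum>i\<le>j. fact j * (1 / ((real i + 1)^3 * (real (j - i) + 1)^3)))"
    by (rule sum.cong) (auto simp: wt_def binomial_fact field_simps)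
  also have "\<dots> \<le> fact j * (8 / (real j + 1)^3)"
    unfolding sum_distrib_left[symmetric] by (intro mult_left_mono sum_cube_convolution) auto
  also have "\<dots> = 8 * wt j" by (simp add: wt_def)
  finally show ?thesis .
qed

lemma fact_ratio_mono:
  assumes "m \<le> n" shows "fact (k + m) * fact n \<le> (fact (k + n) * fact m :: real)"
  using assms
proof (induction n rule: dec_induct)
  case (step n)
  have "fact (k + m) * fact (Suc n) = (real n + 1) * (fact (k + m) * fact n)" by (simp add: algebra_simps)
  also have "\<dots> \<le> (real (k + n) + 1) * (fact (k + n) * fact m)"
    by (intro mult_mono step.IH) auto
  also have "\<dots> = fact (k + Suc n) * fact m" by (simp add: algebra_simps)
  finally show ?case .
qed simp

text \<open>
  The ratio of factorials is at most \<open>(i + 1) / (j + 1)\<close> times the one for \<open>i = j\<close>, whatever \<open>k\<close> is;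
  this eats one power of \<open>i + 1\<close> and reduces the claim to the convolution of squares.
\<close>

lemma wt_compose_convolution:
  "(\<Sum>i\<le>j. real (j choose i) * (fact (Suc k + i) / (real i + 1)^3) * wt (Suc (j - i))) \<le> 16 * fact (Suc k + j) / (real j + 2)^3"
proof -
  have "(\<Sum>i\<le>j. real (j choose i) * (fact (Suc k + i) / (real i + 1)^3) * wt (Suc (j - i))) \<le>
     (\<Sum>i\<le>j. fact (Suc k + j) / (real j + 1) * (1 / ((real i + 1)\<^sup>2 * (real (j - i) + 1)\<^sup>2)))"
  proof (rule sum_mono)
    fix i assume i: "i \<in> {..j}"
    define a b where "a = real i + 1" and "b = real (j - i) + 1"
    have ab: "a > 0" "b > 0" by (auto simp: a_def b_def)
    have "fact (k + Suc i) * fact (Suc j) \<le> (fact (k + Suc j) * fact (Suc i) :: real)"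
      using i by (intro fact_ratio_mono) auto
    hence *: "fact (Suc k + i) * fact j * (real j + 1) \<le> fact (Suc k + j) * fact i * a"
      by (simp add: a_def algebra_simps)
    have "real (j choose i) * (fact (Suc k + i) / (real i + 1)^3) * wt (Suc (j - i)) =
      (fact (Suc k + i) * fact j * (real j + 1)) * (b / (fact i * (real j + 1) * a^3 * (b + 1)^3))"
    proof -
      have 1: "real (j choose i) = fact j / (fact i * fact (j - i))" using i by (simp add: binomial_fact)
      have 2: "wt (Suc (j - i)) = b * fact (j - i) / (b + 1) ^ 3" by (simp add: wt_def b_def add_ac)
      have "real j + 1 > 0" by simp
      have gen: "jf / (fi * fb) * (F / a^3) * (b * fb / (b + 1)^3) = F * jf * J * (b / (fi * J * a^3 * (b + 1)^3))"
        if "fi > 0" "fb > 0" "J > 0" for F fi fb jf J :: real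
        using that by (simp add: divide_simps)
      show ?thesis unfolding a_def[symmetric] 1 2 by (rule gen) auto
    qed
    also have "\<dots> \<le> (fact (Suc k + j) * fact i * a) * (b / (fact i * (real j + 1) * a^3 * (b + 1)^3))"
      using ab by (intro mult_right_mono *) auto
    also have "\<dots> = fact (Suc k + j) / (real j + 1) * (b / (a\<^sup>2 * (b + 1)^3))"
      using ab by (simp add: power3_eq_cube power2_eq_square mult_ac)
    also have "\<dots> \<le> fact (Suc k + j) / (real j + 1) * (1 / (a\<^sup>2 * b\<^sup>2))"
    proof (intro mult_left_mono)
      have "b * b\<^sup>2 \<le> (b + 1)^3" using ab power_mono[of b "b + 1" 3] by (simp add: power3_eq_cube power2_eq_square)
      thus "b / (a\<^sup>2 * (b + 1) ^ 3) \<le> 1 / (a\<^sup>2 * b\<^sup>2)" using ab by (simp add: divide_simps) 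
    qed auto
    finally show "real (j choose i) * (fact (Suc k + i) / (real i + 1)^3) * wt (Suc (j - i)) \<le> fact (Suc k + j) / (real j + 1) * (1 / ((real i + 1)\<^sup>2 * (real (j - i) + 1)\<^sup>2))"
      by (simp add: a_def b_def)
  qed
  also have "\<dots> \<le> fact (Suc k + j) / (real j + 1) * (8 / (real j + 2)\<^sup>2)"
    unfolding sum_distrib_left[symmetric] by (intro mult_left_mono sum_square_convolution) auto
  also have "\<dots> = fact (Suc k + j) * 8 / (real j + 2)\<^sup>2 * (1 / (real j + 1))" by simp
  also have "\<dots> \<le> fact (Suc k + j) * 8 / (real j + 2)\<^sup>2 * (2 / (real j + 2))"
    by (intro mult_left_mono) (auto simp: divide_simps)
  finally show ?thesis by (simp add: power3_eq_cube power2_eq_square mult_ac)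
qed

lemma tame_ge_1: assumes "tame N" shows "N j \<ge> 1"
  using assms incseqD[of N 0 j] by (auto simp: tame_def)

lemma tame_pos: assumes "tame N" shows "N j > 0"
  using tame_ge_1[OF assms, of j] by simp

text \<open>
  Logarithmic convexity, in the form in which divisions are avoided.
\<close>

lemma tame_step: assumes "tame N" "i \<le> j" shows "N (Suc i) * N j \<le> N (Suc j) * N i"
proof -
  have "incseq (\<lambda>j. N (j + 1) / N j)" using assms by (auto simp: tame_def)
  hence "N (i + 1) / N i \<le> N (j + 1) / N j" using assms(2) by (rule incseqD)
  thus ?thesis using tame_pos[OF assms(1)] by (simp add: divide_simps mult.commute)
qed

lemma tame_mult_le: assumes "tame N" shows "N a * N b \<le> N (a + b)"
proof (induction b)
  case 0 thus ?case using assms by (simp add: tame_def)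
next
  case (Suc b)
  have "N b * (N a * N (Suc b)) = N (Suc b) * (N a * N b)" by simp
  also have "\<dots> \<le> N (Suc b) * N (a + b)" using Suc tame_pos[OF assms, of "Suc b"] by (intro mult_left_mono) auto
  also have "\<dots> \<le> N b * N (a + Suc b)" using tame_step[OF assms, of b "a + b"] by (simp add: mult.commute)
  finally show ?case using tame_pos[OF assms, of b] by simp
qed

text \<open>
  The shifted sequence \<open>N\<^sub>j\<^sub>+\<^sub>1 / N\<^sub>1\<close> is again logarithmically convex. The gain of one index over
  the plain product inequality is what makes the chain rule close up, where a derivative of order
  \<open>k + 1\<close> meets an inner derivative of order at least 1.
\<close>

lemma tame_mult_Suc_le: assumes "tame N" shows "N (Suc a) * N (Suc b) \<le> N 1 * N (Suc (a + b))"
proof (induction b)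
  case (Suc b)
  have "N (Suc b) * (N (Suc a) * N (Suc (Suc b))) = N (Suc (Suc b)) * (N (Suc a) * N (Suc b))" by simp
  also have "\<dots> \<le> N (Suc (Suc b)) * (N 1 * N (Suc (a + b)))" using Suc tame_pos[OF assms, of "Suc (Suc b)"] by (intro mult_left_mono) auto
  also have "\<dots> = N 1 * (N (Suc (Suc b)) * N (Suc (a + b)))" by simp
  also have "\<dots> \<le> N 1 * (N (Suc (Suc (a + b))) * N (Suc b))"
    using tame_step[OF assms, of "Suc b" "Suc (a + b)"] tame_pos[OF assms, of 1] by (intro mult_left_mono) auto
  finally show ?case using tame_pos[OF assms, of "Suc b"] by (simp add: mult_ac)
qed simp

lemma tame_const_1: "tame (\<lambda>_. 1)"
  unfolding tame_def by (auto intro!: exI[of _ 1] simp: incseq_def)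

text \<open>
  The two constants play different roles: for flat functions \<open>D\<close> becomes small on small balls,
  whereas \<open>R\<close> stays fixed.
\<close>

definition dc_on :: "('a::real_normed_field^'n::finite) set \<Rightarrow> (nat \<Rightarrow> real) \<Rightarrow> real \<Rightarrow> real \<Rightarrow> ('a^'n \<Rightarrow> 'a) \<Rightarrow> bool" where
  "dc_on U N D R u \<longleftrightarrow> smooth U u \<and>
     (\<forall>x\<in>U. \<forall>l. norm (pds l u x) \<le> D * R ^ length l * wt (length l) * N (length l))"

lemma dc_onD: "dc_on U N D R u \<Longrightarrow> x \<in> U \<Longrightarrow> norm (pds l u x) \<le> D * R ^ length l * wt (length l) * N (length l)"
  and dc_on_smooth: "dc_on U N D R u \<Longrightarrow> smooth U u"
  by (auto simp: dc_on_def)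

lemma dc_on_norm_le: assumes "dc_on U N D R u" "x \<in> U" "tame N" shows "norm (u x) \<le> D"
  using dc_onD[OF assms(1,2), of "[]"] assms(3) by (simp add: tame_def)

lemma dc_on_mono:
  assumes "dc_on U N D R u" "open V" "V \<subseteq> U" "0 \<le> D" "D \<le> D'" "0 \<le> R" "R \<le> R'"
    "\<And>j. 0 \<le> N j" "\<And>j. N j \<le> N' j"
  shows "dc_on V N' D' R' u"
  unfolding dc_on_def
proof (intro conjI ballI allI)
  show "smooth V u" using assms smooth_subset by (auto simp: dc_on_def)
  fix x l assume "x \<in> V"
  hence "norm (pds l u x) \<le> D * R ^ length l * wt (length l) * N (length l)"
    using assms(1,3) by (intro dc_onD[OF assms(1)]) auto
  also have "\<dots> \<le> D' * R' ^ length l * wt (length l) * N' (length l)"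
    using assms wt_pos[of "length l"] by (intro mult_mono power_mono) (auto intro!: mult_nonneg_nonneg less_imp_le)
  finally show "norm (pds l u x) \<le> D' * R' ^ length l * wt (length l) * N' (length l)" .
qed

lemma dc_on_mono_const:
  assumes "dc_on U N D R u" "tame N" "0 \<le> D" "D \<le> D'" "0 \<le> R" "R \<le> R'"
  shows "dc_on U N D' R' u"
  using assms tame_pos[OF assms(2)]
  by (intro dc_on_mono[OF assms(1)]) (auto intro: less_imp_le dest: dc_on_smooth smooth_open)

lemma dc_on_cong:
  assumes "\<And>y. y \<in> U \<Longrightarrow> f y = g y" "dc_on U N D R f"
  shows "dc_on U N D R g"
proof -
  have "smooth U f" using assms(2) by (rule dc_on_smooth)
  hence "smooth U g" "open U" using smooth_cong[of U f g, OF assms(1)] smooth_open by auto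
  moreover have "pds l g x = pds l f x" if "x \<in> U" for l x
    by (rule pds_cong[OF \<open>open U\<close> _ that]) (simp add: assms(1))
  ultimately show ?thesis using assms(2) by (simp add: dc_on_def)
qed

lemma dc_on_add:
  fixes U :: "('a::real_normed_field^'n::finite) set"
  assumes "dc_on U N D R f" "dc_on U N D' R g"
  shows "dc_on U N (D + D') R (\<lambda>x. f x + g x)"
  unfolding dc_on_def
proof (intro conjI ballI allI)
  note s = dc_on_smooth[OF assms(1)] dc_on_smooth[OF assms(2)]
  show "smooth U (\<lambda>x. f x + g x)" by (intro smooth_add s)
  fix x and l :: "'n list" assume x: "x \<in> U"
  have "norm (pds l (\<lambda>x. f x + g x) x) \<le> norm (pds l f x) + norm (pds l g x)"
    by (simp add: smooth_pds_add[OF s x] norm_triangle_ineq)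
  also note add_mono[OF dc_onD[OF assms(1) x, of l] dc_onD[OF assms(2) x, of l]]
  finally show "norm (pds l (\<lambda>x. f x + g x) x) \<le> (D + D') * R ^ length l * wt (length l) * N (length l)"
    by (simp add: algebra_simps)
qed

lemma pd_const: "pd i (\<lambda>x. c) = (\<lambda>x. 0)"
  by (auto simp: has_grad_const)

lemma dc_on_const:
  fixes U :: "('a::real_normed_field^'n::finite) set"
  assumes "open U" "norm c \<le> D" "0 \<le> R" "tame N"
  shows "dc_on U N D R (\<lambda>x. c)"
  unfolding dc_on_def
proof (intro conjI ballI allI)
  show "smooth U (\<lambda>x. c)" by (rule smooth_const[OF assms(1)])
  fix x and l :: "'n list" assume x: "x \<in> U"
  have D: "0 \<le> D" using assms(2) norm_ge_zero order_trans by blast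
  show "norm (pds l (\<lambda>x. c) x) \<le> D * R ^ length l * wt (length l) * N (length l)"
  proof (cases l rule: rev_cases)
    case Nil thus ?thesis using assms by (simp add: tame_def)
  next
    case (snoc l' i)
    have "pd i (\<lambda>x. c) = (\<lambda>x. 0)" by (auto simp: has_grad_const)
    hence "pds l (\<lambda>x. c) x = 0" by (simp add: snoc pds_snoc pds_zero)
    thus ?thesis using D assms wt_pos[of "length l"] tame_pos[OF assms(4), of "length l"] by simp
  qed
qed

lemma dc_on_sum:
  assumes "open U" "0 \<le> R" "tame N" "\<And>i. i \<in> I \<Longrightarrow> dc_on U N (D i) R (f i)"
  shows "dc_on U N (\<Sum>i\<in>I. D i) R (\<lambda>x. \<Sum>i\<in>I. f i x)"
  using assms(4) by (induction I rule: infinite_finite_induct) (auto intro!: dc_on_const dc_on_add assms(1-3))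

text \<open>
  The Leibniz rule together with \<open>N\<^sub>i N\<^sub>j\<^sub>-\<^sub>i \<le> N\<^sub>j\<close> and the stability of the weights: the functions with
  a given \<open>R\<close> form an algebra.
\<close>

lemma dc_on_mult:
  fixes U :: "('a::real_normed_field^'n::finite) set"
  assumes "dc_on U N D R f" "dc_on U N D' R g" "tame N" "0 \<le> D" "0 \<le> D'" "0 \<le> R"
  shows "dc_on U N (8 * D * D') R (\<lambda>x. f x * g x)"
  unfolding dc_on_def
proof (intro conjI ballI allI)
  note s = dc_on_smooth[OF assms(1)] dc_on_smooth[OF assms(2)]
  show "smooth U (\<lambda>x. f x * g x)" by (intro smooth_mult s)
  fix x and l :: "'n list" assume x: "x \<in> U"
  define j where "j = length l"
  have "norm (pds l (\<lambda>x. f x * g x) x) \<le> (\<Sum>i\<le>j. real (j choose i) * (D * R ^ i * wt i * N i) * (D' * R ^ (j - i) * wt (j - i) * N (j - i)))"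
    unfolding j_def by (rule leibniz_bound[OF s x dc_onD[OF assms(1) x] dc_onD[OF assms(2) x]])
  also have "\<dots> \<le> (\<Sum>i\<le>j. D * D' * R ^ j * N j * (real (j choose i) * wt i * wt (j - i)))"
  proof (rule sum_mono)
    fix i assume i: "i \<in> {..j}"
    have "real (j choose i) * (D * R ^ i * wt i * N i) * (D' * R ^ (j - i) * wt (j - i) * N (j - i)) =
      (D * D' * R ^ (i + (j - i)) * (real (j choose i) * wt i * wt (j - i))) * (N i * N (j - i))"
      by (simp add: power_add algebra_simps)
    also have "\<dots> \<le> (D * D' * R ^ (i + (j - i)) * (real (j choose i) * wt i * wt (j - i))) * N (i + (j - i))"
      using assms wt_pos by (intro mult_left_mono tame_mult_le mult_nonneg_nonneg) (auto intro: less_imp_le)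
    finally show "real (j choose i) * (D * R ^ i * wt i * N i) * (D' * R ^ (j - i) * wt (j - i) * N (j - i)) \<le> D * D' * R ^ j * N j * (real (j choose i) * wt i * wt (j - i))"
      using i by (simp add: algebra_simps)
  qed
  also have "\<dots> \<le> D * D' * R ^ j * N j * (8 * wt j)"
    unfolding sum_distrib_left[symmetric] using assms tame_pos[OF assms(3), of j]
    by (intro mult_left_mono wt_convolution) auto
  finally show "norm (pds l (\<lambda>x. f x * g x) x) \<le> 8 * D * D' * R ^ length l * wt (length l) * N (length l)"
    by (simp add: j_def algebra_simps)
qed

lemma dc_on_cmult:
  fixes f :: "'a::real_normed_field^'n::finite \<Rightarrow> 'a"
  assumes "dc_on U N D R f"
  shows "dc_on U N (norm c * D) R (\<lambda>x. c * f x)"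
  unfolding dc_on_def
proof (intro conjI ballI allI)
  note s = dc_on_smooth[OF assms(1)]
  note op = smooth_open[OF s]
  show "smooth U (\<lambda>x. c * f x)" by (intro smooth_mult smooth_const op s)
  fix x and l :: "'n list" assume x: "x \<in> U"
  have "pds l (\<lambda>x. c * f x) x = c * pds l f x" using x
  proof (induction l arbitrary: x)
    case (Cons i l)
    have "pds (i # l) (\<lambda>x. c * f x) x = pd i (\<lambda>x. c * pds l f x) x"
      unfolding pds_Cons by (rule pd_cong[OF op Cons.prems Cons.IH])
    also have "\<dots> = c * pds (i # l) f x"
      using has_grad_mult(2)[OF has_grad_const(1) smooth_has_grad[OF s Cons.prems], of i c l]
      by (simp add: pds_Cons has_grad_const)
    finally show ?case .
  qed simp
  thus "norm (pds l (\<lambda>x. c * f x) x) \<le> norm c * D * R ^ length l * wt (length l) * N (length l)"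
    using mult_left_mono[OF dc_onD[OF assms x, of l], of "norm c"] by (simp add: norm_mult mult_ac)
qed

lemma dc_on_coord:
  fixes U :: "('a::real_normed_field^'n::finite) set"
  assumes "open U" "\<And>x. x \<in> U \<Longrightarrow> norm (x $ i) \<le> s" "8 \<le> R * s" "0 \<le> s" "0 \<le> R" "tame N"
  shows "dc_on U N s R (\<lambda>x. x $ i)"
  unfolding dc_on_def
proof (intro conjI ballI allI)
  show "smooth U (\<lambda>x. x $ i)" by (rule smooth_coord[OF assms(1)])
  fix x :: "'a^'n" and l :: "'n list" assume x: "x \<in> U"
  have p: "pd k (\<lambda>x. x $ i) = (\<lambda>x::'a^'n. if k = i then 1 else 0)" for k by (auto simp: has_grad_coord)
  show "norm (pds l (\<lambda>x. x $ i) x) \<le> s * R ^ length l * wt (length l) * N (length l)"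
  proof (cases l rule: rev_cases)
    case Nil thus ?thesis using assms x by (simp add: tame_def)
  next
    case (snoc l' k)
    show ?thesis
    proof (cases "l' = []")
      case True
      have "8 * 1 \<le> (R * s) * N 1" using assms(3-5) tame_ge_1[OF assms(6), of 1] by (intro mult_mono) auto
      hence "1 \<le> s * R * (1 / 8) * N 1" by (simp add: mult_ac)
      moreover have "norm (pds l (\<lambda>x. x $ i) x) \<le> 1" by (simp add: snoc True pds_Cons p)
      ultimately show ?thesis using snoc True by simp
    next
      case False
      have "pds l (\<lambda>x. x $ i) x = 0"
        using False by (cases l' rule: rev_cases) (simp_all add: snoc pds_append pds_Cons p pd_const pds_zero cong: if_cong)
      thus ?thesis using assms wt_pos[of "length l"] tame_pos[OF assms(6), of "length l"] by simp
    qed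
  qed
qed



text \<open>
  The induction runs over the order of the outer differentiation, simultaneously for all derivatives
  of \<open>f\<close>: the chain rule expresses a derivative of \<open>(D\<^sup>L f) \<circ> \<phi>\<close> by those of \<open>(D\<^sup>s\<^sup>L f) \<circ> \<phi>\<close> of one order
  less. The right invariant is \<open>(k + j)! / (j + 1)\<^sup>3\<close> with \<open>k\<close> the length of \<open>L\<close>. If the derivatives of
  \<open>\<phi>\<close> are small, relative to the growth rate \<open>\<rho>\<close> of those of \<open>f\<close>, the constant \<open>D\<close> of \<open>f\<close> is reproduced exactly, so
  that the bound may be iterated arbitrarily often.
\<close>

lemma compose_bound:
  fixes \<phi> :: "'a::real_normed_field^'n::finite \<Rightarrow> 'a^'m::finite" and f :: "'a^'m \<Rightarrow> 'a"
  assumes \<phi>: "\<And>s. smooth U (\<lambda>x. \<phi> x $ s)" and f: "smooth V f" and UV: "\<And>x. x \<in> U \<Longrightarrow> \<phi> x \<in> V" and x: "x \<in> U"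
    and bf: "\<And>l. norm (pds l f (\<phi> x)) \<le> D * \<rho> ^ length l * fact (length l) * N (length l)"
    and b\<phi>: "\<And>s l. l \<noteq> [] \<Longrightarrow> norm (pds l (\<lambda>x. \<phi> x $ s) x) \<le> \<mu> * R ^ length l * wt (length l) * N (length l)"
    and N: "tame N" and small: "16 * real CARD('m) * N 1 * \<mu> * \<rho> \<le> 1"
    and nn: "0 \<le> D" "0 \<le> \<rho>" "0 \<le> R" "0 \<le> \<mu>"
  shows "norm (pds l (\<lambda>x. f (\<phi> x)) x) \<le> D * R ^ length l * wt (length l) * N (length l)"
proof -
  note op = smooth_open[OF \<phi>]
  have "norm (pds l (\<lambda>x. pds L f (\<phi> x)) x) \<le> D * \<rho> ^ length L * R ^ length l * (fact (length L + length l) / (real (length l) + 1)^3) * N (length L + length l)"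
    if "length l \<le> J" for l L J
    using that
  proof (induction J arbitrary: l L)
    case 0 thus ?case using bf[of L] by simp
  next
    case (Suc J)
    show ?case
    proof (cases l rule: rev_cases)
      case Nil thus ?thesis using bf[of L] by simp
    next
      case (snoc l' i)
      define j k where "j = length l'" and "k = length L"
      have jJ: "j \<le> J" using Suc.prems snoc by (simp add: j_def)
      have T: "norm (pds l' (\<lambda>x. pds (s # L) f (\<phi> x) * pd i (\<lambda>x. \<phi> x $ s) x) x) \<le> 
        D * \<rho> ^ Suc k * \<mu> * R ^ Suc j * N 1 * N (Suc k + j) * (16 * fact (Suc k + j) / (real j + 2)^3)" for s
      proof -
      have "norm (pds l' (\<lambda>x. pds (s # L) f (\<phi> x) * pd i (\<lambda>x. \<phi> x $ s) x) x) \<le>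
        (\<Sum>q\<le>j. real (j choose q) * (D * \<rho> ^ Suc k * R ^ q * (fact (Suc k + q) / (real q + 1)^3) * N (Suc k + q)) *
          (\<mu> * R ^ Suc (j - q) * wt (Suc (j - q)) * N (Suc (j - q))))"
        unfolding j_def k_def
      proof (rule leibniz_bound[OF _ _ x])
        show "smooth U (\<lambda>x. pds (s # L) f (\<phi> x))"
          by (rule smooth_compose[of U \<phi> V, OF \<phi> smooth_pds[OF f] UV])
        show "smooth U (pd i (\<lambda>x. \<phi> x $ s))" by (rule smooth_pd[OF \<phi>])
      next
        fix l'' :: "'n list" assume "length l'' \<le> length l'"
        hence "length l'' \<le> J" using jJ by (simp add: j_def)
        from Suc.IH[OF this, of "s # L"] show "norm (pds l'' (\<lambda>x. pds (s # L) f (\<phi> x)) x)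
             \<le> D * \<rho> ^ Suc (length L) * R ^ length l'' * (fact (Suc (length L) + length l'') / (real (length l'') + 1) ^ 3) * N (Suc (length L) + length l'')"
          by simp
      next
        fix l'' :: "'n list"
        show "norm (pds l'' (pd i (\<lambda>x. \<phi> x $ s)) x) \<le> \<mu> * R ^ Suc (length l'') * wt (Suc (length l'')) * N (Suc (length l''))"
          using b\<phi>[of "l'' @ [i]" s] by (simp add: pds_snoc)
      qed
      also have "\<dots> \<le> (\<Sum>q\<le>j. D * \<rho> ^ Suc k * \<mu> * R ^ Suc j * N 1 * N (Suc k + j) *
          (real (j choose q) * (fact (Suc k + q) / (real q + 1)^3) * wt (Suc (j - q))))"
      proof (rule sum_mono)
        fix q assume q: "q \<in> {..j}"
        have NN: "N (Suc k + q) * N (Suc (j - q)) \<le> N 1 * N (Suc k + j)"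
          using tame_mult_Suc_le[OF N, of "k + q" "j - q"] q by simp
        have "real (j choose q) * (D * \<rho> ^ Suc k * R ^ q * (fact (Suc k + q) / (real q + 1)^3) * N (Suc k + q)) *
          (\<mu> * R ^ Suc (j - q) * wt (Suc (j - q)) * N (Suc (j - q))) =
          (D * \<rho> ^ Suc k * \<mu> * R ^ (q + Suc (j - q)) * (real (j choose q) * (fact (Suc k + q) / (real q + 1)^3) * wt (Suc (j - q)))) * (N (Suc k + q) * N (Suc (j - q)))"
          unfolding power_add by (simp only: mult_ac)
        also have "\<dots> \<le> (D * \<rho> ^ Suc k * \<mu> * R ^ (q + Suc (j - q)) * (real (j choose q) * (fact (Suc k + q) / (real q + 1)^3) * wt (Suc (j - q)))) * (N 1 * N (Suc k + j))"
          using nn wt_pos by (intro mult_left_mono NN mult_nonneg_nonneg) (auto intro: less_imp_le)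
        also have "q + Suc (j - q) = Suc j" using q by simp
        finally show "real (j choose q) * (D * \<rho> ^ Suc k * R ^ q * (fact (Suc k + q) / (real q + 1)^3) * N (Suc k + q)) *
          (\<mu> * R ^ Suc (j - q) * wt (Suc (j - q)) * N (Suc (j - q))) \<le> D * \<rho> ^ Suc k * \<mu> * R ^ Suc j * N 1 * N (Suc k + j) *
          (real (j choose q) * (fact (Suc k + q) / (real q + 1)^3) * wt (Suc (j - q)))"
          by (simp only: mult_ac)
      qed
      also have "\<dots> \<le> D * \<rho> ^ Suc k * \<mu> * R ^ Suc j * N 1 * N (Suc k + j) * (16 * fact (Suc k + j) / (real j + 2)^3)"
        unfolding sum_distrib_left[symmetric] using nn tame_pos[OF N] 
        by (intro mult_left_mono wt_compose_convolution mult_nonneg_nonneg) (auto intro: less_imp_le)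
      finally show ?thesis .
      qed
      have "pds l (\<lambda>x. pds L f (\<phi> x)) x = pds l' (\<lambda>x. \<Sum>s\<in>UNIV. pds (s # L) f (\<phi> x) * pd i (\<lambda>x. \<phi> x $ s) x) x"
        unfolding snoc pds_snoc
      proof (rule pds_cong[OF op _ x])
        fix y assume y: "y \<in> U"
        show "pd i (\<lambda>x. pds L f (\<phi> x)) y = (\<Sum>s\<in>UNIV. pds (s # L) f (\<phi> y) * pd i (\<lambda>x. \<phi> x $ s) y)"
          unfolding pds_Cons by (rule has_grad_compose(2)[OF smooth_has_grad0[OF \<phi> y] smooth_has_grad[OF f UV[OF y]]])
      qed
      also have "\<dots> = (\<Sum>s\<in>UNIV. pds l' (\<lambda>x. pds (s # L) f (\<phi> x) * pd i (\<lambda>x. \<phi> x $ s) x) x)"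
      proof (rule smooth_pds_sum[OF op _ x])
        fix s
        show "smooth U (\<lambda>x. pds (s # L) f (\<phi> x) * pd i (\<lambda>x. \<phi> x $ s) x)"
          by (rule smooth_mult[OF smooth_compose[of U \<phi> V, OF \<phi> smooth_pds[OF f] UV] smooth_pd[OF \<phi>]])
      qed
      finally have "norm (pds l (\<lambda>x. pds L f (\<phi> x)) x) \<le> (\<Sum>s\<in>(UNIV::'m set). D * \<rho> ^ Suc k * \<mu> * R ^ Suc j * N 1 * N (Suc k + j) * (16 * fact (Suc k + j) / (real j + 2)^3))"
        by (simp only:) (rule sum_norm_le, rule T)
      also have "\<dots> = (16 * real CARD('m) * N 1 * \<mu> * \<rho>) * (D * \<rho> ^ k * R ^ Suc j * (fact (Suc k + j) / (real j + 2)^3) * N (Suc k + j))"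
        by (simp add: mult_ac del: fact_Suc)
      also have "\<dots> \<le> 1 * (D * \<rho> ^ k * R ^ Suc j * (fact (Suc k + j) / (real j + 2)^3) * N (Suc k + j))"
        using nn tame_pos[OF N] by (intro mult_right_mono small mult_nonneg_nonneg) (auto intro: less_imp_le)
      finally show ?thesis
      proof -
        have len: "length l = Suc j" "real (Suc j) + 1 = real j + 2" by (simp_all add: snoc j_def)
        assume "norm (pds l (\<lambda>x. pds L f (\<phi> x)) x) \<le> 1 * (D * \<rho> ^ k * R ^ Suc j * (fact (Suc k + j) / (real j + 2)^3) * N (Suc k + j))"
        thus ?thesis unfolding len k_def[symmetric] by (simp only: mult_1 add_Suc add_Suc_right)
      qed
    qed
  qed
  from this[of l "length l" "[]"] show ?thesis by (simp add: wt_def)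
qed

section \<open>Limits of smooth functions and symmetry of derivatives\<close>

lemma norm_vec_nth_le: "norm ((h::'a::real_normed_field^'n::finite) $ i) \<le> norm h"
  by (rule Finite_Cartesian_Product.norm_nth_le)

lemma linear_form_bound:
  fixes c :: "'n::finite \<Rightarrow> 'a::real_normed_field"
  assumes "\<And>i. norm (c i) \<le> B"
  shows "norm (\<Sum>i\<in>UNIV. h $ i * c i) \<le> real CARD('n) * B * norm h"
proof -
  have B: "0 \<le> B" using assms norm_ge_zero order_trans by blast
  have "norm (\<Sum>i\<in>UNIV. h $ i * c i) \<le> (\<Sum>i\<in>(UNIV::'n set). norm h * B)"
    using assms by (intro sum_norm_le) (auto simp: norm_mult intro!: mult_mono norm_vec_nth_le B)
  thus ?thesis by (simp add: mult_ac)
qed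

lemma bounded_linear_form:
  fixes c :: "'n::finite \<Rightarrow> 'a::real_normed_field"
  shows "bounded_linear (\<lambda>h. \<Sum>i\<in>UNIV. h $ i * c i)"
  by (intro bounded_linear_sum bounded_linear_mult_const bounded_linear_vec_nth)

lemma gradient_lipschitz:
  fixes f :: "'a::real_normed_field^'n::finite \<Rightarrow> 'a"
  assumes "convex S" "\<And>z. z \<in> S \<Longrightarrow> (f has_derivative (\<lambda>h. \<Sum>i\<in>UNIV. h $ i * c z i)) (at z)"
    and "\<And>z i. z \<in> S \<Longrightarrow> norm (c z i) \<le> B" "x \<in> S" "y \<in> S"
  shows "norm (f y - f x) \<le> real CARD('n) * B * norm (y - x)"
proof (rule differentiable_bound[OF assms(1) _ _ assms(5,4)])
  show "(f has_derivative (\<lambda>h. \<Sum>i\<in>UNIV. h $ i * c z i)) (at z within S)" if "z \<in> S" for z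
    using assms(2)[OF that] by (rule has_derivative_at_withinI)
  show "onorm (\<lambda>h. \<Sum>i\<in>UNIV. h $ i * c z i) \<le> real CARD('n) * B" if "z \<in> S" for z
    by (rule onorm_le) (rule linear_form_bound[OF assms(3)[OF that]])
qed

lemma smooth_lipschitz:
  fixes f :: "'a::real_normed_field^'n::finite \<Rightarrow> 'a"
  assumes "convex S" "\<And>z. z \<in> S \<Longrightarrow> has_grad f z" "\<And>z i. z \<in> S \<Longrightarrow> norm (pd i f z) \<le> B" "x \<in> S" "y \<in> S"
  shows "norm (f y - f x) \<le> real CARD('n) * B * norm (y - x)"
  using assms by (intro gradient_lipschitz[where c="\<lambda>z i. pd i f z"]) (auto simp: has_grad_def)

text \<open>
  The function minus its linear part at \<open>x\<close> has a gradient that is itself Lipschitz and vanishes at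
  \<open>x\<close>.
\<close>

lemma taylor_second_order:
  fixes f :: "'a::real_normed_field^'n::finite \<Rightarrow> 'a"
  assumes S: "convex S" and f: "\<And>z. z \<in> S \<Longrightarrow> has_grad f z" "\<And>z i. z \<in> S \<Longrightarrow> has_grad (pd i f) z"
    and B: "\<And>z i j. z \<in> S \<Longrightarrow> norm (pd j (pd i f) z) \<le> B" and xy: "x \<in> S" "y \<in> S"
  shows "norm (f y - f x - (\<Sum>i\<in>UNIV. (y - x) $ i * pd i f x)) \<le> (real CARD('n))\<^sup>2 * B * (norm (y - x))\<^sup>2"
proof -
  define c where "c i = pd i f x" for i
  define S' where "S' = S \<inter> cball x (norm (y - x))"
  have B0: "0 \<le> B" using B[OF xy(1)] norm_ge_zero order_trans by blast
  have "norm ((f y - (\<Sum>i\<in>UNIV. y $ i * c i)) - (f x - (\<Sum>i\<in>UNIV. x $ i * c i))) \<le> real CARD('n) * (real CARD('n) * B * norm (y - x)) * norm (y - x)"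
  proof (rule gradient_lipschitz[where S=S' and c="\<lambda>z i. pd i f z - c i"])
    show "convex S'" using S by (auto simp: S'_def intro: convex_Int)
    show "((\<lambda>z. f z - (\<Sum>i\<in>UNIV. z $ i * c i)) has_derivative (\<lambda>h. \<Sum>i\<in>UNIV. h $ i * (pd i f z - c i))) (at z)"
      if "z \<in> S'" for z
    proof -
      have "((\<lambda>z. f z - (\<Sum>i\<in>UNIV. z $ i * c i)) has_derivative (\<lambda>h. (\<Sum>i\<in>UNIV. h $ i * pd i f z) - (\<Sum>i\<in>UNIV. h $ i * c i))) (at z)"
        using f(1)[of z] that
        by (intro has_derivative_diff bounded_linear_imp_has_derivative bounded_linear_form) (auto simp: has_grad_def S'_def)
      thus ?thesis by (simp add: right_diff_distrib sum_subtractf)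
    qed
    show "norm (pd i f z - c i) \<le> real CARD('n) * B * norm (y - x)" if "z \<in> S'" for z i
    proof -
      have "norm (pd i f z - c i) \<le> real CARD('n) * B * norm (z - x)" unfolding c_def
        using that by (intro smooth_lipschitz[OF S f(2) B]) (auto simp: S'_def xy)
      also have "\<dots> \<le> real CARD('n) * B * norm (y - x)"
        using that B0 by (intro mult_left_mono) (auto simp: S'_def dist_norm norm_minus_commute)
      finally show ?thesis .
    qed
    show "x \<in> S'" "y \<in> S'" using xy by (auto simp: S'_def dist_norm norm_minus_commute)
  qed
  moreover have "(f y - (\<Sum>i\<in>UNIV. y $ i * c i)) - (f x - (\<Sum>i\<in>UNIV. x $ i * c i)) = f y - f x - (\<Sum>i\<in>UNIV. (y - x) $ i * pd i f x)"
    by (simp add: c_def left_diff_distrib sum_subtractf)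
  ultimately show ?thesis by (simp only: power2_eq_square mult_ac)
qed

lemma has_derivative_quadratic:
  assumes "bounded_linear L" "e > 0" "\<And>y. y \<in> ball x e \<Longrightarrow> norm (w y - w x - L (y - x)) \<le> C * (norm (y - x))\<^sup>2"
  shows "(w has_derivative L) (at x)"
proof (rule has_derivativeI_sandwich[OF assms(2,1)])
  show "norm (w y - w x - L (y - x)) / norm (y - x) \<le> C * norm (y - x)" if "y \<noteq> x" "dist y x < e" for y
    using assms(3)[of y] that by (simp add: dist_commute divide_simps power2_eq_square)
  have "((\<lambda>y. C * norm (y - x)) \<longlongrightarrow> C * norm (x - x)) (at x)" by (intro tendsto_intros)
  thus "((\<lambda>y. C * norm (y - x)) \<longlongrightarrow> 0) (at x)" by simp
qed

text \<open>
  A bound on the second derivatives turns difference quotients into uniform approximations of the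
  first derivatives. Hence the derivatives at a point converge as soon as the values do, and the
  quadratic Taylor estimate passes to the limit.
\<close>

lemma limit_has_grad:
  fixes w :: "nat \<Rightarrow> ('a::{real_normed_field,banach}^'n::finite) \<Rightarrow> 'a"
  assumes U: "open U" "x \<in> U" and w: "\<And>k z. z \<in> U \<Longrightarrow> has_grad (w k) z" "\<And>k z i. z \<in> U \<Longrightarrow> has_grad (pd i (w k)) z"
    and B: "\<And>k z i j. z \<in> U \<Longrightarrow> norm (pd j (pd i (w k)) z) \<le> B"
    and lim: "\<And>z. z \<in> U \<Longrightarrow> (\<lambda>k. w k z) \<longlonglongrightarrow> v z"
  shows "has_grad v x \<and> (\<lambda>k. pd i (w k) x) \<longlonglongrightarrow> pd i v x"
proof -
  obtain e where e: "e > 0" "ball x e \<subseteq> U" using U by (auto simp: open_contains_ball)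
  define C where "C = (real CARD('n))\<^sup>2 * B"
  have B0: "0 \<le> B" using B[OF U(2)] norm_ge_zero order_trans by blast
  hence C0: "C \<ge> 0" by (simp add: C_def)
  have T: "norm (w k y - w k x - (\<Sum>i\<in>UNIV. (y - x) $ i * pd i (w k) x)) \<le> C * (norm (y - x))\<^sup>2" if "y \<in> ball x e" for k y
    unfolding C_def using e that by (intro taylor_second_order[of "ball x e"] w B) auto
  have "Cauchy (\<lambda>k. pd i (w k) x)" for i
  proof (rule CauchyI)
    fix \<epsilon> :: real assume \<epsilon>: "\<epsilon> > 0"
    \<comment> \<open>a step for which the Taylor error of the difference quotient is at most a quarter of \<open>\<epsilon>\<close>\<close>
    define t where "t = min (e / 2) (\<epsilon> / (4 * (C + 1)))"
    have t: "t > 0" "t < e" using e \<epsilon> C0 by (auto simp: t_def min_less_iff_disj)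
    have "C * t \<le> (C + 1) * (\<epsilon> / (4 * (C + 1)))" using C0 t by (intro mult_mono) (auto simp: t_def)
    also have "c1 * (\<epsilon> / (4 * c1)) = \<epsilon> / 4" if "c1 > 0" for c1 :: real using that by simp
    from this[of "C + 1"] have "(C + 1) * (\<epsilon> / (4 * (C + 1))) = \<epsilon> / 4" using C0 by simp
    finally have Ct: "C * t \<le> \<epsilon> / 4" .
    define y where "y = x + axis i (of_real t :: 'a)"
    have ny: "norm (y - x) = t" using t by (simp add: y_def norm_axis)
    have y: "y \<in> ball x e" using t ny by (simp add: dist_norm norm_minus_commute)
    have T1: "norm (w k y - w k x - of_real t * pd i (w k) x) \<le> C * t\<^sup>2" for k
      using T[OF y, of k] unfolding ny by (simp add: y_def sum_axis_mult)
    have "(\<lambda>k. w k y - w k x) \<longlonglongrightarrow> v y - v x"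
      using e y by (intro tendsto_diff lim U(2)) auto
    hence "Cauchy (\<lambda>k. w k y - w k x)" by (rule LIMSEQ_imp_Cauchy)
    then obtain K where K: "\<And>m n. m \<ge> K \<Longrightarrow> n \<ge> K \<Longrightarrow> norm ((w m y - w m x) - (w n y - w n x)) < \<epsilon> * t / 4"
      using CauchyD[of "\<lambda>k. w k y - w k x" "\<epsilon> * t / 4"] \<epsilon> t by auto
    have "norm (pd i (w m) x - pd i (w n) x) < \<epsilon>" if "m \<ge> K" "n \<ge> K" for m n
    proof -
      have eq: "of_real t * (pd i (w m) x - pd i (w n) x) =
        ((w m y - w m x) - (w n y - w n x)) - (w m y - w m x - of_real t * pd i (w m) x) + (w n y - w n x - of_real t * pd i (w n) x)"
        by (simp add: algebra_simps)
      have "t * norm (pd i (w m) x - pd i (w n) x) = norm (of_real t * (pd i (w m) x - pd i (w n) x))"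
        using t by (simp add: norm_mult)
      also have "\<dots> \<le> norm ((w m y - w m x) - (w n y - w n x)) + norm (w m y - w m x - of_real t * pd i (w m) x) + norm (w n y - w n x - of_real t * pd i (w n) x)"
        unfolding eq by (intro norm_triangle_le add_right_mono norm_triangle_ineq4)
      also have "\<dots> < \<epsilon> * t / 4 + C * t\<^sup>2 + C * t\<^sup>2"
        using K[OF that] T1[of m] T1[of n] by simp
      also have "\<dots> = t * (\<epsilon> / 4 + 2 * (C * t))" by (simp add: power2_eq_square algebra_simps)
      also have "\<dots> \<le> t * (\<epsilon> / 4 + 2 * (\<epsilon> / 4))" using Ct t by (intro mult_left_mono add_left_mono) auto
      also have "\<dots> \<le> t * \<epsilon>" using t \<epsilon> by simp
      finally show ?thesis using t by simp
    qed
    thus "\<exists>M. \<forall>m\<ge>M. \<forall>n\<ge>M. norm (pd i (w m) x - pd i (w n) x) < \<epsilon>" by blast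
  qed
  hence "\<forall>i. \<exists>c. (\<lambda>k. pd i (w k) x) \<longlonglongrightarrow> c" using Cauchy_convergent_iff convergent_def by blast
  then obtain c where c: "\<And>i. (\<lambda>k. pd i (w k) x) \<longlonglongrightarrow> c i" by metis
  have *: "(v has_derivative (\<lambda>h. \<Sum>i\<in>UNIV. h $ i * c i)) (at x)"
  proof (rule has_derivative_quadratic[OF bounded_linear_form e(1)])
    fix y assume y: "y \<in> ball x e"
    have "(\<lambda>k. norm (w k y - w k x - (\<Sum>i\<in>UNIV. (y - x) $ i * pd i (w k) x))) \<longlonglongrightarrow> norm (v y - v x - (\<Sum>i\<in>UNIV. (y - x) $ i * c i))"
      using e y U by (intro tendsto_intros lim c) auto
    thus "norm (v y - v x - (\<Sum>i\<in>UNIV. (y - x) $ i * c i)) \<le> C * (norm (y - x))\<^sup>2"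
      by (rule LIMSEQ_le_const2) (use T[OF y] in auto)
  qed
  show ?thesis using has_gradI[OF *] pd_eqI[OF *] c by simp
qed

text \<open>
  Pointwise convergence suffices, because the uniform bounds on all derivatives let the previous
  lemma climb from each order to the next.
\<close>

lemma smooth_limit:
  fixes w :: "nat \<Rightarrow> ('a::{real_normed_field,banach}^'n::finite) \<Rightarrow> 'a"
  assumes U: "open U" and w: "\<And>k. smooth U (w k)"
    and B: "\<And>k z l. z \<in> U \<Longrightarrow> norm (pds l (w k) z) \<le> B l"
    and lim: "\<And>z. z \<in> U \<Longrightarrow> (\<lambda>k. w k z) \<longlonglongrightarrow> v z"
  shows "smooth U v" and "z \<in> U \<Longrightarrow> (\<lambda>k. pds l (w k) z) \<longlonglongrightarrow> pds l v z"
proof -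
  have step: "has_grad (pds l v) z \<and> (\<forall>i. (\<lambda>k. pds (i # l) (w k) z) \<longlonglongrightarrow> pds (i # l) v z)"
    if "\<And>z. z \<in> U \<Longrightarrow> (\<lambda>k. pds l (w k) z) \<longlonglongrightarrow> pds l v z" "z \<in> U" for l z
  proof -
    define Bm where "Bm = Max (range (\<lambda>(i, j). B (j # i # l)))"
    have Bm: "B (j # i # l) \<le> Bm" for i j
      unfolding Bm_def by (rule Max_ge) (auto intro!: image_eqI[of _ _ "(i, j)"])
    have "has_grad (pds l v) z \<and> (\<lambda>k. pd i (pds l (w k)) z) \<longlonglongrightarrow> pd i (pds l v) z" for i
    proof (rule limit_has_grad[OF U that(2) _ _ _ that(1)])
      show "has_grad (pds l (w k)) z" if "z \<in> U" for k z by (rule smooth_has_grad[OF w that])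
      show "has_grad (pd i (pds l (w k))) z" if "z \<in> U" for k z i
        using smooth_has_grad[OF w that, of "i # l" k] by (simp add: pds_Cons)
      show "norm (pd j (pd i (pds l (w k))) z) \<le> Bm" if "z \<in> U" for k z i j
        using order_trans[OF B[OF that, of "j # i # l" k] Bm] by (simp add: pds_Cons)
    qed auto
    thus ?thesis by (simp add: pds_Cons)
  qed
  have L: "(\<lambda>k. pds l (w k) z) \<longlonglongrightarrow> pds l v z" if "z \<in> U" for l z
    using that
  proof (induction l arbitrary: z)
    case Nil thus ?case using lim by simp
  next
    case (Cons i l) thus ?case using step by blast
  qed
  show "smooth U v" unfolding smooth_def using U step[OF L] by blast
  show "(\<lambda>k. pds l (w k) z) \<longlonglongrightarrow> pds l v z" if "z \<in> U" by (rule L[OF that])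
qed

lemma dc_on_limit:
  fixes w :: "nat \<Rightarrow> ('a::{real_normed_field,banach}^'n::finite) \<Rightarrow> 'a"
  assumes U: "open U" and w: "\<And>k. dc_on U N D R (w k)"
    and lim: "\<And>z. z \<in> U \<Longrightarrow> (\<lambda>k. w k z) \<longlonglongrightarrow> v z"
  shows "dc_on U N D R v"
proof -
  define B where "B l = D * R ^ length l * wt (length l) * N (length l)" for l :: "'n list"
  have B: "norm (pds l (w k) z) \<le> B l" if "z \<in> U" for k z l
    unfolding B_def by (rule dc_onD[OF w that])
  have s: "smooth U v"
    by (rule smooth_limit(1)[of U w B v]) (use U dc_on_smooth[OF w] B lim in auto)
  have "norm (pds l v z) \<le> B l" if z: "z \<in> U" for z l
  proof -
    have "(\<lambda>k. pds l (w k) z) \<longlonglongrightarrow> pds l v z"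
      by (rule smooth_limit(2)[of U w B v]) (use U dc_on_smooth[OF w] B lim z in auto)
    from tendsto_norm[OF this] show ?thesis by (rule LIMSEQ_le_const2) (use B z in auto)
  qed
  thus ?thesis using s by (simp add: dc_on_def B_def)
qed

text \<open>
  The mixed difference is symmetric in \<open>i\<close> and \<open>j\<close>, while two applications of the mean value theorem
  turn it into a value of \<open>\<partial>\<^sub>i \<partial>\<^sub>j f\<close> nearby.
\<close>

lemma second_difference:
  fixes f :: "real^'n::finite \<Rightarrow> real"
  assumes U: "open U" "x \<in> U" and f: "smooth U f" "i \<noteq> j"
    and "\<epsilon> > 0"
  shows "\<exists>\<delta>>0. \<forall>t. 0 < t \<and> t < \<delta> \<longrightarrow>
    \<bar>(f (x + axis i t + axis j t) - f (x + axis i t) - f (x + axis j t) + f x) / t\<^sup>2 - pd i (pd j f) x\<bar> \<le> \<epsilon>"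
proof -
  have s: "smooth U (pd i (pd j f))" by (intro smooth_pd f)
  have "continuous (at x) (pd i (pd j f))" using has_grad_isCont[OF smooth_has_grad0[OF s U(2)]] .
  then obtain d where d: "d > 0" "\<And>y. dist y x < d \<Longrightarrow> dist (pd i (pd j f) y) (pd i (pd j f) x) < \<epsilon>"
    using assms(5) unfolding continuous_at_eps_delta by blast
  obtain e where e: "e > 0" "ball x e \<subseteq> U" using U by (auto simp: open_contains_ball)
  define \<delta> where "\<delta> = min d e / 3"
  have "\<bar>(f (x + axis i t + axis j t) - f (x + axis i t) - f (x + axis j t) + f x) / t\<^sup>2 - pd i (pd j f) x\<bar> \<le> \<epsilon>"
    if t: "0 < t" "t < \<delta>" for t
  proof -
    have near: "dist (x + axis i a + axis j b) x < min d e" if "0 \<le> a" "a \<le> t" "0 \<le> b" "b \<le> t" for a b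
    proof -
      have "dist (x + axis i a + axis j b) x \<le> norm (axis i a) + norm (axis j b)"
        unfolding dist_norm using norm_triangle_ineq[of "axis i a" "axis j b"] by (simp add: algebra_simps)
      also have "\<dots> < min d e" using that t d e by (auto simp: norm_axis \<delta>_def)
      finally show ?thesis .
    qed
    have inU: "x + axis i a + axis j b \<in> U" if "0 \<le> a" "a \<le> t" "0 \<le> b" "b \<le> t" for a b
      using near[OF that] e by (auto simp: dist_commute subset_iff)
    have D1: "((\<lambda>b. f (x + axis i a + axis j b)) has_real_derivative pd j f (x + axis i a + axis j b)) (at b)"
      if "0 \<le> a" "a \<le> t" "0 \<le> b" "b \<le> t" for a b
      using field_deriv_axis[OF smooth_has_grad0[OF f(1) inU[OF that], unfolded has_grad_def]] .
    have ax0: "axis k 0 = (0::real^'n)" for k by (simp add: axis_def zero_vec_def)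
    define F where "F b = f (x + axis i t + axis j b) - f (x + axis j b)" for b
    have "(F has_real_derivative (pd j f (x + axis i t + axis j b) - pd j f (x + axis j b))) (at b)" if "0 \<le> b" "b \<le> t" for b
      unfolding F_def using D1[of t b] D1[of 0 b] t that by (auto intro!: DERIV_diff simp: ax0)
    from MVT2[OF t(1), of F, OF this] obtain b where b: "0 < b" "b < t"
      "F t - F 0 = (t - 0) * (pd j f (x + axis i t + axis j b) - pd j f (x + axis j b))" by auto
    have "((\<lambda>a. pd j f (x + axis j b + axis i a)) has_real_derivative pd i (pd j f) (x + axis j b + axis i a)) (at a)"
      if "0 \<le> a" "a \<le> t" for a
      using field_deriv_axis[OF smooth_has_grad0[OF smooth_pd[OF f(1)], unfolded has_grad_def], of "x + axis j b" i a j]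
        inU[of a b] b that by (simp add: add_ac)
    from MVT2[OF t(1), of "\<lambda>a. pd j f (x + axis j b + axis i a)", OF this] obtain a where a: "0 < a" "a < t"
      "pd j f (x + axis j b + axis i t) - pd j f (x + axis j b + axis i 0) = (t - 0) * pd i (pd j f) (x + axis j b + axis i a)" by auto
    have "F t - F 0 = t\<^sup>2 * pd i (pd j f) (x + axis i a + axis j b)"
      using a(3) b(3) by (simp add: ax0 add_ac power2_eq_square)
    hence "(f (x + axis i t + axis j t) - f (x + axis i t) - f (x + axis j t) + f x) / t\<^sup>2 = pd i (pd j f) (x + axis i a + axis j b)"
      using t by (simp add: F_def ax0 field_simps)
    thus ?thesis using d(2)[of "x + axis i a + axis j b"] near[of a b] a b by (simp add: dist_real_def)
  qed
  moreover have "\<delta> > 0" using d e by (simp add: \<delta>_def)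
  ultimately show ?thesis by blast
qed

lemma pd_commute:
  fixes f :: "real^'n::finite \<Rightarrow> real"
  assumes "smooth U f" "x \<in> U"
  shows "pd i (pd j f) x = pd j (pd i f) x"
proof (cases "i = j")
  case False
  note U = smooth_open[OF assms(1)] assms(2)
  show ?thesis
  proof (rule ccontr)
    assume ne: "pd i (pd j f) x \<noteq> pd j (pd i f) x"
    define \<epsilon> where "\<epsilon> = \<bar>pd i (pd j f) x - pd j (pd i f) x\<bar> / 3"
    have \<epsilon>: "\<epsilon> > 0" using ne by (simp add: \<epsilon>_def)
    obtain d1 where d1: "d1 > 0" "\<And>t. 0 < t \<Longrightarrow> t < d1 \<Longrightarrow> \<bar>(f (x + axis i t + axis j t) - f (x + axis i t) - f (x + axis j t) + f x) / t\<^sup>2 - pd i (pd j f) x\<bar> \<le> \<epsilon>"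
      using second_difference[OF U assms(1) False \<epsilon>] by blast
    obtain d2 where d2: "d2 > 0" "\<And>t. 0 < t \<Longrightarrow> t < d2 \<Longrightarrow> \<bar>(f (x + axis j t + axis i t) - f (x + axis j t) - f (x + axis i t) + f x) / t\<^sup>2 - pd j (pd i f) x\<bar> \<le> \<epsilon>"
      using second_difference[OF U assms(1) False[symmetric] \<epsilon>] by blast
    define t where "t = min d1 d2 / 2"
    have t: "0 < t" "t < d1" "t < d2" using d1(1) d2(1) by (auto simp: t_def)
    define q where "q = (f (x + axis i t + axis j t) - f (x + axis i t) - f (x + axis j t) + f x) / t\<^sup>2"
    have e: "f (x + axis j t + axis i t) - f (x + axis j t) - f (x + axis i t) + f x =
        f (x + axis i t + axis j t) - f (x + axis i t) - f (x + axis j t) + f x"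
      by (simp add: add_ac)
    have "\<bar>q - pd i (pd j f) x\<bar> \<le> \<epsilon>" "\<bar>q - pd j (pd i f) x\<bar> \<le> \<epsilon>"
      unfolding q_def by (rule d1(2)[OF t(1,2)], rule d2(2)[OF t(1,3), unfolded e])
    hence "\<bar>pd i (pd j f) x - pd j (pd i f) x\<bar> \<le> 2 * \<epsilon>" by linarith
    thus False using \<epsilon> by (simp add: \<epsilon>_def)
  qed
qed simp

lemma pds_move:
  fixes f :: "real^'n::finite \<Rightarrow> real"
  assumes "smooth U f" "x \<in> U"
  shows "pds (l @ i # l') f x = pds (i # l @ l') f x"
  using assms(2)
proof (induction l arbitrary: x)
  case (Cons j l)
  have "pds ((j # l) @ i # l') f x = pd j (pds (i # l @ l') f) x"
    unfolding append_Cons pds_Cons[of j] by (rule pd_cong[OF smooth_open[OF assms(1)] Cons.prems Cons.IH])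
  also have "\<dots> = pd i (pds (j # l @ l') f) x"
    unfolding pds_Cons by (rule pd_commute[OF smooth_pds[OF assms(1)] Cons.prems])
  finally show ?case by (simp add: pds_Cons)
qed simp

lemma pds_perm:
  fixes f :: "real^'n::finite \<Rightarrow> real"
  assumes "smooth U f" "x \<in> U" "mset l = mset l'"
  shows "pds l f x = pds l' f x"
  using assms(2,3)
proof (induction l arbitrary: x l')
  case (Cons i l)
  have "i \<in> set l'" using Cons.prems(2) by (metis list.set_intros(1) set_mset_mset)
  then obtain a b where l': "l' = a @ i # b" by (auto simp: in_set_conv_decomp)
  hence m: "mset l = mset (a @ b)" using Cons.prems(2) by simp
  have "pds (i # l) f x = pd i (pds (a @ b) f) x"
    unfolding pds_Cons by (rule pd_cong[OF smooth_open[OF assms(1)] Cons.prems(1) Cons.IH[OF _ m]])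
  also have "\<dots> = pds l' f x" using pds_move[OF assms(1) Cons.prems(1), of a i b] by (simp add: l' pds_Cons)
  finally show ?case .
qed simp

section \<open>Analytic germs\<close>

text \<open>
  Two finite partial sums that differ in a single term are both close to the limit.
\<close>

lemma has_sum_terms_bounded:
  fixes f :: "'i \<Rightarrow> 'a::real_normed_vector"
  assumes "(f has_sum s) UNIV"
  obtains B where "B > 0" "\<And>J. norm (f J) \<le> B"
proof -
  have "eventually (\<lambda>F. dist (sum f F) s < 1 / 2) (finite_subsets_at_top UNIV)"
    using assms unfolding has_sum_def by (rule tendstoD) simp
  then obtain X where X: "finite X" "\<And>F. finite F \<Longrightarrow> X \<subseteq> F \<Longrightarrow> dist (sum f F) s < 1 / 2"
    unfolding eventually_finite_subsets_at_top by auto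
  have "norm (f J) \<le> 1 + (\<Sum>J\<in>X. norm (f J))" for J
  proof (cases "J \<in> X")
    case True
    hence "norm (f J) \<le> (\<Sum>J\<in>X. norm (f J))" using X(1) by (intro member_le_sum) auto
    thus ?thesis by simp
  next
    case False
    have "f J = sum f (insert J X) - sum f X" using False X(1) by simp
    hence "norm (f J) \<le> dist (sum f (insert J X)) s + dist (sum f X) s"
      by (metis dist_norm dist_triangle2)
    also have "\<dots> \<le> 1"
      using X(2)[OF finite.insertI[OF X(1)] subset_insertI, of J] X(2)[OF X(1) subset_refl] by linarith
    finally show ?thesis using sum_nonneg[of X "\<lambda>J. norm (f J)"] by simp
  qed
  moreover have "0 < 1 + (\<Sum>J\<in>X. norm (f J))" using sum_nonneg[of X "\<lambda>J. norm (f J)"] by (simp add: add_pos_nonneg)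
  ultimately show ?thesis using that by blast
qed

text \<open>
  Exhausting the multi-indices by boxes lets the sum of a product of geometric series factor.
\<close>

definition exps_upto :: "nat \<Rightarrow> ('n::finite \<Rightarrow> nat) set" where
  "exps_upto k = (UNIV \<rightarrow>\<^sub>E {..k})"

lemma finite_exps_upto: "finite (exps_upto k)"
  unfolding exps_upto_def by (intro finite_PiE) auto

lemma filterlim_exps_upto: "filterlim (exps_upto :: nat \<Rightarrow> ('n::finite \<Rightarrow> nat) set) (finite_subsets_at_top UNIV) sequentially"
  unfolding filterlim_finite_subsets_at_top
proof (intro allI impI)
  fix X :: "('n \<Rightarrow> nat) set" assume X: "finite X \<and> X \<subseteq> UNIV"
  define K where "K = Max (insert 0 (\<Union>J\<in>X. range J))"
  have "J i \<le> K" if "J \<in> X" for J i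
    unfolding K_def using X that by (intro Max_ge) auto
  hence "X \<subseteq> exps_upto k" if "k \<ge> K" for k
    using that unfolding exps_upto_def by (auto simp: PiE_def intro: order_trans)
  thus "\<forall>\<^sub>F y in sequentially. finite (exps_upto y) \<and> X \<subseteq> exps_upto y \<and> exps_upto y \<subseteq> UNIV"
    using finite_exps_upto by (auto intro!: eventually_sequentiallyI[of K])
qed

lemma dc_on_power:
  fixes U :: "('a::real_normed_field^'n::finite) set"
  assumes "dc_on U N D R f" "tame N" "0 \<le> D" "0 \<le> R"
  shows "dc_on U N ((8 * D) ^ k) R (\<lambda>x. f x ^ k)"
proof (induction k)
  case 0
  show ?case using assms by (auto intro!: dc_on_const dest: dc_on_smooth smooth_open)
next
  case (Suc k)
  have "dc_on U N (8 * D * (8 * D) ^ k) R (\<lambda>x. f x * f x ^ k)"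
    by (intro dc_on_mult assms Suc) (use assms in auto)
  thus ?case by simp
qed

lemma dc_on_prod:
  fixes U :: "('a::real_normed_field^'n::finite) set"
  assumes "open U" "finite I" "tame N" "0 \<le> R" "\<And>i. i \<in> I \<Longrightarrow> dc_on U N (D i) R (f i)" "\<And>i. i \<in> I \<Longrightarrow> 0 \<le> D i"
  shows "dc_on U N (\<Prod>i\<in>I. 8 * D i) R (\<lambda>x. \<Prod>i\<in>I. f i x)"
  using assms(2,5,6)
proof (induction I rule: finite_induct)
  case empty show ?case using assms by (auto intro!: dc_on_const)
next
  case (insert i F)
  have "dc_on U N (8 * D i * (\<Prod>i\<in>F. 8 * D i)) R (\<lambda>x. f i x * (\<Prod>i\<in>F. f i x))"
    using insert by (intro dc_on_mult assms(3,4) insert.IH prod_nonneg) auto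
  thus ?case using insert by simp
qed

lemma geometric_le_2: "(\<Sum>j\<le>k. (1 / 2 :: real) ^ j) \<le> 2"
proof -
  have "(\<Sum>j\<le>k. (1 / 2 :: real) ^ j) = 2 - (1 / 2) ^ k" by (induction k) auto
  thus ?thesis by simp
qed

text \<open>
  On a ball of radius \<open>s\<close> each coordinate has bounds with \<open>D = s\<close> and \<open>R = 8 / s\<close>, so a monomial of
  exponent \<open>J\<close> has \<open>D\<close> of the order of \<open>(8 s)\<^sup>J\<close>. The coefficients grow like \<open>r\<^sup>-\<^sup>J\<close>, and with \<open>16 s \<le> r\<close>
  the partial sums have uniformly bounded \<open>D\<close>; their limit inherits it.
\<close>

lemma analytic_germ_dc_on:
  fixes f :: "'a::{real_normed_field,banach}^'n::finite \<Rightarrow> 'a"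
  assumes "f \<in> analytic_germs"
  obtains s D R where "s > 0" "D \<ge> 0" "R \<ge> 0" "dc_on (ball 0 s) (\<lambda>_. 1) D R f"
proof -
  define mono where "mono J x = (\<Prod>i\<in>UNIV. (x $ i) ^ J i)" for J and x :: "'a^'n"
  from assms obtain a where "\<forall>\<^sub>F x in nhds 0. ((\<lambda>J. a J * mono J x) has_sum f x) UNIV"
    unfolding analytic_germs_def mono_def by blast
  then obtain e where e: "e > 0" "\<And>x. norm x < e \<Longrightarrow> ((\<lambda>J. a J * mono J x) has_sum f x) UNIV"
    unfolding eventually_nhds_metric by (auto simp: dist_norm)
  define r where "r = e / (real CARD('n) + 1)"
  have r: "r > 0" using e by (simp add: r_def add_pos_nonneg)
  \<comment> \<open>convergence at a point on the diagonal bounds the coefficients geometrically\<close>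
  define p :: "'a^'n" where "p = (\<chi> i. of_real r)"
  have "norm p \<le> (\<Sum>i\<in>UNIV. norm (p $ i))" unfolding norm_vec_def by (rule L2_set_le_sum) auto
  also have "\<dots> = real CARD('n) * r" using r by (simp add: p_def)
  also have "\<dots> < e" using e by (simp add: r_def divide_simps)
  finally have "norm p < e" .
  from has_sum_terms_bounded[OF e(2)[OF this]] obtain B where B: "B > 0" "\<And>J. norm (a J * mono J p) \<le> B" by blast
  have aB: "norm (a J) \<le> B * (\<Prod>i\<in>UNIV. (1 / r) ^ J i)" for J
  proof -
    have "norm (mono J p) = (\<Prod>i\<in>UNIV. r ^ J i)" using r by (simp add: mono_def p_def norm_power prod_norm[symmetric])
    with B(2)[of J] have "norm (a J) * (\<Prod>i\<in>UNIV. r ^ J i) \<le> B" by (simp add: norm_mult)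
    moreover have "(\<Prod>i\<in>UNIV. r ^ J i) > 0" using r by (intro prod_pos) auto
    ultimately have "norm (a J) \<le> B / (\<Prod>i\<in>UNIV. r ^ J i)" by (simp add: field_simps)
    also have "\<dots> = B * (\<Prod>i\<in>UNIV. (1 / r) ^ J i)" by (simp add: power_one_over prod_dividef)
    finally show ?thesis .
  qed
  define s where "s = min (r / 16) e"
  define R where "R = 8 / s"
  have s: "s > 0" "s \<le> e" "16 * s \<le> r" using r e by (auto simp: s_def)
  have R: "R \<ge> 0" using s by (simp add: R_def)
  have coord: "dc_on (ball 0 s) (\<lambda>_. 1) s R (\<lambda>x :: 'a^'n. x $ i)" for i :: 'n
  proof (rule dc_on_coord)
    fix x :: "'a^'n" assume "x \<in> ball 0 s"
    thus "norm (x $ i) \<le> s" using norm_vec_nth_le[of x i] by simp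
  qed (use s R tame_const_1 in \<open>auto simp: R_def\<close>)
  have mon: "dc_on (ball 0 s) (\<lambda>_. 1) (\<Prod>i\<in>UNIV. 8 * (8 * s) ^ J i) R (mono J)" for J
    unfolding mono_def using s R by (intro dc_on_prod dc_on_power coord tame_const_1) auto
  have trm: "dc_on (ball 0 s) (\<lambda>_. 1) (B * (\<Prod>i\<in>UNIV. 8 * (1 / 2) ^ J i)) R (\<lambda>x. a J * mono J x)" for J
  proof (rule dc_on_mono_const[OF dc_on_cmult[OF mon] tame_const_1])
    have "norm (a J) * (\<Prod>i\<in>UNIV. 8 * (8 * s) ^ J i) \<le> (B * (\<Prod>i\<in>UNIV. (1 / r) ^ J i)) * (\<Prod>i\<in>UNIV. 8 * (8 * s) ^ J i)"
      using s by (intro mult_right_mono aB prod_nonneg) auto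
    also have "\<dots> = B * (\<Prod>i\<in>UNIV. 8 * (8 * s / r) ^ J i)"
    proof -
      have e: "(1 / r) ^ k * (8 * (8 * s) ^ k) = 8 * (8 * s / r) ^ k" for k by (simp add: power_divide)
      show ?thesis by (simp only: mult.assoc prod.distrib[symmetric] e)
    qed
    also have "\<dots> \<le> B * (\<Prod>i\<in>UNIV. 8 * (1 / 2) ^ J i)"
      using s r B by (intro mult_left_mono prod_mono conjI power_mono) (auto simp: divide_simps)
    finally show "norm (a J) * (\<Prod>i\<in>UNIV. 8 * (8 * s) ^ J i) \<le> B * (\<Prod>i\<in>UNIV. 8 * (1 / 2) ^ J i)" .
  qed (use s R in \<open>auto intro!: mult_nonneg_nonneg prod_nonneg\<close>)
  have tot: "(\<Sum>J\<in>exps_upto k. B * (\<Prod>i\<in>(UNIV::'n set). 8 * (1 / 2) ^ J i)) \<le> B * 16 ^ CARD('n)" for k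
  proof -
    have "(\<Sum>J\<in>exps_upto k. B * (\<Prod>i\<in>(UNIV::'n set). 8 * (1 / 2) ^ J i)) = B * (\<Prod>i\<in>(UNIV::'n set). \<Sum>j\<le>k. 8 * (1 / 2) ^ j)"
      unfolding exps_upto_def by (subst prod_sum_PiE) (auto simp: sum_distrib_left)
    also have "\<dots> \<le> B * (\<Prod>i\<in>(UNIV::'n set). 16)"
      using B geometric_le_2[of k] by (intro mult_left_mono prod_mono) (auto simp: sum_distrib_left[symmetric] intro!: sum_nonneg)
    finally show ?thesis by simp
  qed
  have part: "dc_on (ball 0 s) (\<lambda>_. 1) (B * 16 ^ CARD('n)) R (\<lambda>x. \<Sum>J\<in>exps_upto k. a J * mono J x)" for k
    by (rule dc_on_mono_const[OF dc_on_sum[OF open_ball R tame_const_1 trm] tame_const_1 _ tot])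
      (use B R in \<open>auto intro!: sum_nonneg mult_nonneg_nonneg prod_nonneg\<close>)
  have "dc_on (ball 0 s) (\<lambda>_. 1) (B * 16 ^ CARD('n)) R f"
  proof (rule dc_on_limit[OF open_ball part])
    fix z :: "'a^'n" assume "z \<in> ball 0 s"
    hence "((\<lambda>J. a J * mono J z) has_sum f z) UNIV" using s by (intro e) auto
    thus "(\<lambda>k. \<Sum>J\<in>exps_upto k. a J * mono J z) \<longlonglongrightarrow> f z"
      unfolding has_sum_def by (rule filterlim_compose[OF _ filterlim_exps_upto])
  qed
  from that[OF s(1) _ R this] B show ?thesis by simp
qed

section \<open>Denjoy-Carleman classes\<close>

lemma partial_eq_pd: "partial i f = pd i f"
proof -
  have "t *\<^sub>R axis i 1 = axis i (t::real)" for t by (simp add: axis_def vec_eq_iff)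
  thus ?thesis by (simp add: fun_eq_iff partial_def pd_def)
qed

lemma iter_partial_eq_pds: "iter_partial l f = pds l f"
  by (induction l) (auto simp: iter_partial_def pds_Cons partial_eq_pd)

lemma differentiable_imp_has_grad:
  fixes f :: "real^'n::finite \<Rightarrow> real"
  assumes "f differentiable (at x)"
  shows "has_grad f x"
proof -
  from assms obtain D where D: "(f has_derivative D) (at x)" unfolding differentiable_def by blast
  have lin: "linear D" using has_derivative_linear[OF D] .
  have "D h = (\<Sum>i\<in>UNIV. h $ i * D (axis i 1))" for h
  proof -
    have "D h = D (\<Sum>i\<in>UNIV. h $ i *\<^sub>R axis i 1)"
      using basis_expansion[of h] by (simp add: scalar_mult_eq_scaleR)
    also have "\<dots> = (\<Sum>i\<in>UNIV. h $ i * D (axis i 1))"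
      by (simp add: linear_sum[OF lin] linear_cmul[OF lin])
    finally show ?thesis .
  qed
  hence "D = (\<lambda>h. \<Sum>i\<in>UNIV. h $ i * D (axis i 1))" by blast
  with D show ?thesis by (intro has_gradI[of f "\<lambda>i. D (axis i 1)"]) simp
qed

lemma smooth_on_eq_smooth:
  fixes f :: "real^'n::finite \<Rightarrow> real"
  shows "smooth_on U f \<longleftrightarrow> smooth U f"
proof -
  have "f differentiable (at x) \<longleftrightarrow> has_grad f x" for f :: "real^'n \<Rightarrow> real" and x
    using differentiable_imp_has_grad by (auto simp: has_grad_def differentiable_def)
  thus ?thesis by (simp add: smooth_on_def smooth_def iter_partial_eq_pds)
qed

lemma ex_list_counts: "\<exists>l. \<forall>i::'n::finite. count_list l i = J i"
proof -
  obtain l where "mset l = (\<Sum>i\<in>UNIV. replicate_mset (J i) i)" using ex_mset by blast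
  hence "count (mset l) i = J i" for i by (simp add: count_sum sum.delta)
  thus ?thesis by (auto simp: count_mset)
qed

lemma mderiv_as_pds:
  fixes J :: "'n::finite \<Rightarrow> nat"
  shows "\<exists>l. length l = mlength J \<and> (\<forall>u. mderiv J u = pds l u) \<and> (\<forall>i. count_list l i = J i)"
proof -
  define l where "l = (SOME l. \<forall>i. count_list l i = J i)"
  have l: "count_list l i = J i" for i unfolding l_def using someI_ex[OF ex_list_counts[of J]] by blast
  have "length l = mlength J" unfolding mlength_def l[symmetric] by (simp add: sum_count_set)
  thus ?thesis using l by (auto simp: mderiv_def l_def iter_partial_eq_pds)
qed

text \<open>
  The unspecified order of differentiation in \<open>mderiv\<close> is harmless by the symmetry of derivatives.
\<close>

lemma mderiv_eq_pds:
  assumes "smooth U u" "x \<in> U"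
  shows "mderiv (count_list l) u x = pds l u x" "mlength (count_list l) = length l"
proof -
  obtain l' where l': "length l' = mlength (count_list l)" "\<And>u. mderiv (count_list l) u = pds l' u" "\<And>i. count_list l' i = count_list l i"
    using mderiv_as_pds[of "count_list l"] by blast
  have m: "mset l' = mset l" using l'(3) by (simp add: multiset_eq_iff count_mset)
  show "mderiv (count_list l) u x = pds l u x" unfolding l'(2) by (rule pds_perm[OF assms m])
  show "mlength (count_list l) = length l" using l'(1) mset_eq_length[OF m] by simp
qed

lemma dc_classD:
  assumes "u \<in> dc_class M"
  obtains r C where "r > 0" "C > 0" "smooth (ball 0 r) u"
    "\<And>x l. x \<in> ball 0 r \<Longrightarrow> \<bar>pds l u x\<bar> \<le> C ^ (length l + 1) * fact (length l) * M (length l)"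
proof -
  from assms obtain U C where U: "0 \<in> U" "smooth U u" "C > 0"
    "\<And>x J. x \<in> U \<Longrightarrow> \<bar>mderiv J u x\<bar> \<le> C ^ (mlength J + 1) * fact (mlength J) * M (mlength J)"
    unfolding dc_class_def smooth_on_eq_smooth by blast
  obtain r where r: "r > 0" "ball 0 r \<subseteq> U" using U(1) smooth_open[OF U(2)] by (auto simp: open_contains_ball)
  show ?thesis
  proof (rule that[OF r(1) U(3)])
    show "smooth (ball 0 r) u" by (rule smooth_subset[OF U(2) open_ball r(2)])
    show "\<bar>pds l u x\<bar> \<le> C ^ (length l + 1) * fact (length l) * M (length l)" if "x \<in> ball 0 r" for x l
      using U(4)[of x "count_list l"] mderiv_eq_pds[OF U(2), of x l] that r(2) by auto
  qed
qed

lemma dc_classI: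
  fixes u :: "real^'n::finite \<Rightarrow> real"
  assumes "dc_on (ball 0 r) N D R u" "r > 0" "tame N" "0 \<le> D" "0 \<le> R"
  shows "u \<in> dc_class N"
proof -
  define C where "C = max 1 (max D R)"
  have C: "1 \<le> C" "D \<le> C" "R \<le> C" by (auto simp: C_def)
  have "\<bar>mderiv J u x\<bar> \<le> C ^ (mlength J + 1) * fact (mlength J) * N (mlength J)" if "x \<in> ball 0 r" for x J
  proof -
    obtain l where l: "length l = mlength J" "\<And>u. mderiv J u = pds l u" using mderiv_as_pds[of J] by blast
    define j where "j = mlength J"
    have "\<bar>pds l u x\<bar> \<le> D * R ^ j * wt j * N j"
      using dc_onD[OF assms(1) that, of l] by (simp add: l j_def)
    also have "\<dots> \<le> C * C ^ j * fact j * N j"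
      using C assms tame_pos[OF assms(3), of j] wt_pos[of j] wt_le_fact[of j]
      by (intro mult_mono power_mono) (auto intro: less_imp_le)
    finally show ?thesis by (simp add: l j_def)
  qed
  thus ?thesis unfolding dc_class_def smooth_on_eq_smooth using dc_on_smooth[OF assms(1)] assms(2) C
    by (intro CollectI exI[of _ "ball 0 r"] exI[of _ C]) auto
qed

section \<open>Cauchy estimates\<close>

lemma axis_zero [simp]: "axis i 0 = (0::'a::real_normed_field^'n::finite)"
  by (simp add: axis_def zero_vec_def)

lemma cauchy_pd:
  fixes H :: "complex^'n::finite \<Rightarrow> complex"
  assumes "\<And>w. w \<in> cball z \<delta> \<Longrightarrow> has_grad H w" "\<And>w. w \<in> cball z \<delta> \<Longrightarrow> norm (H w) \<le> S" "\<delta> > 0"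
  shows "norm (pd i H z) \<le> S / \<delta>"
proof -
  define h where "h t = H (z + axis i t)" for t
  have in_cb: "z + axis i t \<in> cball z \<delta>" if "norm t \<le> \<delta>" for t
    using that by (simp add: dist_norm norm_axis)
  have d: "(h has_field_derivative pd i H (z + axis i t)) (at t)" if "norm t \<le> \<delta>" for t
    unfolding h_def by (rule field_deriv_axis) (use assms(1)[OF in_cb[OF that]] in \<open>simp add: has_grad_def\<close>)
  have "norm ((deriv ^^ 1) h 0) \<le> fact 1 * S / \<delta> ^ 1"
  proof (rule Cauchy_inequality)
    show "h holomorphic_on ball 0 \<delta>"
      unfolding holomorphic_on_def
    proof
      fix t :: complex assume "t \<in> ball 0 \<delta>"
      hence "norm t \<le> \<delta>" by simp
      from d[OF this] show "h field_differentiable at t within ball 0 \<delta>"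
        unfolding field_differentiable_def by (blast intro: has_field_derivative_at_within)
    qed
    show "continuous_on (cball 0 \<delta>) h"
    proof (intro continuous_at_imp_continuous_on ballI)
      fix t :: complex assume "t \<in> cball 0 \<delta>"
      hence "norm t \<le> \<delta>" by simp
      from DERIV_isCont[OF d[OF this]] show "isCont h t" .
    qed
    show "norm (h t) \<le> S" if "norm (0 - t) = \<delta>" for t
      unfolding h_def using that by (intro assms(2) in_cb) auto
  qed fact
  moreover have "deriv h 0 = pd i H z" unfolding h_def pd_def ..
  ultimately show ?thesis by simp
qed

lemma power_self_le: "real j ^ j \<le> 3 ^ j * fact j"
proof -
  have s: "(\<lambda>n. inverse (fact n) * real j ^ n) sums exp (real j)"
    using exp_converges[of "real j"] by simp
  have "(\<Sum>n\<in>{j}. inverse (fact n) * real j ^ n) \<le> (\<Sum>n. inverse (fact n) * real j ^ n)"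
    by (rule sum_le_suminf) (use s in \<open>auto intro: sums_summable\<close>)
  hence "real j ^ j / fact j \<le> exp (real j)" using sums_unique[OF s] by (simp add: field_simps)
  also have "exp (real j) = exp 1 ^ j" by (simp add: exp_of_nat_mult[symmetric])
  also have "\<dots> \<le> 3 ^ j" using exp_le by (intro power_mono) auto
  finally show ?thesis by (simp add: field_simps)
qed

text \<open>
  The radius is spent in \<open>j\<close> equal portions, one for each differentiation, which gives \<open>(j / \<rho>)\<^sup>j\<close>; this
  is at most \<open>(3 / \<rho>)\<^sup>j j!\<close>.
\<close>

lemma cauchy_pds:
  fixes H :: "complex^'n::finite \<Rightarrow> complex"
  assumes H: "smooth V H" "cball z \<rho> \<subseteq> V" "\<And>w. w \<in> cball z \<rho> \<Longrightarrow> norm (H w) \<le> S" "\<rho> > 0"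
  shows "norm (pds l H z) \<le> S * (3 / \<rho>) ^ length l * fact (length l)"
proof (cases "l = []")
  case True thus ?thesis using H(3)[of z] H(4) by simp
next
  case False
  define j where "j = length l"
  have j: "j > 0" using False by (simp add: j_def)
  have S: "0 \<le> S" using order_trans[OF norm_ge_zero H(3)[of z]] H(4) by simp
  have "norm (pds l' H w) \<le> S * (real j / \<rho>) ^ length l'" if "length l' \<le> j" "w \<in> cball z (\<rho> * (1 - real (length l') / real j))" for l' w
    using that
  proof (induction l' arbitrary: w)
    case Nil thus ?case using H(3) by simp
  next
    case (Cons i l')
    have sub: "cball w (\<rho> / real j) \<subseteq> cball z (\<rho> * (1 - real (length l') / real j))"
    proof
      fix y assume "y \<in> cball w (\<rho> / real j)"
      hence "dist z y \<le> \<rho> * (1 - real (length (i # l')) / real j) + \<rho> / real j"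
        using Cons.prems(2) dist_triangle[of z y w] by simp
      also have "\<dots> = \<rho> * (1 - real (length l') / real j)" using j by (simp add: field_simps)
      finally show "y \<in> cball z (\<rho> * (1 - real (length l') / real j))" by simp
    qed
    have sub2: "cball z (\<rho> * (1 - real (length l') / real j)) \<subseteq> cball z \<rho>"
      using H(4) j by (intro subset_cball) (simp add: mult_le_cancel_left1)
    have "norm (pd i (pds l' H) w) \<le> (S * (real j / \<rho>) ^ length l') / (\<rho> / real j)"
    proof (rule cauchy_pd)
      fix y assume y: "y \<in> cball w (\<rho> / real j)"
      show "has_grad (pds l' H) y" using y sub sub2 H(2) by (intro smooth_has_grad[OF H(1)]) blast
      show "norm (pds l' H y) \<le> S * (real j / \<rho>) ^ length l'"
        using y sub Cons.prems by (intro Cons.IH) auto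
    qed (use H(4) j in auto)
    thus ?case by (simp add: pds_Cons field_simps)
  qed
  from this[of l z] have "norm (pds l H z) \<le> S * (real j / \<rho>) ^ j" using H(4) j by (simp add: j_def)
  also have "\<dots> = S / \<rho> ^ j * real j ^ j" by (simp add: power_divide)
  also have "\<dots> \<le> S / \<rho> ^ j * (3 ^ j * fact j)" using S H(4) by (intro mult_left_mono power_self_le) auto
  finally show ?thesis by (simp add: j_def power_divide)
qed

text \<open>
  A holomorphic extension determines the real derivatives: its restriction to a real line has the
  same derivative.
\<close>

lemma pds_complex_vec:
  fixes h :: "real^'n::finite \<Rightarrow> real" and H :: "complex^'n \<Rightarrow> complex"
  assumes "smooth U h" "smooth V H" "\<And>x. x \<in> U \<Longrightarrow> complex_vec x \<in> V"
    "\<And>x. x \<in> U \<Longrightarrow> H (complex_vec x) = of_real (h x)" "x \<in> U"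
  shows "pds l H (complex_vec x) = of_real (pds l h x)"
  using assms(5)
proof (induction l arbitrary: x)
  case Nil thus ?case using assms(4) by simp
next
  case (Cons i l)
  define c where "c = pd i (pds l H) (complex_vec x)"
  define d where "d = pd i (pds l h) x"
  have cv: "complex_vec (x + axis i t) = complex_vec x + axis i (of_real t)" for t
    by (simp add: complex_vec_def axis_def vec_eq_iff)
  have "((\<lambda>t. pds l H (complex_vec x + axis i t)) has_field_derivative c) (at 0)"
    unfolding c_def by (rule field_deriv_axis)
      (use smooth_has_grad[OF assms(2) assms(3)[OF Cons.prems]] in \<open>simp add: has_grad_def\<close>)
  hence "((\<lambda>t. pds l H (complex_vec x + axis i t)) has_field_derivative c) (at (of_real 0))" by simp
  from has_vector_derivative_real_field[OF this]
  have 1: "((\<lambda>t. pds l H (complex_vec x + axis i (of_real t))) has_vector_derivative c) (at 0)" .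
  have "((\<lambda>t. pds l h (x + axis i t)) has_field_derivative d) (at 0)"
    unfolding d_def by (rule field_deriv_axis)
      (use smooth_has_grad[OF assms(1) Cons.prems] in \<open>simp add: has_grad_def\<close>)
  hence 2: "((\<lambda>t. complex_of_real (pds l h (x + axis i t))) has_vector_derivative of_real d) (at 0)"
    by (intro has_vector_derivative_of_real) (simp add: has_real_derivative_iff_has_vector_derivative)
  obtain e where e: "e > 0" "ball x e \<subseteq> U" using Cons.prems smooth_open[OF assms(1)] by (auto simp: open_contains_ball)
  have "((\<lambda>t. pds l H (complex_vec x + axis i (of_real t))) has_vector_derivative of_real d) (at 0)"
  proof (rule has_vector_derivative_transform_within_open[OF 2, of "ball 0 e"])
    fix t :: real assume "t \<in> ball 0 e"
    hence "x + axis i t \<in> U" using e by (auto simp: subset_iff dist_norm norm_axis)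
    from Cons.IH[OF this] show "complex_of_real (pds l h (x + axis i t)) = pds l H (complex_vec x + axis i (of_real t))"
      by (simp add: cv)
  qed (use e in auto)
  from vector_derivative_unique_at[OF 1 this] show ?case by (simp add: c_def d_def pds_Cons)
qed

section \<open>Lower bounds for holomorphic functions away from their zeros\<close>

text \<open>
  Harnack's inequality for the positive harmonic function \<open>ln (B / \<bar>h\<bar>)\<close>. The logarithm of \<open>h / B\<close> maps
  the disc into the left half plane; after moving its value at 0 to 0 by a Moebius map onto the unit
  disc, the Schwarz lemma applies.
\<close>

lemma zero_free_harnack:
  assumes h: "h holomorphic_on ball 0 \<rho>" "\<rho> > 0" "\<And>t. norm t < \<rho> \<Longrightarrow> h t \<noteq> 0" "\<And>t. norm t < \<rho> \<Longrightarrow> norm (h t) < B"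
    and t: "norm t \<le> \<rho> / 2"
  shows "norm (h t) ^ 3 \<le> B\<^sup>2 * norm (h 0)"
proof -
  have B: "B > 0" using h(4)[of 0] h(2) norm_ge_zero[of "h 0"] by (simp del: norm_ge_zero)
  define k where "k s = h (of_real \<rho> * s) / of_real B" for s
  have scl: "of_real \<rho> * s \<in> ball 0 \<rho>" if "s \<in> ball 0 1" for s :: complex
    using that h(2) by (simp add: norm_mult)
  have kh: "k holomorphic_on ball 0 1"
    unfolding k_def using scl B
    by (intro holomorphic_intros holomorphic_on_compose_gen[OF _ h(1), unfolded o_def]) auto
  have k0: "k s \<noteq> 0" if "s \<in> ball 0 1" for s
    using h(3)[of "of_real \<rho> * s"] scl[OF that] B by (simp add: k_def)
  have k1: "norm (k s) < 1" if "s \<in> ball 0 1" for s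
    using h(4)[of "of_real \<rho> * s"] scl[OF that] B by (simp add: k_def norm_divide)
  obtain F where F: "F holomorphic_on ball 0 1" "\<And>s. s \<in> ball 0 1 \<Longrightarrow> exp (F s) = k s"
    using holomorphic_logarithm_exists[OF convex_ball open_ball kh, of 0] k0 by auto
  have ReF: "Re (F s) < 0" if "s \<in> ball 0 1" for s
    using k1[OF that] F(2)[OF that] by (metis exp_less_one_iff norm_exp_eq_Re)
  define A where "A = F 0"
  have ReA: "Re A < 0" using ReF[of 0] by (simp add: A_def)
  have ne: "F s + cnj A \<noteq> 0" if "s \<in> ball 0 1" for s
  proof
    assume "F s + cnj A = 0"
    hence "Re (F s) + Re A = 0" by (simp add: complex_eq_iff)
    thus False using ReF[OF that] ReA by simp
  qed
  \<comment> \<open>the Moebius map of the left half plane onto the unit disc that takes \<open>A\<close> to 0\<close>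
  define W where "W s = (F s - A) / (F s + cnj A)" for s
  have sq: "(cmod (F s + cnj A))\<^sup>2 - (cmod (F s - A))\<^sup>2 = 4 * Re (F s) * Re A" for s
    by (simp add: cmod_power2) (simp add: power2_eq_square algebra_simps)
  have W1: "norm (W s) < 1" if "s \<in> ball 0 1" for s
  proof -
    have "Re (F s) * Re A > 0" using ReF[OF that] ReA by (rule mult_neg_neg)
    hence "(cmod (F s - A))\<^sup>2 < (cmod (F s + cnj A))\<^sup>2" using sq[of s] by simp
    hence "cmod (F s - A) < cmod (F s + cnj A)" by (rule power2_less_imp_less) simp
    thus ?thesis using ne[OF that] by (simp add: W_def norm_divide)
  qed
  define s where "s = t / of_real \<rho>"
  have s: "norm s \<le> 1 / 2" "s \<in> ball 0 1" using t h(2) by (auto simp: s_def norm_divide divide_simps)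
  have "norm (W s) \<le> norm s"
  proof (rule Schwarz_Lemma(1))
    show "W holomorphic_on ball 0 1" unfolding W_def using ne by (intro holomorphic_intros F) auto
    show "W 0 = 0" by (simp add: W_def A_def)
  qed (use W1 s in auto)
  hence "norm (W s) \<le> 1 / 2" using s by simp
  hence "2 * cmod (F s - A) \<le> cmod (F s + cnj A)"
    using ne[OF s(2)] by (simp add: W_def norm_divide divide_simps)
  hence "(2 * cmod (F s - A))\<^sup>2 \<le> (cmod (F s + cnj A))\<^sup>2" by (rule power_mono) simp
  hence "4 * ((Re (F s) - Re A)\<^sup>2 + (Im (F s) - Im A)\<^sup>2) \<le> (Re (F s) + Re A)\<^sup>2 + (Im (F s) - Im A)\<^sup>2"
    by (simp add: cmod_power2 power_mult_distrib)
  hence "4 * (Re (F s) - Re A)\<^sup>2 \<le> (Re (F s) + Re A)\<^sup>2"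
  proof -
    assume "4 * ((Re (F s) - Re A)\<^sup>2 + (Im (F s) - Im A)\<^sup>2) \<le> (Re (F s) + Re A)\<^sup>2 + (Im (F s) - Im A)\<^sup>2"
    hence "4 * (Re (F s) - Re A)\<^sup>2 + 3 * (Im (F s) - Im A)\<^sup>2 \<le> (Re (F s) + Re A)\<^sup>2" by simp
    thus ?thesis using add_increasing2[of "3 * (Im (F s) - Im A)\<^sup>2"] by (meson add_le_cancel_left le_add_same_cancel1 order_trans zero_le_mult_iff zero_le_numeral zero_le_power2)
  qed
  hence "(2 * (Re (F s) - Re A))\<^sup>2 \<le> (- (Re (F s) + Re A))\<^sup>2"
    unfolding power_mult_distrib power2_minus by simp
  hence "2 * (Re (F s) - Re A) \<le> - (Re (F s) + Re A)"
    by (rule power2_le_imp_le) (use ReF[OF s(2)] ReA in simp)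
  hence "3 * Re (F s) \<le> Re A" by simp
  hence "exp (3 * Re (F s)) \<le> exp (Re A)" by simp
  hence "norm (k s) ^ 3 \<le> norm (k 0)"
    using F(2)[OF s(2)] F(2)[of 0] by (simp add: A_def norm_exp_eq_Re[symmetric] exp_of_nat_mult[of 3 "Re (F s)", simplified])
  moreover have "k s = h t / of_real B" "k 0 = h 0 / of_real B" using h(2) by (auto simp: k_def s_def)
  ultimately have "norm (h t) ^ 3 / B ^ 3 \<le> norm (h 0) / B" using B by (simp add: norm_divide power_divide)
  hence "norm (h t) ^ 3 \<le> norm (h 0) / B * B ^ 3" using B by (simp add: divide_simps)
  also have "\<dots> = B\<^sup>2 * norm (h 0)" using B by (simp add: power3_eq_cube power2_eq_square)
  finally show ?thesis .
qed

text \<open>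
  Rescale the disc of radius \<open>\<rho>\<close> to the unit disc and let \<open>P\<close> be the largest of the first \<open>m + 1\<close>
  rescaled Taylor coefficients. The coefficient of order \<open>m\<close> gives \<open>P \<ge> \<kappa> \<rho>\<^sup>m\<close>, and it also dominates the
  tail of the series, so \<open>\<bar>h\<bar>\<close> is at most a constant times \<open>P\<close> on the whole disc. If \<open>h 0\<close> were much
  smaller than \<open>P\<close>, Harnack's inequality would make \<open>h\<close> small on half the disc, and with it all
  coefficients.
\<close>

lemma zero_free_lower_bound:
  assumes h: "h holomorphic_on ball 0 1" "\<And>t. norm t < 1 \<Longrightarrow> norm (h t) \<le> S"
    and m: "norm ((deriv ^^ m) h 0) \<ge> fact m * \<kappa>" "\<kappa> > 0"
    and \<rho>: "0 < \<rho>" "\<rho> \<le> 1 / 4" and zf: "\<And>t. norm t < \<rho> \<Longrightarrow> h t \<noteq> 0"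
  shows "norm (h 0) \<ge> \<kappa> / (8 ^ m * (real m + 2 + 4 * S * 2 ^ m / \<kappa>)\<^sup>2) * \<rho> ^ m"
proof -
  define c where "c k = norm ((deriv ^^ k) h 0) / fact k" for k
  have S: "0 \<le> S" using order_trans[OF norm_ge_zero h(2)[of 0]] by simp
  have c: "c k \<le> S * 2 ^ k" for k
  proof -
    have "norm ((deriv ^^ k) h 0) \<le> fact k * S / (1 / 2) ^ k"
    proof (rule Cauchy_inequality)
      show "h holomorphic_on ball 0 (1/2)" by (rule holomorphic_on_subset[OF h(1)]) auto
      show "continuous_on (cball 0 (1/2)) h"
        by (rule holomorphic_on_imp_continuous_on, rule holomorphic_on_subset[OF h(1)]) auto
    qed (use h(2) in auto)
    thus ?thesis by (simp add: c_def field_simps power_one_over)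
  qed
  define P where "P = Max ((\<lambda>k. c k * \<rho> ^ k) ` {..m})"
  have P_ge: "c k * \<rho> ^ k \<le> P" if "k \<le> m" for k unfolding P_def using that by (intro Max_ge) auto
  have "P \<in> (\<lambda>k. c k * \<rho> ^ k) ` {..m}" unfolding P_def by (rule Max_in) auto
  then obtain k where k: "k \<le> m" "P = c k * \<rho> ^ k" by auto
  have "\<kappa> \<le> c m" using m(1) by (simp add: c_def field_simps)
  hence "\<kappa> * \<rho> ^ m \<le> c m * \<rho> ^ m" using \<rho> by (intro mult_right_mono) auto
  hence Pm: "\<kappa> * \<rho> ^ m \<le> P" using P_ge[of m] by simp
  have P0: "P > 0" using Pm m(2) \<rho>(1) by (meson mult_pos_pos order_less_le_trans zero_less_power)
  define A where "A = real m + 2 + 4 * S * 2 ^ m / \<kappa>"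
  have "0 \<le> 4 * S * 2 ^ m / \<kappa>" using S m(2) by simp
  hence A: "A > 0" by (simp add: A_def)
  have bd: "norm (h t) < A * P" if t: "norm t < \<rho>" for t
  proof -
    define a where "a n = (deriv ^^ n) h 0 / fact n * t ^ n" for n
    have sums: "a sums h t"
      unfolding a_def[abs_def] using holomorphic_power_series[OF h(1), of t] t \<rho> by simp
    have an: "norm (a n) \<le> c n * \<rho> ^ n" for n
      using t by (auto simp: a_def c_def norm_mult norm_divide norm_power intro!: divide_right_mono mult_left_mono power_mono)
    have an2: "norm (a (n + Suc m)) \<le> S * (2 * \<rho>) ^ Suc m * (1 / 2) ^ n" for n
    proof -
      have "norm (a (n + Suc m)) \<le> S * 2 ^ (n + Suc m) * \<rho> ^ (n + Suc m)"
        using an[of "n + Suc m"] c[of "n + Suc m"] \<rho> mult_right_mono[of "c (n + Suc m)" _ "\<rho> ^ (n + Suc m)"] by (auto intro: order_trans)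
      also have "\<dots> = S * (2 * \<rho>) ^ Suc m * (2 * \<rho>) ^ n" by (simp add: power_add power_mult_distrib)
      also have "\<dots> \<le> S * (2 * \<rho>) ^ Suc m * (1 / 2) ^ n"
        using S \<rho> by (intro mult_left_mono power_mono) auto
      finally show ?thesis .
    qed
    have g: "(\<lambda>n. S * (2 * \<rho>) ^ Suc m * (1 / 2) ^ n) sums (S * (2 * \<rho>) ^ Suc m * 2)"
      using sums_mult[OF geometric_sums[of "1/2::real"], of "S * (2 * \<rho>) ^ Suc m"] by simp
    have "h t = (\<Sum>n. a (n + Suc m)) + (\<Sum>n<Suc m. a n)"
      using suminf_split_initial_segment[OF sums_summable[OF sums], of "Suc m"] sums_unique[OF sums] by simp
    moreover have "norm (\<Sum>n. a (n + Suc m)) \<le> S * (2 * \<rho>) ^ Suc m * 2"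
      using suminf_le[OF an2] norm_suminf_le[OF an2 sums_summable[OF g]] sums_unique[OF g] by simp
    moreover have "norm (\<Sum>n<Suc m. a n) \<le> (\<Sum>n<Suc m. P)"
      using order_trans[OF an P_ge] by (intro sum_norm_le) auto
    ultimately have "norm (h t) \<le> S * (2 * \<rho>) ^ Suc m * 2 + real (Suc m) * P"
      using norm_triangle_ineq[of "\<Sum>n. a (n + Suc m)" "\<Sum>n<Suc m. a n"] by simp
    also have "S * (2 * \<rho>) ^ Suc m * 2 = (4 * S * 2 ^ m * \<rho>) * \<rho> ^ m" by (simp add: power_mult_distrib)
    also have "\<dots> \<le> (4 * S * 2 ^ m) * \<rho> ^ m" 
      using mult_left_mono[of \<rho> 1 "4 * S * 2 ^ m"] S \<rho> by (intro mult_right_mono) auto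
    also have "\<dots> = (4 * S * 2 ^ m / \<kappa>) * (\<kappa> * \<rho> ^ m)" using m(2) by simp
    also have "\<dots> \<le> (4 * S * 2 ^ m / \<kappa>) * P" using S m(2) by (intro mult_left_mono Pm) auto
    finally have "norm (h t) \<le> (A - 1) * P" by (simp add: A_def algebra_simps)
    also have "\<dots> < A * P" using P0 by simp
    finally show ?thesis .
  qed
  have hol: "h holomorphic_on ball 0 \<rho>" by (rule holomorphic_on_subset[OF h(1)]) (use \<rho> in auto)
  define T where "T = root 3 ((A * P)\<^sup>2 * norm (h 0))"
  have T0: "0 \<le> T" by (simp add: T_def)
  have T3: "T ^ 3 = (A * P)\<^sup>2 * norm (h 0)" by (simp add: T_def odd_real_root_pow)
  have hT: "norm (h t) \<le> T" if "norm t \<le> \<rho> / 2" for t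
  proof -
    have "norm (h t) ^ 3 \<le> T ^ 3" unfolding T3 by (rule zero_free_harnack[OF hol \<rho>(1) zf bd that])
    thus ?thesis using power_mono_iff[of "norm (h t)" T 3] T0 by simp
  qed
  have "norm ((deriv ^^ k) h 0) \<le> fact k * T / (\<rho> / 2) ^ k"
  proof (rule Cauchy_inequality)
    show "h holomorphic_on ball 0 (\<rho> / 2)" by (rule holomorphic_on_subset[OF h(1)]) (use \<rho> in auto)
    show "continuous_on (cball 0 (\<rho> / 2)) h"
      by (rule holomorphic_on_imp_continuous_on, rule holomorphic_on_subset[OF h(1)]) (use \<rho> in auto)
  qed (use hT \<rho> in auto)
  hence "c k \<le> T * 2 ^ k / \<rho> ^ k" by (simp add: c_def field_simps power_divide)
  hence "P \<le> T * 2 ^ k" using \<rho>(1) by (simp add: k(2) field_simps)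
  also have "\<dots> \<le> T * 2 ^ m" using k(1) T3 by (intro mult_left_mono power_increasing) (auto simp: T_def)
  finally have "P ^ 3 \<le> (T * 2 ^ m) ^ 3" using P0 by (intro power_mono) auto
  also have "\<dots> = (A * P)\<^sup>2 * norm (h 0) * 8 ^ m"
    unfolding power_mult_distrib T3 by (simp add: power_mult[symmetric] mult.commute[of m]) (simp add: power_mult)
  finally have "P * P\<^sup>2 \<le> (A\<^sup>2 * norm (h 0) * 8 ^ m) * P\<^sup>2" by (simp add: power_mult_distrib power2_eq_square power3_eq_cube mult_ac)
  hence "P \<le> A\<^sup>2 * norm (h 0) * 8 ^ m" using P0 by (simp only: mult_le_cancel_right) auto
  hence "\<kappa> * \<rho> ^ m \<le> A\<^sup>2 * norm (h 0) * 8 ^ m" using Pm by simp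
  hence "\<kappa> / (8 ^ m * A\<^sup>2) * \<rho> ^ m \<le> norm (h 0)" using A by (simp add: field_simps)
  thus ?thesis unfolding A_def .
qed

lemma norm_scalar_mult: "norm ((t::complex) *s (v::complex^'n::finite)) = norm t * norm v"
  unfolding norm_vec_def by (simp add: norm_mult L2_set_right_distrib)

lemma holomorphic_scaled_line:
  fixes G :: "complex^'n::finite \<Rightarrow> complex"
  assumes "smooth V G" "\<And>t. t \<in> T \<Longrightarrow> z + t *s v \<in> V" "open T"
  shows "(\<lambda>t. G (z + t *s v)) holomorphic_on T"
proof -
  have "(\<lambda>t. G (z + t *s v)) field_differentiable (at t)" if "t \<in> T" for t
  proof -
    have "bounded_linear (\<lambda>t::complex. t *s v)"
    proof (rule bounded_linear_intro[where K="norm v"])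
      show "norm (t *s v) \<le> norm t * norm v" for t by (simp add: norm_scalar_mult)
    qed (auto simp: vec_eq_iff algebra_simps)
    hence "((\<lambda>t. z + t *s v) has_derivative (\<lambda>t. t *s v)) (at t)"
      by (intro has_derivative_eq_rhs[OF has_derivative_add[OF has_derivative_const bounded_linear_imp_has_derivative]]) auto
    from has_derivative_compose[OF this smooth_has_grad0[OF assms(1) assms(2)[OF that], unfolded has_grad_def]]
    have "((\<lambda>t. G (z + t *s v)) has_derivative (\<lambda>t'. \<Sum>i\<in>UNIV. (t' *s v) $ i * pd i G (z + t *s v))) (at t)" .
    hence "((\<lambda>t. G (z + t *s v)) has_field_derivative (\<Sum>i\<in>UNIV. v $ i * pd i G (z + t *s v))) (at t)"
      unfolding has_field_derivative_def
      by (rule has_derivative_eq_rhs) (auto simp: fun_eq_iff sum_distrib_right sum_distrib_left mult_ac)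
    thus ?thesis by (auto simp: field_differentiable_def)
  qed
  thus ?thesis by (auto simp: holomorphic_on_def intro: field_differentiable_at_within)
qed

text \<open>
  Unless \<open>G\<close> vanishes identically near 0, there is a direction \<open>v\<close> in which \<open>t \<mapsto> G (t v)\<close> has a nonzero
  Taylor coefficient, of some order \<open>m\<close>. By uniform continuity the coefficients of \<open>t \<mapsto> G (z + t v)\<close>
  of this order stay away from 0 for all small \<open>z\<close>, and the one-variable bound applies on each of these
  lines. If \<open>G\<close> vanishes near 0 no point satisfies the hypothesis.
\<close>

lemma zero_distance_lower_bound:
  fixes G :: "complex^'n::finite \<Rightarrow> complex"
  assumes G: "smooth (ball 0 s) G" "s > 0"
  obtains r c m where "0 < r" "r \<le> s" "c > 0"
    "\<And>z \<rho>. norm z < r \<Longrightarrow> 0 < \<rho> \<Longrightarrow> \<rho> \<le> 1 / 4 \<Longrightarrow> (\<And>w. norm (w - z) < \<rho> \<Longrightarrow> G w \<noteq> 0) \<Longrightarrow> norm (G z) \<ge> c * \<rho> ^ m"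
proof (cases "\<exists>v. norm v < min 1 (s / 4) \<and> G v \<noteq> 0")
  case False
  show ?thesis
  proof (rule that[of "min 1 (s / 4)" 1 0])
    fix z :: "complex^'n" and \<rho> :: real
    assume "norm z < min 1 (s / 4)" "0 < \<rho>" "\<And>w. norm (w - z) < \<rho> \<Longrightarrow> G w \<noteq> 0"
    thus "1 * \<rho> ^ 0 \<le> norm (G z)" using False by (metis diff_self norm_zero)
  qed (use G in auto)
next
  case True
  then obtain v where v: "norm v < 1" "norm v < s / 4" "G v \<noteq> 0" by auto
  define H where "H z t = G (z + t *s v)" for z t
  have ineq: "norm (z + t *s v) \<le> norm z + norm t * norm v" for z t
    using norm_triangle_ineq[of z "t *s v"] by (simp add: norm_scalar_mult)
  have nb: "norm (z + t *s v) < 3 * s / 4" if "norm z < s / 4" "norm t < 2" for z t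
  proof -
    have "norm t * norm v \<le> 2 * (s / 4)" using that v by (intro mult_mono) auto
    thus ?thesis using ineq[of z t] that by simp
  qed
  have hol: "H z holomorphic_on ball 0 2" if "norm z < s / 4" for z
    unfolding H_def
  proof (rule holomorphic_scaled_line[OF G(1)])
    fix t :: complex assume "t \<in> ball 0 2"
    hence "norm (z + t *s v) < 3 * s / 4" by (intro nb that) simp
    also have "\<dots> < s" using G(2) by simp
    finally show "z + t *s v \<in> ball 0 s" by simp
  qed simp
  have "\<exists>m. (deriv ^^ m) (H 0) 0 \<noteq> 0"
  proof (rule ccontr)
    assume "\<not> ?thesis"
    hence "H 0 1 = 0"
      using G(2) by (intro holomorphic_fun_eq_0_on_connected[OF hol open_ball connected_ball]) auto
    thus False using v(3) by (simp add: H_def vec_eq_iff)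
  qed
  then obtain m where m: "(deriv ^^ m) (H 0) 0 \<noteq> 0" by blast
  define \<kappa> where "\<kappa> = norm ((deriv ^^ m) (H 0) 0) / fact m / 2"
  have \<kappa>: "\<kappa> > 0" using m by (simp add: \<kappa>_def)
  have cont: "continuous_on (cball 0 (3 * s / 4)) G"
    by (rule continuous_on_subset[OF smooth_cont[OF G(1)]]) (use G in auto)
  have "bounded (G ` cball 0 (3 * s / 4))"
    by (intro compact_imp_bounded compact_continuous_image cont compact_cball)
  then obtain S where S: "\<And>w. w \<in> cball 0 (3 * s / 4) \<Longrightarrow> norm (G w) \<le> S" unfolding bounded_iff by blast
  have "uniformly_continuous_on (cball 0 (3 * s / 4)) G"
    by (intro compact_uniformly_continuous cont compact_cball)
  moreover have "\<kappa> / 2 ^ m > 0" using \<kappa> by simp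
  ultimately obtain d where d: "d > 0" "\<And>w w'. w \<in> cball 0 (3 * s / 4) \<Longrightarrow> w' \<in> cball 0 (3 * s / 4) \<Longrightarrow> dist w' w < d \<Longrightarrow> dist (G w') (G w) < \<kappa> / 2 ^ m"
    unfolding uniformly_continuous_on_def by metis
  define r where "r = min d (s / 4)"
  have r: "r > 0" using d G by (simp add: r_def)
  have der: "norm ((deriv ^^ m) (H z) 0) \<ge> fact m * \<kappa>" if z: "norm z < r" for z
  proof -
    have z4: "norm z < s / 4" using z by (simp add: r_def)
    have z0: "norm (0::complex^'n) < s / 4" using G by simp
    have hd: "(\<lambda>t. H z t - H 0 t) holomorphic_on ball 0 2" by (intro holomorphic_intros hol z4 z0)
    have "norm ((deriv ^^ m) (\<lambda>t. H z t - H 0 t) 0) \<le> fact m * (\<kappa> / 2 ^ m) / (1/2) ^ m"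
    proof (rule Cauchy_inequality)
      show "(\<lambda>t. H z t - H 0 t) holomorphic_on ball 0 (1/2)" by (rule holomorphic_on_subset[OF hd]) auto
      show "continuous_on (cball 0 (1/2)) (\<lambda>t. H z t - H 0 t)"
        by (rule holomorphic_on_imp_continuous_on, rule holomorphic_on_subset[OF hd]) auto
      fix t :: complex assume "norm (0 - t) = 1/2"
      hence t: "norm t < 2" by simp
      have "dist (G (z + t *s v)) (G (0 + t *s v)) < \<kappa> / 2 ^ m"
      proof (rule d(2))
        show "dist (z + t *s v) (0 + t *s v) < d" using z by (simp add: dist_norm r_def)
      qed (use nb[OF z4 t] nb[OF z0 t] in simp_all)
      thus "norm (H z t - H 0 t) \<le> \<kappa> / 2 ^ m" by (simp add: H_def dist_norm)
    qed simp
    moreover have "(deriv ^^ m) (\<lambda>t. H z t - H 0 t) 0 = (deriv ^^ m) (H z) 0 - (deriv ^^ m) (H 0) 0"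
      by (rule higher_deriv_diff[OF hol[OF z4] hol[OF z0] open_ball]) simp
    ultimately have "norm ((deriv ^^ m) (H z) 0 - (deriv ^^ m) (H 0) 0) \<le> fact m * \<kappa>"
      by (simp add: power_one_over)
    moreover have "norm ((deriv ^^ m) (H 0) 0) = 2 * (fact m * \<kappa>)" by (simp add: \<kappa>_def)
    ultimately show ?thesis
      using norm_triangle_ineq2[of "(deriv ^^ m) (H 0) 0" "(deriv ^^ m) (H z) 0"] by (simp add: norm_minus_commute)
  qed
  show ?thesis
  proof (rule that[of r "\<kappa> / (8 ^ m * (real m + 2 + 4 * S * 2 ^ m / \<kappa>)\<^sup>2)" m])
    have S0: "0 \<le> S" using order_trans[OF norm_ge_zero S[of 0]] G by simp
    show "0 < \<kappa> / (8 ^ m * (real m + 2 + 4 * S * 2 ^ m / \<kappa>)\<^sup>2)"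
    proof -
      have "0 \<le> 4 * S * 2 ^ m / \<kappa>" using S0 \<kappa> by simp
      hence "0 < real m + 2 + 4 * S * 2 ^ m / \<kappa>" by linarith
      thus ?thesis using \<kappa> by simp
    qed
    show "0 < r" "r \<le> s" using r G by (auto simp: r_def)
    fix z :: "complex^'n" and \<rho> :: real
    assume z: "norm z < r" and \<rho>: "0 < \<rho>" "\<rho> \<le> 1 / 4" and zf: "\<And>w. norm (w - z) < \<rho> \<Longrightarrow> G w \<noteq> 0"
    have z4: "norm z < s / 4" using z by (simp add: r_def)
    have "norm (H z 0) \<ge> \<kappa> / (8 ^ m * (real m + 2 + 4 * S * 2 ^ m / \<kappa>)\<^sup>2) * \<rho> ^ m"
    proof (rule zero_free_lower_bound[OF _ _ der[OF z] \<kappa> \<rho>])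
      show "H z holomorphic_on ball 0 1" by (rule holomorphic_on_subset[OF hol[OF z4]]) auto
      show "norm (H z t) \<le> S" if "norm t < 1" for t
        unfolding H_def using nb[OF z4, of t] that by (intro S) auto
      show "H z t \<noteq> 0" if "norm t < \<rho>" for t
      proof -
        have "norm t * norm v \<le> norm t * 1" using v by (intro mult_left_mono) auto
        thus ?thesis unfolding H_def using that by (intro zf) (simp add: norm_scalar_mult)
      qed
    qed
    thus "\<kappa> / (8 ^ m * (real m + 2 + 4 * S * 2 ^ m / \<kappa>)\<^sup>2) * \<rho> ^ m \<le> norm (G z)" by (simp add: H_def)
  qed
qed

text \<open>
  Cauchy's estimates for the reciprocal of the extension on half of the zero-free ball. The case
  \<open>G 0 \<noteq> 0\<close> is covered by restricting \<open>\<rho>\<close> to small values.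
\<close>

lemma reciprocal_bound:
  fixes g :: "real^'n::finite \<Rightarrow> real" and G :: "complex^'n \<Rightarrow> complex"
  assumes g: "smooth (ball 0 s) g" and G: "smooth (ball 0 s) G" and s: "s > 0"
    and gG: "\<And>x. norm x < s \<Longrightarrow> G (complex_vec x) = of_real (g x)"
  obtains r E m where "0 < r" "r \<le> s" "1 \<le> E"
    "\<And>x \<rho> l. norm x < r \<Longrightarrow> 0 < \<rho> \<Longrightarrow> \<rho> \<le> r \<Longrightarrow> (\<And>z. G z = 0 \<Longrightarrow> dist (complex_vec x) z \<ge> \<rho>) \<Longrightarrow>
      g x \<noteq> 0 \<and> \<bar>pds l (\<lambda>x. inverse (g x)) x\<bar> \<le> E ^ (length l + 1) * fact (length l) / \<rho> ^ (length l + m)"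
proof -
  obtain r0 c m where r0: "0 < r0" "r0 \<le> s" "c > 0"
    and lb: "\<And>z \<rho>. norm z < r0 \<Longrightarrow> 0 < \<rho> \<Longrightarrow> \<rho> \<le> 1 / 4 \<Longrightarrow> (\<And>w. norm (w - z) < \<rho> \<Longrightarrow> G w \<noteq> 0) \<Longrightarrow> norm (G z) \<ge> c * \<rho> ^ m"
    using zero_distance_lower_bound[OF G s] by blast
  have ncv: "norm (complex_vec x) = norm x" for x :: "real^'n"
    by (simp add: complex_vec_def norm_vec_def)
  define r where "r = min (r0 / 2) (1 / 4)"
  have r: "r > 0" "r \<le> r0 / 2" "r \<le> 1 / 4" using r0 by (auto simp: r_def)
  define E where "E = max 6 (2 ^ m / c)"
  have E: "E \<ge> 6" "E \<ge> 2 ^ m / c" by (auto simp: E_def)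
  show ?thesis
  proof (rule that[of r E m])
    show "0 < r" "r \<le> s" "1 \<le> E" using r r0 E by auto
    fix x :: "real^'n" and \<rho> :: real and l :: "'n list"
    assume x: "norm x < r" and \<rho>: "0 < \<rho>" "\<rho> \<le> r" and far: "\<And>z. G z = 0 \<Longrightarrow> dist (complex_vec x) z \<ge> \<rho>"
    define j where "j = length l"
    define V where "V = ball (complex_vec x) \<rho>"
    have V: "V \<subseteq> ball 0 s"
    proof
      fix z assume "z \<in> V"
      hence "norm (z - complex_vec x) < \<rho>" by (simp add: V_def dist_norm norm_minus_commute)
      thus "z \<in> ball 0 s" using norm_triangle_ineq[of "z - complex_vec x" "complex_vec x"] x \<rho> r r0 ncv[of x] by simp
    qed
    have nz: "G z \<noteq> 0" if "z \<in> V" for z using far[of z] that by (auto simp: V_def)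
    define U where "U = ball x \<rho>"
    have UV: "complex_vec y \<in> V" if "y \<in> U" for y
    proof -
      have "complex_vec x - complex_vec y = complex_vec (x - y)" by (simp add: complex_vec_def vec_eq_iff)
      thus ?thesis using that by (simp add: U_def V_def dist_norm ncv)
    qed
    have Us: "U \<subseteq> ball 0 s"
    proof
      fix y assume "y \<in> U"
      from UV[OF this] V have "complex_vec y \<in> ball 0 s" by blast
      thus "y \<in> ball 0 s" by (simp add: ncv)
    qed
    have gn: "g y \<noteq> 0" if "y \<in> U" for y
      using nz[OF UV[OF that]] gG[of y] Us that by auto
    have sg: "smooth U (\<lambda>x. inverse (g x))"
      using gn by (intro smooth_inverse smooth_subset[OF g _ Us]) (auto simp: U_def)
    have sG: "smooth V (\<lambda>x. inverse (G x))"
      using nz by (intro smooth_inverse smooth_subset[OF G _ V]) (auto simp: V_def)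
    have xU: "x \<in> U" using \<rho> by (simp add: U_def)
    have "pds l (\<lambda>x. inverse (G x)) (complex_vec x) = of_real (pds l (\<lambda>x. inverse (g x)) x)"
      using gG Us by (intro pds_complex_vec[OF sg sG UV _ xU]) auto
    hence "\<bar>pds l (\<lambda>x. inverse (g x)) x\<bar> = norm (pds l (\<lambda>x. inverse (G x)) (complex_vec x))" by simp
    also have "\<dots> \<le> (inverse c * (2 / \<rho>) ^ m) * (3 / (\<rho> / 2)) ^ j * fact j"
      unfolding j_def
    proof (rule cauchy_pds[OF sG])
      show "cball (complex_vec x) (\<rho> / 2) \<subseteq> V" using \<rho> by (auto simp: V_def)
      fix w assume w: "w \<in> cball (complex_vec x) (\<rho> / 2)"
      have "norm (G w) \<ge> c * (\<rho> / 2) ^ m"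
      proof (rule lb)
        have "norm (w - complex_vec x) \<le> \<rho> / 2" using w by (simp add: dist_norm norm_minus_commute)
        thus "norm w < r0" using norm_triangle_ineq[of "w - complex_vec x" "complex_vec x"] x \<rho> r r0 ncv[of x] by simp
        fix w' assume w': "norm (w' - w) < \<rho> / 2"
        have "dist (complex_vec x) w' < \<rho>" using w w' dist_triangle[of "complex_vec x" w' w] by (simp add: dist_norm norm_minus_commute)
        thus "G w' \<noteq> 0" by (intro nz) (simp add: V_def)
      qed (use \<rho> r in auto)
      moreover have "0 < c * (\<rho> / 2) ^ m" using r0 \<rho> by simp
      ultimately have "inverse (norm (G w)) \<le> inverse (c * (\<rho> / 2) ^ m)" by (intro le_imp_inverse_le) auto
      also have "\<dots> = inverse c * (2 / \<rho>) ^ m" by (simp add: power_divide field_simps)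
      finally show "norm (inverse (G w)) \<le> inverse c * (2 / \<rho>) ^ m" by (simp add: norm_inverse)
    qed (use \<rho> in auto)
    also have "\<dots> = (2 ^ m / c) * 6 ^ j * (fact j / \<rho> ^ (j + m))"
      by (simp add: power_divide power_add field_simps)
    also have "\<dots> \<le> E * E ^ j * (fact j / \<rho> ^ (j + m))"
      using E \<rho> r0 by (intro mult_right_mono mult_mono power_mono) auto
    finally show "g x \<noteq> 0 \<and> \<bar>pds l (\<lambda>x. inverse (g x)) x\<bar> \<le> E ^ (length l + 1) * fact (length l) / \<rho> ^ (length l + m)"
      using gn[OF xU] by (simp add: j_def)
  qed
qed

section \<open>Tame sequences and admissible functions\<close>

lemma h_seq_le: assumes "tame M" "0 \<le> t" shows "h_seq M t \<le> t ^ j * M j"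
  unfolding h_seq_def
proof (rule cINF_lower)
  show "bdd_below (range (\<lambda>j. t ^ j * M j))"
  proof (rule bdd_belowI[of _ 0])
    fix x assume "x \<in> range (\<lambda>j. t ^ j * M j)"
    then obtain j where "x = t ^ j * M j" by blast
    thus "0 \<le> x" using assms tame_pos[OF assms(1), of j] by simp
  qed
qed simp

lemma h_seq_greatest: assumes "\<And>j. c \<le> t ^ j * M j" shows "c \<le> h_seq M t"
  unfolding h_seq_def by (rule cINF_greatest) (use assms in auto)

lemma h_seq_mono: assumes "tame M" "0 \<le> s" "s \<le> t" shows "h_seq M s \<le> h_seq M t"
proof (rule h_seq_greatest)
  fix j
  have "h_seq M s \<le> s ^ j * M j" by (rule h_seq_le) (use assms in auto)
  also have "\<dots> \<le> t ^ j * M j" using assms tame_pos[OF assms(1), of j] by (intro mult_right_mono power_mono) auto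
  finally show "h_seq M s \<le> t ^ j * M j" .
qed

text \<open>
  By logarithmic convexity the terms \<open>t\<^sup>k M\<^sub>k\<close> with \<open>t = M\<^sub>j / M\<^sub>j\<^sub>+\<^sub>1\<close> decrease up to \<open>k = j\<close> and increase
  afterwards, so the infimum is attained at \<open>j\<close>. This recovers \<open>M\<close> from \<open>h_seq M\<close>.
\<close>

lemma h_seq_at_ratio:
  assumes M: "tame M"
  shows "h_seq M (M j / M (Suc j)) \<ge> (M j / M (Suc j)) ^ j * M j"
proof (rule h_seq_greatest)
  fix k
  define t where "t = M j / M (Suc j)"
  have t: "t > 0" using tame_pos[OF M] by (simp add: t_def)
  have up: "t ^ k * M k \<le> t ^ Suc k * M (Suc k)" if "j \<le> k" for k
  proof -
    have "M k \<le> t * M (Suc k)" using tame_step[OF M that] tame_pos[OF M, of "Suc j"] by (simp add: t_def field_simps)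
    thus ?thesis using mult_left_mono[of "M k" "t * M (Suc k)" "t ^ k"] t by (simp add: mult_ac)
  qed
  have down: "t ^ Suc k * M (Suc k) \<le> t ^ k * M k" if "k \<le> j" for k
  proof -
    have "t * M (Suc k) \<le> M k" using tame_step[OF M that] tame_pos[OF M, of "Suc j"] by (simp add: t_def field_simps)
    thus ?thesis using mult_left_mono[of "t * M (Suc k)" "M k" "t ^ k"] t by (simp add: mult_ac)
  qed
  show "t ^ j * M j \<le> t ^ k * M k"
  proof (cases "j \<le> k")
    case True thus ?thesis by (induction k rule: dec_induct) (use up in \<open>auto intro: order_trans\<close>)
  next
    case False
    hence "k \<le> j" by simp
    thus ?thesis by (induction k rule: inc_induct) (use down in \<open>auto intro: order_trans\<close>)
  qed
qed

text \<open>
  The ratios decrease; if they stayed above \<open>\<delta>\<close>, the harmonic series would converge.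
\<close>

lemma ratio_small:
  assumes M: "tame M" "non_quasianalytic M" and "\<delta> > 0"
  obtains J where "\<And>j. j \<ge> J \<Longrightarrow> M j / M (Suc j) < \<delta>"
proof -
  have dec: "M k / M (Suc k) \<le> M j / M (Suc j)" if "j \<le> k" for j k
    using tame_step[OF M(1) that] tame_pos[OF M(1)] by (simp add: divide_simps mult_ac)
  have "\<exists>J. M J / M (Suc J) < \<delta>"
  proof (rule ccontr)
    assume "\<not> ?thesis"
    hence ge: "\<delta> \<le> M j / M (Suc j)" for j by (simp add: not_less)
    have "summable (\<lambda>j. \<delta> * inverse (real (Suc j)))"
    proof (rule summable_comparison_test)
      show "summable (\<lambda>j. M j / ((real j + 1) * M (j + 1)))" using M(2) by (simp add: non_quasianalytic_def)
      have "\<delta> * inverse (real (Suc j)) \<le> M j / ((real j + 1) * M (j + 1))" for j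
      proof -
        have "\<delta> * inverse (real (Suc j)) \<le> M j / M (Suc j) * inverse (real (Suc j))"
          by (intro mult_right_mono ge) simp
        thus ?thesis by (simp add: field_simps)
      qed
      thus "\<exists>N. \<forall>n\<ge>N. norm (\<delta> * inverse (real (Suc n))) \<le> M n / ((real n + 1) * M (n + 1))"
        using assms(3) by simp
    qed
    hence "summable (\<lambda>j. inverse (real (Suc j)))" using assms(3) by (simp add: summable_cmult_iff)
    hence "summable (\<lambda>j. inverse (real j))" using summable_Suc_iff[of "\<lambda>j. inverse (real j)"] by simp
    thus False using not_summable_harmonic by blast
  qed
  then obtain J where "M J / M (Suc J) < \<delta>" by blast
  thus ?thesis using that dec by (meson order_le_less_trans)
qed

lemma h_seq_pos:
  assumes M: "tame M" "non_quasianalytic M" and "t > 0"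
  shows "h_seq M t > 0"
proof -
  obtain J where J: "\<And>j. j \<ge> J \<Longrightarrow> M j / M (Suc j) < t" using ratio_small[OF M assms(3)] by blast
  have p: "M J / M (Suc J) > 0" using tame_pos[OF M(1)] by simp
  have "0 < (M J / M (Suc J)) ^ J * M J" using p tame_pos[OF M(1), of J] by (intro mult_pos_pos zero_less_power)
  also have "\<dots> \<le> h_seq M (M J / M (Suc J))" by (rule h_seq_at_ratio[OF M(1)])
  also have "\<dots> \<le> h_seq M t" using J[of J] p by (intro h_seq_mono M) auto
  finally show ?thesis .
qed

text \<open>
  Everything that the division lemma uses about \<open>\<theta>\<close> and its transform \<open>N\<close>. Positivity of \<open>\<theta>\<close> follows
  from that of \<open>h_seq M\<close>. The comparison of \<open>M\<close> and \<open>N\<close> is obtained by evaluating the left hand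
  inequality for the transform at the ratios of \<open>M\<close>. In the last property a dilation by \<open>b\<close> in the
  argument of \<open>\<theta>\<close> is moved outside as the factor \<open>b\<^sup>s\<close>, because \<open>\<theta>(t) / t\<^sup>s\<close> decreases.
\<close>

lemma theta_comparison:
  assumes \<theta>: "admissible \<theta>" and M: "tame M" "non_quasianalytic M" and tr: "is_theta_transform M \<theta> N"
  obtains \<tau> C where "\<tau> > 0" "C \<ge> 1" "\<And>t. 0 < t \<Longrightarrow> t < \<tau> \<Longrightarrow> 0 < \<theta> t" "\<And>t. 0 < t \<Longrightarrow> t < \<tau> \<Longrightarrow> \<theta> t \<le> C * t"
    "\<And>j. M j \<le> C ^ Suc j * N j"
    "\<And>B. B \<ge> 0 \<Longrightarrow> \<exists>E \<tau>'. E \<ge> 1 \<and> \<tau>' > 0 \<and> (\<forall>t k. 0 < t \<and> t < \<tau>' \<longrightarrow> h_seq M (B * t) \<le> (E * \<theta> t) ^ k * N k)"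
proof -
  obtain \<epsilon> s where \<epsilon>: "\<epsilon> > 0" "mono_on {0..<\<epsilon>} \<theta>" "\<theta> 0 = 0" "mono_on {0<..<\<epsilon>} (\<lambda>t. \<theta> t / t)"
    and s: "s \<ge> 1" "antimono_on {0<..<\<epsilon>} (\<lambda>t. \<theta> t / t powr s)"
    using \<theta> unfolding admissible_def by blast
  obtain c c' where N: "tame N" and c: "c > 0" "c' > 0"
    and ev: "\<forall>\<^sub>F t in at_right 0. h_seq M (c * t) \<le> h_seq N (\<theta> t) \<and> h_seq N (\<theta> t) \<le> h_seq M (c' * t)"
    using tr unfolding is_theta_transform_def by blast
  obtain \<tau>0 where \<tau>0: "\<tau>0 > 0" "\<And>t. 0 < t \<Longrightarrow> t < \<tau>0 \<Longrightarrow> h_seq M (c * t) \<le> h_seq N (\<theta> t)"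
    using ev unfolding eventually_at_right_field by auto
  define \<tau> where "\<tau> = min \<tau>0 (\<epsilon> / 2)"
  have \<tau>: "\<tau> > 0" "\<tau> \<le> \<tau>0" "\<tau> \<le> \<epsilon> / 2" using \<tau>0 \<epsilon> by (auto simp: \<tau>_def)
  have nn: "0 \<le> \<theta> t" if "0 \<le> t" "t < \<epsilon>" for t
    using mono_onD[OF \<epsilon>(2), of 0 t] that \<epsilon> by simp
  have pos: "0 < \<theta> t" if "0 < t" "t < \<tau>" for t
  proof -
    have "\<theta> t \<noteq> 0"
    proof
      assume "\<theta> t = 0"
      hence "h_seq N (\<theta> t) \<le> 0" using h_seq_le[OF N, of 0 1] by simp
      moreover have "0 < h_seq M (c * t)" using c that by (intro h_seq_pos M) auto
      ultimately show False using \<tau>0(2)[of t] that \<tau> by simp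
    qed
    thus ?thesis using nn[of t] that \<tau> by simp
  qed
  define C0 where "C0 = \<theta> (\<epsilon> / 2) / (\<epsilon> / 2)"
  have C0: "\<theta> t \<le> C0 * t" if "0 < t" "t < \<tau>" for t
  proof -
    have "\<theta> t / t \<le> C0" unfolding C0_def using mono_onD[OF \<epsilon>(4), of t "\<epsilon> / 2"] that \<tau> \<epsilon> by simp
    thus ?thesis using that by (simp add: field_simps)
  qed
  have C0n: "0 \<le> C0" using nn[of "\<epsilon> / 2"] \<epsilon> by (simp add: C0_def)
  obtain J where J: "\<And>j. j \<ge> J \<Longrightarrow> M j / M (Suc j) < c * \<tau>" using ratio_small[OF M, of "c * \<tau>"] c \<tau> by auto
  define C where "C = max 1 (max C0 (max (C0 / c) (M J)))"
  have C: "1 \<le> C" "C0 \<le> C" "C0 / c \<le> C" "M J \<le> C" unfolding C_def by (simp_all only: le_max_iff_disj order_refl simp_thms)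
  show ?thesis
  proof (rule that[of \<tau> C])
    show "\<tau> > 0" "C \<ge> 1" by fact+
    show "0 < \<theta> t" if "0 < t" "t < \<tau>" for t by (rule pos[OF that])
    show "\<theta> t \<le> C * t" if "0 < t" "t < \<tau>" for t
    proof -
      have "C0 * t \<le> C * t" using C(2) that by (intro mult_right_mono) auto
      thus ?thesis using C0[OF that] by linarith
    qed
    show "M j \<le> C ^ Suc j * N j" for j
    proof (cases "j \<ge> J")
      case True
      define t where "t = M j / M (Suc j) / c"
      have t: "0 < t" "t < \<tau>" using J[OF True] c tame_pos[OF M(1)] by (auto simp: t_def field_simps)
      have "(c * t) ^ j * M j \<le> h_seq M (c * t)" using h_seq_at_ratio[OF M(1), of j] c by (simp add: t_def)
      also have "\<dots> \<le> h_seq N (\<theta> t)" using t \<tau> by (intro \<tau>0) auto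
      also have "\<dots> \<le> h_seq N (C0 * t)" using t pos[OF t] by (intro h_seq_mono N C0) auto
      also have "\<dots> \<le> (C0 * t) ^ j * N j" using t C0n by (intro h_seq_le N) auto
      finally have "t ^ j * (c ^ j * M j) \<le> t ^ j * (C0 ^ j * N j)" by (simp add: power_mult_distrib mult_ac)
      hence "c ^ j * M j \<le> C0 ^ j * N j" using t by simp
      hence "M j \<le> (C0 / c) ^ j * N j" using c by (simp add: power_divide field_simps)
      also have "\<dots> \<le> C ^ Suc j * N j"
      proof (intro mult_right_mono)
        have "(C0 / c) ^ j \<le> C ^ j" using C C0n c by (intro power_mono) auto
        also have "\<dots> \<le> C ^ Suc j" using C by (intro power_increasing) auto
        finally show "(C0 / c) ^ j \<le> C ^ Suc j" .
      qed (use tame_pos[OF N, of j] in simp)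
      finally show ?thesis .
    next
      case False
      have "M j \<le> M J" using M(1) False by (intro incseqD[of M]) (auto simp: tame_def)
      also have "\<dots> \<le> C * 1" using C by simp
      also have "\<dots> \<le> C ^ Suc j * N j"
        using C tame_ge_1[OF N, of j] power_increasing[of 1 "Suc j" C] by (intro mult_mono) auto
      finally show ?thesis .
    qed
    show "\<exists>E \<tau>'. E \<ge> 1 \<and> \<tau>' > 0 \<and> (\<forall>t k. 0 < t \<and> t < \<tau>' \<longrightarrow> h_seq M (B * t) \<le> (E * \<theta> t) ^ k * N k)" if B: "B \<ge> 0" for B
    proof (intro exI conjI allI impI)
      define b where "b = max 1 (\<bar>B\<bar> / c)"
      have b: "b \<ge> 1" "\<bar>B\<bar> \<le> c * b" using c by (auto simp: b_def max_def field_simps)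
      show "1 \<le> b powr s" using b s by (simp add: ge_one_powr_ge_zero)
      show "0 < \<tau> / b" using \<tau> b by simp
      fix t k assume t: "0 < t \<and> t < \<tau> / b"
      have bt: "b * t < \<tau>" "t \<le> b * t" using t b by (auto simp: field_simps)
      hence t\<tau>: "t < \<tau>" by simp
      have "h_seq M (B * t) \<le> h_seq M (c * (b * t))"
      proof -
        have "B * t \<le> c * b * t" using b t by (intro mult_right_mono) auto
        thus ?thesis using t b B by (intro h_seq_mono M) (auto simp: mult_ac)
      qed
      also have "\<dots> \<le> h_seq N (\<theta> (b * t))" using t b bt \<tau> by (intro \<tau>0) auto
      also have "\<dots> \<le> h_seq N (b powr s * \<theta> t)"
      proof (rule h_seq_mono[OF N])
        show "0 \<le> \<theta> (b * t)" using bt t b \<tau> by (intro nn) auto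
        have "\<theta> (b * t) / (b * t) powr s \<le> \<theta> t / t powr s"
          using monotone_onD[OF s(2), of t "b * t"] t bt b \<tau> t\<tau> by auto
        thus "\<theta> (b * t) \<le> b powr s * \<theta> t" using t b by (simp add: powr_mult field_simps)
      qed
      also have "\<dots> \<le> (b powr s * \<theta> t) ^ k * N k" using t t\<tau> pos[of t] by (intro h_seq_le N) auto
      finally show "h_seq M (B * t) \<le> (b powr s * \<theta> t) ^ k * N k" .
    qed
  qed
qed

section \<open>Flat functions\<close>

text \<open>
  Taylor's formula along the segment from a flat point \<open>y\<close>, in the form of \<open>k\<close> successive integrations;
  the factorial they produce is needed to compare \<open>(j + k)!\<close> with \<open>j!\<close> alone.
\<close>

lemma flat_taylor:
  fixes b :: "real^'n::finite \<Rightarrow> real"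
  assumes b: "smooth U b" and seg: "\<And>s. 0 \<le> s \<Longrightarrow> s \<le> 1 \<Longrightarrow> y + s *\<^sub>R v \<in> U"
    and bd: "\<And>s l. 0 \<le> s \<Longrightarrow> s \<le> 1 \<Longrightarrow> \<bar>pds l b (y + s *\<^sub>R v)\<bar> \<le> B (length l)"
    and flat: "\<And>l. pds l b y = 0" and s: "0 \<le> s" "s \<le> 1"
  shows "\<bar>pds l b (y + s *\<^sub>R v)\<bar> \<le> B (length l + k) * (real CARD('n) * norm v) ^ k * s ^ k / fact k"
  using s
proof (induction k arbitrary: l s)
  case 0 thus ?case using bd[of s l] by simp
next
  case (Suc k)
  define w where "w = real CARD('n) * norm v"
  define F where "F \<sigma> = pds l b (y + \<sigma> *\<^sub>R v)" for \<sigma>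
  define F' where "F' \<sigma> = (\<Sum>i\<in>UNIV. v $ i * pds (i # l) b (y + \<sigma> *\<^sub>R v))" for \<sigma>
  define c where "c = B (length l + Suc k) * w ^ Suc k / fact k"
  have F: "(F has_vector_derivative F' \<sigma>) (at \<sigma>)" if "0 \<le> \<sigma>" "\<sigma> \<le> 1" for \<sigma>
  proof -
    have "((\<lambda>\<sigma>. y + \<sigma> *\<^sub>R v) has_derivative (\<lambda>\<sigma>. \<sigma> *\<^sub>R v)) (at \<sigma>)" by (auto intro!: derivative_eq_intros)
    from has_derivative_compose[OF this smooth_has_grad[OF b seg[OF that], unfolded has_grad_def]]
    show ?thesis unfolding F_def F'_def has_vector_derivative_def
      by (rule has_derivative_eq_rhs) (auto simp: fun_eq_iff sum_distrib_left pds_Cons mult_ac)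
  qed
  have F': "norm (F' \<sigma>) \<le> c * \<sigma> ^ k" if "0 \<le> \<sigma>" "\<sigma> \<le> 1" for \<sigma>
  proof -
    have "norm (F' \<sigma>) \<le> real CARD('n) * (B (Suc (length l) + k) * w ^ k * \<sigma> ^ k / fact k) * norm v"
      unfolding F'_def w_def using Suc.IH[OF that, of "_ # l"] by (intro linear_form_bound) simp
    thus ?thesis by (simp add: c_def w_def mult_ac)
  qed
  show ?case
  proof (cases "s = 0")
    case True thus ?thesis using flat by simp
  next
    case False
    hence s: "0 < s" "s \<le> 1" using Suc.prems by auto
    have "norm (F s - F 0) \<le> c * s ^ Suc k / (real k + 1) - c * 0 ^ Suc k / (real k + 1)"
    proof (rule differentiable_bound_general[OF s(1)])
      show "continuous_on {0..s} F"
      proof (rule continuous_at_imp_continuous_on, rule ballI)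
        fix \<sigma> assume "\<sigma> \<in> {0..s}"
        hence "0 \<le> \<sigma>" "\<sigma> \<le> 1" using s by auto
        from has_vector_derivative_continuous[OF F[OF this]] show "isCont F \<sigma>" .
      qed
      show "continuous_on {0..s} (\<lambda>\<sigma>. c * \<sigma> ^ Suc k / (real k + 1))" by (intro continuous_intros) auto
      fix \<sigma> assume \<sigma>: "0 < \<sigma>" "\<sigma> < s"
      show "(F has_vector_derivative F' \<sigma>) (at \<sigma>)" using \<sigma> s by (intro F) auto
      show "((\<lambda>\<sigma>. c * \<sigma> ^ Suc k / (real k + 1)) has_vector_derivative c * \<sigma> ^ k) (at \<sigma>)"
        unfolding has_real_derivative_iff_has_vector_derivative[symmetric]
      proof -
        have "((\<lambda>\<sigma>. \<sigma> ^ Suc k) has_real_derivative real (Suc k) * \<sigma> ^ k) (at \<sigma>)"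
          using DERIV_pow[of "Suc k" \<sigma> UNIV] by simp
        from DERIV_cmult[OF this, of "c / (real k + 1)"]
        have "((\<lambda>\<sigma>. c / (real k + 1) * \<sigma> ^ Suc k) has_real_derivative c / (real k + 1) * (real (Suc k) * \<sigma> ^ k)) (at \<sigma>)" .
        moreover have "c / (real k + 1) * (real (Suc k) * \<sigma> ^ k) = c * \<sigma> ^ k" by (simp add: divide_simps)
        ultimately show "((\<lambda>\<sigma>. c * \<sigma> ^ Suc k / (real k + 1)) has_real_derivative c * \<sigma> ^ k) (at \<sigma>)" by simp
      qed
      show "norm (F' \<sigma>) \<le> c * \<sigma> ^ k" using \<sigma> s by (intro F') auto
    qed
    moreover have "F 0 = 0" by (simp add: F_def flat)
    ultimately have "\<bar>F s\<bar> \<le> c * s ^ Suc k / (real k + 1)" by simp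
    also have "\<dots> = B (length l + Suc k) * w ^ Suc k * s ^ Suc k / fact (Suc k)" by (simp add: c_def add.commute mult_ac)
    finally show ?thesis by (simp only: F_def w_def)
  qed
qed

text \<open>
  The Taylor estimate at the nearest point of \<open>Y\<close>, for every \<open>k\<close>, with \<open>(j + k)! \<le> 2\<^sup>j\<^sup>+\<^sup>k j! k!\<close> and
  \<open>M\<^sub>j\<^sub>+\<^sub>k \<le> A\<^sup>j\<^sup>+\<^sup>k M\<^sub>j M\<^sub>k\<close>; the infimum over \<open>k\<close> produces \<open>h_seq M\<close>.
\<close>

lemma flat_decay:
  fixes b :: "real^'n::finite \<Rightarrow> real"
  assumes b: "smooth (ball 0 r) b" and M: "tame M" and C: "C > 0" and Y: "closed Y" "0 \<in> Y"
    and bd: "\<And>x l. norm x < r \<Longrightarrow> \<bar>pds l b x\<bar> \<le> C ^ (length l + 1) * fact (length l) * M (length l)"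
    and flat: "\<And>y l. y \<in> Y \<Longrightarrow> norm y < r \<Longrightarrow> pds l b y = 0"
  obtains E where "E \<ge> 1" "\<And>x l. norm x < r / 2 \<Longrightarrow> \<bar>pds l b x\<bar> \<le> E ^ (length l + 1) * fact (length l) * M (length l) * h_seq M (E * infdist x Y)"
proof -
  obtain A where A: "A > 0" "\<And>j k. M (j + k) \<le> A ^ (j + k) * M j * M k" using M unfolding tame_def by blast
  define A' where "A' = max 1 A"
  define C' where "C' = max 1 C"
  have A': "A' \<ge> 1" "A \<le> A'" and C': "C' \<ge> 1" "C \<le> C'" by (auto simp: A'_def C'_def)
  define n where "n = real CARD('n)"
  have n: "n \<ge> 1" by (simp add: n_def Suc_leI)
  define e where "e = 2 * C' * A'"
  have e: "e \<ge> 1" using mult_mono[of 1 C' 1 A'] A' C' by (simp add: e_def)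
  define E where "E = e * n"
  have E: "E \<ge> e" "E \<ge> 1" using mult_mono[of e e 1 n] mult_mono[of 1 e 1 n] e n by (auto simp: E_def)
  show ?thesis
  proof (rule that[OF E(2)])
    fix x :: "real^'n" and l :: "'n list" assume x: "norm x < r / 2"
    define j where "j = length l"
    obtain y where y: "y \<in> Y" "infdist x Y = dist x y" using infdist_attains_inf[OF Y(1)] Y(2) by blast
    define d where "d = infdist x Y"
    have dn: "d = norm (x - y)" "d \<le> norm x" using y infdist_le[OF Y(2), of x] by (auto simp: d_def dist_norm)
    have seg: "norm (y + s *\<^sub>R (x - y)) < r" if "0 \<le> s" "s \<le> 1" for s
    proof -
      have "y + s *\<^sub>R (x - y) = x + (s - 1) *\<^sub>R (x - y)" by (simp add: algebra_simps)
      hence "norm (y + s *\<^sub>R (x - y)) \<le> norm x + \<bar>s - 1\<bar> * norm (x - y)" by (metis norm_triangle_ineq norm_scaleR)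
      also have "\<dots> \<le> norm x + 1 * norm (x - y)" using that by (intro add_left_mono mult_right_mono) auto
      finally show ?thesis using dn x by simp
    qed
    have yr: "norm y < r" using seg[of 0] by simp
    have "\<bar>pds l b x\<bar> \<le> E ^ (j + 1) * fact j * M j * ((E * d) ^ k * M k)" for k
    proof -
      have "\<bar>pds l b (y + 1 *\<^sub>R (x - y))\<bar> \<le> (C ^ (length l + k + 1) * fact (length l + k) * M (length l + k)) * (real CARD('n) * norm (x - y)) ^ k * 1 ^ k / fact k"
      proof (rule flat_taylor[OF b, where B="\<lambda>j. C ^ (j + 1) * fact j * M j"])
        fix s :: real assume s: "0 \<le> s" "s \<le> 1"
        show "y + s *\<^sub>R (x - y) \<in> ball 0 r" using seg[OF s] by simp
        show "\<bar>pds l b (y + s *\<^sub>R (x - y))\<bar> \<le> C ^ (length l + 1) * fact (length l) * M (length l)" for l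
          by (rule bd[OF seg[OF s]])
      qed (use flat y yr in auto)
      also have "\<dots> = C ^ (j + k + 1) * (fact (j + k) / fact k) * M (j + k) * (n * d) ^ k"
        by (simp add: j_def n_def dn)
      also have "\<dots> \<le> C' ^ (j + k + 1) * (2 ^ (j + k) * fact j) * (A' ^ (j + k) * M j * M k) * (n * d) ^ k"
      proof (intro mult_mono)
        show "C ^ (j + k + 1) \<le> C' ^ (j + k + 1)" using C C' by (intro power_mono) auto
        have "real ((j + k) choose k) \<le> 2 ^ (j + k)" using binomial_le_pow2[of "j + k" k] by (metis of_nat_le_iff of_nat_numeral of_nat_power)
        hence "fact (j + k) / (fact k * fact j) \<le> (2 ^ (j + k) :: real)" by (simp add: binomial_fact)
        thus "fact (j + k) / fact k \<le> (2 ^ (j + k) * fact j :: real)" by (simp add: field_simps)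
        show "M (j + k) \<le> A' ^ (j + k) * M j * M k"
        proof -
          have "A ^ (j + k) * (M j * M k) \<le> A' ^ (j + k) * (M j * M k)"
            using A A' tame_pos[OF M, of j] tame_pos[OF M, of k] by (intro mult_right_mono power_mono) auto
          thus ?thesis using A(2)[of j k] by (simp add: mult_ac)
        qed
      qed (use C C' A' dn n tame_pos[OF M] in \<open>auto intro!: mult_nonneg_nonneg intro: less_imp_le\<close>)
      also have "\<dots> = C' * e ^ j * fact j * M j * ((e * n * d) ^ k * M k)"
        by (simp add: e_def power_mult_distrib power_add mult_ac)
      also have "\<dots> \<le> E * E ^ j * fact j * M j * ((E * d) ^ k * M k)"
      proof (intro mult_mono power_mono)
        have "C' * 1 \<le> C' * (2 * A')" using C' A' by (intro mult_left_mono) auto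
        thus "C' \<le> E" using E by (simp add: e_def mult_ac)
      qed (use e E C' dn n tame_pos[OF M] in \<open>auto simp: E_def intro!: mult_nonneg_nonneg intro: less_imp_le\<close>)
      finally show ?thesis by simp
    qed
    note bound = this
    define c where "c = E ^ (j + 1) * fact j * M j"
    have c: "c > 0" using E tame_pos[OF M, of j] by (simp add: c_def)
    have "\<bar>pds l b x\<bar> / c \<le> (E * d) ^ k * M k" for k
      using bound[of k] unfolding c_def[symmetric] by (subst pos_divide_le_eq[OF c], subst mult.commute)
    hence "\<bar>pds l b x\<bar> / c \<le> h_seq M (E * d)" by (rule h_seq_greatest)
    hence "\<bar>pds l b x\<bar> \<le> c * h_seq M (E * d)" using c by (simp add: pos_divide_le_eq mult.commute)
    thus "\<bar>pds l b x\<bar> \<le> E ^ (length l + 1) * fact (length l) * M (length l) * h_seq M (E * infdist x Y)"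
      by (simp add: c_def j_def d_def)
  qed
qed

section \<open>Near-identity maps\<close>

text \<open>
  The instance of the composition bound that gets iterated. The contribution of the identity to the
  first derivatives of \<open>x + \<xi>(x)\<close> is made small relative to \<open>\<mu> R\<close> by a large \<open>R\<close>, not by a small ball.
  The bound for the result involves the constant of \<open>X\<close> but not that of \<open>\<xi>\<close>.
\<close>

lemma dc_on_translate_compose:
  fixes X :: "real^'n::finite \<Rightarrow> real" and \<xi> :: "real^'n \<Rightarrow> real^'n"
  assumes X: "dc_on V N D \<rho> X" and \<xi>: "\<And>i. dc_on U N D' R (\<lambda>x. \<xi> x $ i)" and UV: "\<And>x. x \<in> U \<Longrightarrow> x + \<xi> x \<in> V"
    and N: "tame N" and nn: "0 \<le> D" "0 \<le> \<rho>" "0 \<le> R" "0 \<le> D'"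
    and \<mu>: "16 \<le> \<mu> * R" "2 * D' \<le> \<mu>" "16 * real CARD('n) * N 1 * \<mu> * \<rho> \<le> 1"
  shows "dc_on U N D R (\<lambda>x. X (x + \<xi> x))"
proof -
  note op = smooth_open[OF dc_on_smooth[OF \<xi>]]
  have s\<xi>: "smooth U (\<lambda>x. \<xi> x $ i)" for i using \<xi> by (rule dc_on_smooth)
  have s: "smooth U (\<lambda>x. (x + \<xi> x) $ i)" for i
    using smooth_add[OF smooth_coord[OF op] s\<xi>] by simp
  have \<mu>0: "0 \<le> \<mu>" using \<mu>(2) nn by simp
  have b: "norm (pds l (\<lambda>x. (x + \<xi> x) $ i) x) \<le> \<mu> * R ^ length l * wt (length l) * N (length l)"
    if x: "x \<in> U" and l: "l \<noteq> []" for x l i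
  proof -
    define j where "j = length l"
    have w: "0 \<le> R ^ j * wt j * N j" using nn wt_pos[of j] tame_pos[OF N, of j] by simp
    have "norm (pds l (\<lambda>x. x $ i) x) \<le> (\<mu> / 2) * (R ^ j * wt j * N j)"
    proof -
      obtain l' k where l': "l = l' @ [k]" using l by (cases l rule: rev_cases) auto
      have p: "pd k (\<lambda>x. x $ i) = (\<lambda>x::real^'n. if k = i then 1 else 0)" by (auto simp: has_grad_coord)
      show ?thesis
      proof (cases "l' = []")
        case True
        have "16 * 1 \<le> (\<mu> * R) * N 1" using \<mu> tame_ge_1[OF N, of 1] \<mu>0 nn by (intro mult_mono) auto
        thus ?thesis by (simp add: l' True pds_Cons p j_def)
      next
        case False
        then obtain l'' k' where "l' = l'' @ [k']" by (cases l' rule: rev_cases) auto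
        hence "pds l (\<lambda>x. x $ i) x = 0" by (simp add: l' pds_append pds_Cons p pd_const pds_zero)
        thus ?thesis using w \<mu>0 by simp
      qed
    qed
    moreover have "norm (pds l (\<lambda>x. \<xi> x $ i) x) \<le> (\<mu> / 2) * (R ^ j * wt j * N j)"
    proof -
      have "norm (pds l (\<lambda>x. \<xi> x $ i) x) \<le> D' * (R ^ j * wt j * N j)"
        using dc_onD[OF \<xi> x, of l i] by (simp add: j_def mult_ac)
      also have "\<dots> \<le> (\<mu> / 2) * (R ^ j * wt j * N j)" using \<mu> by (intro mult_right_mono w) auto
      finally show ?thesis .
    qed
    moreover have "pds l (\<lambda>x. (x + \<xi> x) $ i) x = pds l (\<lambda>x. x $ i) x + pds l (\<lambda>x. \<xi> x $ i) x"
      using smooth_pds_add[OF smooth_coord[OF op] s\<xi> x, of l i i] by simp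
    ultimately have "norm (pds l (\<lambda>x. (x + \<xi> x) $ i) x) \<le> \<mu> * (R ^ j * wt j * N j)"
      using norm_triangle_ineq[of "pds l (\<lambda>x. x $ i) x" "pds l (\<lambda>x. \<xi> x $ i) x"] by simp
    thus ?thesis by (simp add: j_def mult_ac)
  qed
  have bX: "norm (pds l X y) \<le> D * \<rho> ^ length l * fact (length l) * N (length l)" if "y \<in> V" for l y
  proof -
    have "norm (pds l X y) \<le> D * \<rho> ^ length l * wt (length l) * N (length l)" by (rule dc_onD[OF X that])
    also have "\<dots> \<le> D * \<rho> ^ length l * fact (length l) * N (length l)"
      using nn wt_le_fact tame_pos[OF N, of "length l"] by (intro mult_right_mono mult_left_mono) auto
    finally show ?thesis .
  qed
  show ?thesis unfolding dc_on_def
  proof (intro conjI ballI allI)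
    show "smooth U (\<lambda>x. X (x + \<xi> x))" by (rule smooth_compose[OF s dc_on_smooth[OF X] UV])
    show "norm (pds l (\<lambda>x. X (x + \<xi> x)) x) \<le> D * R ^ length l * wt (length l) * N (length l)" if x: "x \<in> U" for x l
      by (rule compose_bound[OF s dc_on_smooth[OF X] UV x bX[OF UV[OF x]] b[OF x] N \<mu>(3) nn(1,2,3) \<mu>0])
  qed
qed

lemma norm_vec_le_sum:
  fixes v :: "real^'n::finite"
  assumes "\<And>i. \<bar>v $ i\<bar> \<le> B" shows "norm v \<le> real CARD('n) * B"
proof -
  have "norm v \<le> (\<Sum>i\<in>UNIV. \<bar>v $ i\<bar>)" by (rule norm_le_l1_cart)
  also have "\<dots> \<le> (\<Sum>i\<in>(UNIV::'n set). B)" by (rule sum_mono) (rule assms)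
  finally show ?thesis by simp
qed

lemma dc_on_lipschitz:
  fixes \<xi> :: "real^'n::finite \<Rightarrow> real^'n"
  assumes \<xi>: "\<And>i. dc_on (ball 0 r) N D R (\<lambda>x. \<xi> x $ i)"
    and D: "(real CARD('n))\<^sup>2 * D * R * N 1 \<le> 1" and xy: "x \<in> ball 0 r" "y \<in> ball 0 r"
  shows "norm (\<xi> x - \<xi> y) \<le> norm (x - y) / 8"
proof -
  define B where "B = D * R * N 1 / 8"
  have "\<bar>(\<xi> x - \<xi> y) $ i\<bar> \<le> real CARD('n) * B * norm (x - y)" for i
  proof -
    have "norm (\<xi> x $ i - \<xi> y $ i) \<le> real CARD('n) * B * norm (x - y)"
    proof (rule smooth_lipschitz[OF convex_ball _ _ xy(2,1)])
      show "has_grad (\<lambda>x. \<xi> x $ i) z" if "z \<in> ball 0 r" for z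
        by (rule smooth_has_grad0[OF dc_on_smooth[OF \<xi>] that])
      show "norm (pd k (\<lambda>x. \<xi> x $ i) z) \<le> B" if "z \<in> ball 0 r" for z k
        using dc_onD[OF \<xi> that, of "[k]" i] by (simp add: pds_Cons B_def)
    qed
    thus ?thesis by simp
  qed
  hence "norm (\<xi> x - \<xi> y) \<le> real CARD('n) * (real CARD('n) * B * norm (x - y))" by (rule norm_vec_le_sum)
  also have "\<dots> = (real CARD('n))\<^sup>2 * D * R * N 1 * (norm (x - y) / 8)" by (simp add: B_def power2_eq_square)
  also have "\<dots> \<le> 1 * (norm (x - y) / 8)" by (intro mult_right_mono D) auto
  finally show ?thesis by simp
qed

text \<open>
  The correction \<open>\<eta>\<close> of the inverse is the fixed point of \<open>h \<mapsto> - \<xi> (x + h)\<close>. Starting the iteration at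
  0, all iterates obey the same derivative bounds, and they converge because \<open>\<xi>\<close> is a contraction.
  That the fixed point is also a left inverse follows from injectivity of \<open>x + \<xi>(x)\<close>.
\<close>

lemma near_identity_inverse:
  fixes \<xi> :: "real^'n::finite \<Rightarrow> real^'n"
  assumes \<xi>: "\<And>i. dc_on (ball 0 r) N D R (\<lambda>x. \<xi> x $ i)" and r: "r > 0" and \<xi>0: "\<xi> 0 = 0" and N: "tame N"
    and nn: "0 \<le> D" "0 \<le> R" "0 \<le> R'" and D: "(real CARD('n))\<^sup>2 * D * R * N 1 \<le> 1"
    and \<mu>: "16 \<le> \<mu> * R'" "2 * D \<le> \<mu>" "16 * real CARD('n) * N 1 * \<mu> * R \<le> 1"
  obtains \<eta> where "\<And>i. smooth (ball 0 (r / 4)) (\<lambda>x. \<eta> x $ i)" "\<eta> 0 = 0"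
    "\<And>x. norm x < r / 4 \<Longrightarrow> (x + \<eta> x) + \<xi> (x + \<eta> x) = x"
    "\<And>x. norm x < r / 8 \<Longrightarrow> (x + \<xi> x) + \<eta> (x + \<xi> x) = x"
proof -
  have lip: "norm (\<xi> x - \<xi> y) \<le> norm (x - y) / 8" if "norm x < r" "norm y < r" for x y
    by (rule dc_on_lipschitz[OF \<xi> D]) (use that in auto)
  have \<xi>le: "norm (\<xi> x) \<le> norm x / 8" if "norm x < r" for x
    using lip[OF that, of 0] r \<xi>0 by simp
  define it where "it k = ((\<lambda>h x. - \<xi> (x + h x)) ^^ k) (\<lambda>x. 0)" for k
  have it0: "it 0 = (\<lambda>x. 0)" and itS: "it (Suc k) = (\<lambda>x. - \<xi> (x + it k x))" for k
    by (simp_all add: it_def)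
  have it_le: "norm (it k x) \<le> norm x" if "norm x < r / 4" for k x
  proof (induction k)
    case (Suc k)
    have "norm (x + it k x) \<le> 2 * norm x" using norm_triangle_ineq[of x "it k x"] Suc by simp
    moreover have "norm (x + it k x) < r" using calculation that norm_ge_zero[of x] by linarith
    hence "norm (it (Suc k) x) \<le> norm (x + it k x) / 8"
      using \<xi>le[of "x + it k x"] by (simp add: itS)
    ultimately show ?case using norm_ge_zero[of x] by linarith
  qed (simp add: it0)
  have it_in: "norm (x + it k x) < r" if "norm x < r / 4" for k x
    using norm_triangle_ineq[of x "it k x"] it_le[OF that, of k] that norm_ge_zero[of x] by linarith
  have it_dc: "dc_on (ball 0 (r / 4)) N D R' (\<lambda>x. it k x $ i)" for k i
  proof (induction k arbitrary: i)
    case 0 show ?case using nn N by (auto simp: it0 intro!: dc_on_const)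
  next
    case (Suc k)
    have "dc_on (ball 0 (r / 4)) N D R' (\<lambda>x. \<xi> (x + it k x) $ i)"
      by (rule dc_on_translate_compose[OF \<xi> Suc _ N nn(1,2,3,1) \<mu>]) (use it_in in auto)
    from dc_on_cmult[OF this, of "-1"] show ?case by (simp add: itS)
  qed
  have ex: "\<exists>h. norm h \<le> norm x \<and> h = - \<xi> (x + h)" if x: "norm x < r / 4" for x
  proof -
    have "\<exists>!h\<in>cball 0 (norm x). - \<xi> (x + h) = h"
    proof (rule Banach_fix[where c="1/8"])
      have in1: "norm (x + h) < r" "norm (x + h) \<le> 2 * norm x" if "h \<in> cball 0 (norm x)" for h
      proof -
        have "norm (x + h) \<le> norm x + norm h" "norm h \<le> norm x" using norm_triangle_ineq[of x h] that by auto
        thus "norm (x + h) < r" "norm (x + h) \<le> 2 * norm x" using x norm_ge_zero[of x] by linarith+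
      qed
      show "(\<lambda>h. - \<xi> (x + h)) ` cball 0 (norm x) \<subseteq> cball 0 (norm x)"
      proof
        fix k assume "k \<in> (\<lambda>h. - \<xi> (x + h)) ` cball 0 (norm x)"
        then obtain h where h: "h \<in> cball 0 (norm x)" "k = - \<xi> (x + h)" by blast
        have "norm k \<le> norm x" unfolding h(2) norm_minus_cancel
          using \<xi>le[OF in1(1)[OF h(1)]] in1(2)[OF h(1)] norm_ge_zero[of x] by linarith
        thus "k \<in> cball 0 (norm x)" by simp
      qed
      show "dist (- \<xi> (x + h)) (- \<xi> (x + h')) \<le> 1 / 8 * dist h h'"
        if "h \<in> cball 0 (norm x)" "h' \<in> cball 0 (norm x)" for h h'
        using lip[OF in1(1)[OF that(1)] in1(1)[OF that(2)]] by (simp add: dist_norm norm_minus_commute)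
    qed (auto simp: complete_eq_closed)
    thus ?thesis by (auto intro: sym)
  qed
  define \<eta> where "\<eta> x = (SOME h. norm h \<le> norm x \<and> h = - \<xi> (x + h))" for x
  have \<eta>: "norm (\<eta> x) \<le> norm x" "\<eta> x = - \<xi> (x + \<eta> x)" if "norm x < r / 4" for x
    using someI_ex[OF ex[OF that]] unfolding \<eta>_def by auto
  have lim: "(\<lambda>k. it k x) \<longlonglongrightarrow> \<eta> x" if x: "norm x < r / 4" for x
  proof -
    have \<eta>in: "norm (x + \<eta> x) < r" using norm_triangle_ineq[of x "\<eta> x"] \<eta>(1)[OF x] x norm_ge_zero[of x] by linarith
    have "norm (it k x - \<eta> x) \<le> (1 / 8) ^ k * norm x" for k
    proof (induction k)
      case 0 thus ?case using \<eta>(1)[OF x] by (simp add: it0)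
    next
      case (Suc k)
      define w where "w = \<xi> (x + \<eta> x)"
      have "\<eta> x = - w" unfolding w_def by (rule \<eta>(2)[OF x])
      hence "it (Suc k) x - \<eta> x = - (\<xi> (x + it k x) - w)" by (simp add: itS)
      hence "norm (it (Suc k) x - \<eta> x) = norm (\<xi> (x + it k x) - \<xi> (x + \<eta> x))"
        by (simp only: norm_minus_cancel w_def)
      also have "\<dots> \<le> norm ((x + it k x) - (x + \<eta> x)) / 8" by (rule lip[OF it_in[OF x] \<eta>in])
      finally show ?case using Suc by simp
    qed
    hence ev: "\<forall>\<^sub>F k in sequentially. norm (it k x - \<eta> x) \<le> (1 / 8) ^ k * norm x" by (intro always_eventually allI)
    have "(\<lambda>k. (1 / 8) ^ k * norm x) \<longlonglongrightarrow> 0 * norm x" by (intro tendsto_mult tendsto_const LIMSEQ_power_zero) simp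
    hence "(\<lambda>k. (1 / 8) ^ k * norm x) \<longlonglongrightarrow> 0" by simp
    from Lim_null_comparison[OF ev this] have "(\<lambda>k. it k x - \<eta> x) \<longlonglongrightarrow> 0" .
    thus ?thesis by (simp add: LIM_zero_iff)
  qed
  have dcb: "dc_on (ball 0 (r / 4)) N D R' (\<lambda>x. \<eta> x $ i)" for i
  proof (rule dc_on_limit[OF open_ball, where w="\<lambda>k x. it k x $ i"])
    show "dc_on (ball 0 (r / 4)) N D R' (\<lambda>x. it k x $ i)" for k by (rule it_dc)
    show "(\<lambda>k. it k z $ i) \<longlonglongrightarrow> \<eta> z $ i" if "z \<in> ball 0 (r / 4)" for z
      using that by (intro tendsto_vec_nth lim) simp
  qed
  have right: "(x + \<eta> x) + \<xi> (x + \<eta> x) = x" if "norm x < r / 4" for x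
    using \<eta>(2)[OF that] by (metis add.assoc add.right_neutral add.right_inverse minus_minus)
  show ?thesis
  proof (rule that[of \<eta>])
    show "smooth (ball 0 (r / 4)) (\<lambda>x. \<eta> x $ i)" for i by (rule dc_on_smooth[OF dcb])
    show "\<eta> 0 = 0" using \<eta>(1)[of 0] r by simp
    show "(x + \<eta> x) + \<xi> (x + \<eta> x) = x" if "norm x < r / 4" for x by (rule right[OF that])
    fix x :: "real^'n" assume x: "norm x < r / 8"
    define z where "z = x + \<xi> x"
    have "norm z \<le> norm x + norm x / 8" using norm_triangle_ineq[of x "\<xi> x"] \<xi>le[of x] x r by (simp add: z_def)
    hence z: "norm z < r / 4" using x norm_ge_zero[of x] by linarith
    define y where "y = z + \<eta> z"
    have y: "norm y < r" using norm_triangle_ineq[of z "\<eta> z"] \<eta>(1)[OF z] z norm_ge_zero[of z] unfolding y_def by linarith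
    have "y + \<xi> y = x + \<xi> x" using right[OF z] by (simp add: y_def z_def)
    hence "y - x = - (\<xi> y - \<xi> x)" by (simp add: algebra_simps)
    hence "norm (y - x) = norm (\<xi> y - \<xi> x)" by (simp only: norm_minus_cancel)
    also have "\<dots> \<le> norm (y - x) / 8" using x r by (intro lip[OF y]) simp
    finally have "norm (y - x) \<le> norm (y - x) / 8" .
    hence "y = x" by simp
    thus "(x + \<xi> x) + \<eta> (x + \<xi> x) = x" by (simp add: y_def z_def)
  qed
qed

section \<open>Integration of a vector field by Euler's method\<close>

text \<open>
  One Euler step of length \<open>\<delta>\<close> at time \<open>t\<close> changes \<open>f + t u\<close> into \<open>f + (t - \<delta>) u\<close> up to \<open>\<delta>\<^sup>2\<close>, because
  the first order term \<open>\<delta> (\<nabla>(f + t u) \<cdot> Z - u)\<close> is controlled by the residual. With \<open>m\<close> steps of length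
  \<open>1 / m\<close> and fields of precision \<open>2\<^sup>-\<^sup>m\<close> the total error is of order \<open>1 / m\<close>. The displacement after \<open>k\<close>
  steps has derivative bounds with constant \<open>(k / m) D\<close>, since each step adds \<open>(1 / m) Z\<close> evaluated along
  a near-identity map. A convergent subsequence suffices, as the relation \<open>f \<circ> \<Phi> = f + u\<close> passes to
  any limit.
\<close>

lemma euler_flow:
  fixes f u :: "real^'n::finite \<Rightarrow> real" and Z :: "real \<Rightarrow> nat \<Rightarrow> real^'n \<Rightarrow> real^'n"
  assumes r: "0 < r" "r \<le> 1" and f: "smooth (ball 0 r) f" and u: "smooth (ball 0 r) u"
    and B: "\<And>x i j. norm x < r \<Longrightarrow> \<bar>pd j (pd i f) x\<bar> \<le> B" "\<And>x i j. norm x < r \<Longrightarrow> \<bar>pd j (pd i u) x\<bar> \<le> B"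
      "\<And>x i. norm x < r \<Longrightarrow> \<bar>pd i u x\<bar> \<le> B"
    and N: "tame N" and Z: "\<And>t Q i. 0 \<le> t \<Longrightarrow> t \<le> 1 \<Longrightarrow> dc_on (ball 0 r) N D \<rho> (\<lambda>x. Z t Q x $ i)"
    and Z0: "\<And>t Q. 0 \<le> t \<Longrightarrow> t \<le> 1 \<Longrightarrow> Z t Q 0 = 0"
    and res: "\<And>t Q x. 0 \<le> t \<Longrightarrow> t \<le> 1 \<Longrightarrow> norm x < r \<Longrightarrow>
      \<bar>(\<Sum>i\<in>UNIV. Z t Q x $ i * (pd i f x + t * pd i u x)) - u x\<bar> \<le> C * (1 / 2) ^ Q"
    and nn: "0 \<le> D" "0 \<le> \<rho>" "0 \<le> R" and D: "(real CARD('n))\<^sup>2 * D * \<rho> * N 1 \<le> 1"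
    and \<mu>: "16 \<le> \<mu> * R" "2 * D \<le> \<mu>" "16 * real CARD('n) * N 1 * \<mu> * \<rho> \<le> 1"
  obtains \<xi> where "\<And>i. dc_on (ball 0 (r / 8)) N D R (\<lambda>x. \<xi> x $ i)" "\<xi> 0 = 0"
    "\<And>x. norm x < r / 8 \<Longrightarrow> norm (x + \<xi> x) < r \<and> f (x + \<xi> x) = f x + u x"
proof -
  have Zle: "norm (Z t Q x) \<le> norm x / 8" if "0 \<le> t" "t \<le> 1" "norm x < r" for t Q x
    using dc_on_lipschitz[of r N D \<rho> "Z t Q" x 0, OF Z[OF that(1,2)] D] that r Z0[OF that(1,2)] by simp
  define it where "it m = rec_nat (\<lambda>x. 0) (\<lambda>k h x. h x + (1 / real m) *\<^sub>R Z (1 - real k / real m) m (x + h x))" for m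
  have it0: "it m 0 = (\<lambda>x. 0)" and itS: "it m (Suc k) = (\<lambda>x. it m k x + (1 / real m) *\<^sub>R Z (1 - real k / real m) m (x + it m k x))" for m k
    by (simp_all add: it_def)
  define P where "P m k x = x + it m k x" for m k x
  have tk: "0 \<le> 1 - real k / real m" "1 - real k / real m \<le> 1" if "k \<le> m" "m > 0" for k m :: nat
    using that by (auto simp: divide_simps)
  have P_le: "norm (P m k x) \<le> (1 + 1 / (8 * real m)) ^ k * norm x \<and> (1 + 1 / (8 * real m)) ^ k \<le> 3"
    if "k \<le> m" "m > 0" "norm x < r / 4" for m k x
    using that(1)
  proof (induction k)
    case (Suc k)
    have IH: "norm (P m k x) \<le> (1 + 1 / (8 * real m)) ^ k * norm x" "(1 + 1 / (8 * real m)) ^ k \<le> 3" using Suc by auto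
    have "norm (P m k x) \<le> 3 * norm x" using IH mult_right_mono[OF IH(2), of "norm x"] by simp
    hence inr: "norm (P m k x) < r" using that norm_ge_zero[of x] by linarith
    have "P m (Suc k) x = P m k x + (1 / real m) *\<^sub>R Z (1 - real k / real m) m (P m k x)"
      by (simp add: P_def itS)
    hence "norm (P m (Suc k) x) \<le> norm (P m k x) + (1 / real m) * norm (Z (1 - real k / real m) m (P m k x))"
      using norm_triangle_ineq[of "P m k x" "(1 / real m) *\<^sub>R Z (1 - real k / real m) m (P m k x)"] by simp
    also have "\<dots> \<le> norm (P m k x) + (1 / real m) * (norm (P m k x) / 8)"
      using Suc.prems that tk[of k m] inr by (intro add_left_mono mult_left_mono Zle) auto
    also have "\<dots> = (1 + 1 / (8 * real m)) * norm (P m k x)" by (simp add: algebra_simps)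
    also have "\<dots> \<le> (1 + 1 / (8 * real m)) * ((1 + 1 / (8 * real m)) ^ k * norm x)"
      by (intro mult_left_mono IH) auto
    finally have 1: "norm (P m (Suc k) x) \<le> (1 + 1 / (8 * real m)) ^ Suc k * norm x" by simp
    have "(1 + 1 / (8 * real m)) ^ Suc k \<le> exp (1 / (8 * real m)) ^ Suc k" by (intro power_mono exp_ge_add_one_self) auto
    also have "\<dots> = exp (real (Suc k) * (1 / (8 * real m)))" by (simp only: exp_of_nat_mult)
    also have "\<dots> \<le> exp 1" using Suc.prems that by (simp add: divide_simps)
    also have "\<dots> \<le> 3" by (rule exp_le)
    finally show ?case using 1 by simp
  qed (simp add: P_def it0)
  have P_in: "norm (P m k x) < r" "norm (P m k x) \<le> 3 * norm x" if "k \<le> m" "m > 0" "norm x < r / 4" for m k x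
  proof -
    have "norm (P m k x) \<le> (1 + 1 / (8 * real m)) ^ k * norm x" "(1 + 1 / (8 * real m)) ^ k \<le> 3" using P_le[OF that] by auto
    thus "norm (P m k x) \<le> 3 * norm x" using mult_right_mono[of "(1 + 1 / (8 * real m)) ^ k" 3 "norm x"] by simp
    thus "norm (P m k x) < r" using that norm_ge_zero[of x] by linarith
  qed
  have it_dc: "dc_on (ball 0 (r / 4)) N (real k / real m * D) R (\<lambda>x. it m k x $ i)" if "k \<le> m" "m > 0" for k m i
    using that(1)
  proof (induction k arbitrary: i)
    case 0 show ?case using nn N by (auto simp: it0 intro!: dc_on_const)
  next
    case (Suc k)
    have k: "k \<le> m" using Suc by simp
    have "dc_on (ball 0 (r / 4)) N D R (\<lambda>x. Z (1 - real k / real m) m (x + it m k x) $ i)"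
    proof (rule dc_on_translate_compose[OF Z Suc.IH[OF k] _ N nn(1,2,3)])
      show "x + it m k x \<in> ball 0 r" if "x \<in> ball 0 (r / 4)" for x
        using P_in(1)[OF k \<open>m > 0\<close>, of x] that by (simp add: P_def)
      have "real k / real m * D \<le> 1 * D" using k that nn by (intro mult_right_mono) auto
      thus "2 * (real k / real m * D) \<le> \<mu>" using \<mu> by simp
    qed (use tk[OF k that(2)] nn \<mu> in auto)
    from dc_on_add[OF Suc.IH[OF k] dc_on_cmult[OF this, of "1 / real m"]]
    show ?case using that by (simp add: itS add_divide_distrib algebra_simps)
  qed
  \<comment> \<open>\<open>m + 1\<close> steps, so that the step length is never \<open>1 / 0\<close>\<close>
  define \<Xi> where "\<Xi> m = it (Suc m) (Suc m)" for m
  have \<Xi>dc: "dc_on (ball 0 (r / 4)) N D R (\<lambda>x. \<Xi> m x $ i)" for m i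
    using it_dc[of "Suc m" "Suc m" i] by (simp add: \<Xi>_def)
  have \<Xi>0: "\<Xi> m 0 = 0" for m using P_in(2)[of "Suc m" "Suc m" 0] r by (simp add: \<Xi>_def P_def)
  define n where "n = real CARD('n)"
  have n: "n \<ge> 1" by (simp add: n_def Suc_leI)
  have "\<bar>pd (undefined::'n) u 0\<bar> \<le> B" using B(3)[of 0] r by simp
  hence B0: "0 \<le> B" using abs_ge_zero order_trans by blast
  define B' where "B' = n\<^sup>2 * B + n\<^sup>2 * B + n * B"
  have step: "\<bar>(f y' + (t - \<delta>) * u y') - (f y + t * u y)\<bar> \<le> \<delta>\<^sup>2 * B' + \<delta> * (C * (1 / 2) ^ Q)"
    if t: "0 \<le> t" "t \<le> 1" and \<delta>: "0 \<le> \<delta>" "\<delta> \<le> 1" and y: "norm y < r" "norm y' < r" and y': "y' = y + \<delta> *\<^sub>R Z t Q y" for t \<delta> Q y y'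
  proof -
    define z where "z = Z t Q y"
    have z: "norm z \<le> 1" using Zle[OF t y(1), of Q] y r by (simp add: z_def)
    have nz: "norm (y' - y) \<le> \<delta>" using z \<delta> mult_left_mono[OF z, of \<delta>] by (simp add: y' z_def)
    hence nz2: "(norm (y' - y))\<^sup>2 \<le> \<delta>\<^sup>2" by (intro power_mono) auto
    have T: "\<bar>h y' - h y - (\<Sum>i\<in>UNIV. (y' - y) $ i * pd i h y)\<bar> \<le> n\<^sup>2 * B * \<delta>\<^sup>2"
      if h: "smooth (ball 0 r) h" "\<And>x i j. norm x < r \<Longrightarrow> \<bar>pd j (pd i h) x\<bar> \<le> B" for h
    proof -
      have "norm (h y' - h y - (\<Sum>i\<in>UNIV. (y' - y) $ i * pd i h y)) \<le> n\<^sup>2 * B * (norm (y' - y))\<^sup>2"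
        unfolding n_def
        by (rule taylor_second_order[OF convex_ball[of 0 r] smooth_has_grad0[OF h(1)] smooth_has_grad0[OF smooth_pd[OF h(1)]]])
          (use h(2) y in auto)
      also have "\<dots> \<le> n\<^sup>2 * B * \<delta>\<^sup>2" using B0 by (intro mult_left_mono nz2) auto
      finally show ?thesis by simp
    qed
    have L: "\<bar>u y' - u y\<bar> \<le> n * B * \<delta>"
    proof -
      have "norm (u y' - u y) \<le> n * B * norm (y' - y)"
        unfolding n_def by (rule smooth_lipschitz[OF convex_ball[of 0 r] smooth_has_grad0[OF u]]) (use B(3) y in auto)
      also have "\<dots> \<le> n * B * \<delta>" using n B0 by (intro mult_left_mono nz) auto
      finally show ?thesis by simp
    qed
    have S: "(\<Sum>i\<in>UNIV. (y' - y) $ i * pd i f y) + t * (\<Sum>i\<in>UNIV. (y' - y) $ i * pd i u y) = \<delta> * (\<Sum>i\<in>UNIV. z $ i * (pd i f y + t * pd i u y))"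
      by (simp add: y' z_def sum_distrib_left sum.distrib[symmetric] algebra_simps)
    define a1 where "a1 = f y' - f y - (\<Sum>i\<in>UNIV. (y' - y) $ i * pd i f y)"
    define a2 where "a2 = u y' - u y - (\<Sum>i\<in>UNIV. (y' - y) $ i * pd i u y)"
    define a3 where "a3 = (\<Sum>i\<in>UNIV. z $ i * (pd i f y + t * pd i u y)) - u y"
    have "(f y' + (t - \<delta>) * u y') - (f y + t * u y) = a1 + t * a2 + \<delta> * a3 - \<delta> * (u y' - u y)"
      using S unfolding a1_def a2_def a3_def by (simp add: algebra_simps)
    moreover have "\<bar>a1\<bar> \<le> n\<^sup>2 * B * \<delta>\<^sup>2" unfolding a1_def by (rule T[OF f B(1)])
    moreover have "\<bar>t * a2\<bar> \<le> 1 * (n\<^sup>2 * B * \<delta>\<^sup>2)"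
      unfolding abs_mult a2_def using t by (intro mult_mono T[OF u B(2)]) auto
    moreover have "\<bar>\<delta> * a3\<bar> \<le> \<delta> * (C * (1 / 2) ^ Q)"
      unfolding abs_mult a3_def z_def using res[OF t y(1), of Q] \<delta> by (simp add: mult_left_mono)
    moreover have "\<bar>\<delta> * (u y' - u y)\<bar> \<le> \<delta> * (n * B * \<delta>)"
      unfolding abs_mult using L \<delta> by (simp add: mult_left_mono)
    moreover have "\<delta>\<^sup>2 * B' = n\<^sup>2 * B * \<delta>\<^sup>2 + 1 * (n\<^sup>2 * B * \<delta>\<^sup>2) + \<delta> * (n * B * \<delta>)"
      by (simp add: B'_def power2_eq_square algebra_simps)
    ultimately show ?thesis by linarith
  qed
  have err: "\<bar>(f (P m k x) + (1 - real k / real m) * u (P m k x)) - (f x + u x)\<bar> \<le> real k * ((1 / real m)\<^sup>2 * B' + 1 / real m * (C * (1 / 2) ^ m))"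
    if "k \<le> m" "m > 0" "norm x < r / 4" for m k x
    using that(1)
  proof (induction k)
    case 0 show ?case by (simp add: P_def it0)
  next
    case (Suc k)
    have k: "k \<le> m" using Suc by simp
    have "\<bar>(f (P m (Suc k) x) + (1 - real k / real m - 1 / real m) * u (P m (Suc k) x)) - (f (P m k x) + (1 - real k / real m) * u (P m k x))\<bar>
        \<le> (1 / real m)\<^sup>2 * B' + 1 / real m * (C * (1 / 2) ^ m)"
    proof (rule step[OF tk[OF k that(2)]])
      show "norm (P m k x) < r" by (rule P_in[OF k that(2,3)])
      show "norm (P m (Suc k) x) < r" by (rule P_in[OF Suc.prems that(2,3)])
      show "P m (Suc k) x = P m k x + (1 / real m) *\<^sub>R Z (1 - real k / real m) m (P m k x)" by (simp add: P_def itS)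
    qed (use that(2) in auto)
    moreover have "1 - real k / real m - 1 / real m = 1 - real (Suc k) / real m" by (simp add: add_divide_distrib)
    moreover have "real (Suc k) * e = real k * e + e" for e :: real by (simp add: algebra_simps)
    ultimately have A: "\<bar>f (P m (Suc k) x) + (1 - real (Suc k) / real m) * u (P m (Suc k) x) - (f (P m k x) + (1 - real k / real m) * u (P m k x))\<bar>
        \<le> (1 / real m)\<^sup>2 * B' + 1 / real m * (C * (1 / 2) ^ m)" by simp
    have tri: "\<bar>a - c\<bar> \<le> e' + e" if "\<bar>a - b\<bar> \<le> e" "\<bar>b - c\<bar> \<le> e'" for a b c e e' :: real using that by linarith
    have e: "real (Suc k) * e = real k * e + e" for e :: real by (simp add: algebra_simps)
    show ?case unfolding e by (rule tri[OF A Suc.IH[OF k]])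
  qed
  have err1: "\<bar>f (x + \<Xi> m x) - (f x + u x)\<bar> \<le> B' / real (Suc m) + C * (1 / 2) ^ Suc m" if "norm x < r / 4" for m x
  proof -
    have "real (Suc m) * ((1 / real (Suc m))\<^sup>2 * B' + 1 / real (Suc m) * (C * (1 / 2) ^ Suc m)) = B' / real (Suc m) + C * (1 / 2) ^ Suc m"
    proof -
      have gen: "M * ((1 / M)\<^sup>2 * B' + 1 / M * X) = B' / M + X" if "M > 0" for M X :: real
        using that by (simp add: field_simps power2_eq_square)
      show ?thesis by (rule gen) simp
    qed
    thus ?thesis using err[of "Suc m" "Suc m" x] that by (simp add: P_def \<Xi>_def)
  qed
  define S where "S = cball (0::real^'n) (r / 8)"
  have Slip: "norm (\<Xi> m x - \<Xi> m y) \<le> n * (n * (D * R * N 1 / 8) * norm (x - y))" if "x \<in> S" "y \<in> S" for m x y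
  proof -
    have "\<bar>(\<Xi> m x - \<Xi> m y) $ i\<bar> \<le> n * (D * R * N 1 / 8) * norm (x - y)" for i
    proof -
      have "norm (\<Xi> m x $ i - \<Xi> m y $ i) \<le> n * (D * R * N 1 / 8) * norm (x - y)"
        unfolding n_def
      proof (rule smooth_lipschitz[where S="ball 0 (r / 4)"])
        show "norm (pd k (\<lambda>x. \<Xi> m x $ i) z) \<le> D * R * N 1 / 8" if "z \<in> ball 0 (r / 4)" for z k
          using dc_onD[OF \<Xi>dc that, of "[k]" m i] by (simp add: pds_Cons)
      qed (use that r smooth_has_grad0[OF dc_on_smooth[OF \<Xi>dc]] in \<open>auto simp: S_def\<close>)
      thus ?thesis by simp
    qed
    thus ?thesis unfolding n_def by (rule norm_vec_le_sum)
  qed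
  obtain \<xi> k where k: "strict_mono (k :: nat \<Rightarrow> nat)"
    and lim0: "\<And>e. 0 < e \<Longrightarrow> \<exists>K. \<forall>m x. m \<ge> K \<and> x \<in> S \<longrightarrow> norm (\<Xi> (k m) x - \<xi> x) < e"
  proof (rule Arzela_Ascoli[of S \<Xi> "n * D"])
    show "compact S" by (simp add: S_def)
    show "norm (\<Xi> m x) \<le> n * D" if "x \<in> S" for m x
      unfolding n_def
    proof (rule norm_vec_le_sum)
      show "\<bar>\<Xi> m x $ i\<bar> \<le> D" for i
        using dc_on_norm_le[OF \<Xi>dc _ N, of x m i] that r by (simp add: S_def)
    qed
    fix x :: "real^'n" and e :: real assume x: "x \<in> S" and e: "0 < e"
    define L where "L = n * (n * (D * R * N 1 / 8)) + 1"
    have L: "L \<ge> 1" using n nn tame_pos[OF N, of 1] by (simp add: L_def)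
    show "\<exists>d. 0 < d \<and> (\<forall>m y. y \<in> S \<and> norm (x - y) < d \<longrightarrow> norm (\<Xi> m x - \<Xi> m y) < e)"
    proof (intro exI[of _ "e / L"] conjI allI impI)
      show "0 < e / L" using e L by simp
      fix m y assume y: "y \<in> S \<and> norm (x - y) < e / L"
      have "norm (\<Xi> m x - \<Xi> m y) \<le> n * (n * (D * R * N 1 / 8) * norm (x - y))" using Slip x y by blast
      also have "\<dots> = (L - 1) * norm (x - y)" by (simp add: L_def)
      also have "\<dots> \<le> L * norm (x - y)" by (intro mult_right_mono) auto
      also have "\<dots> < e" using y L by (simp add: field_simps)
      finally show "norm (\<Xi> m x - \<Xi> m y) < e" .
    qed
  qed blast
  have lim: "(\<lambda>m. \<Xi> (k m) x) \<longlonglongrightarrow> \<xi> x" if "norm x < r / 8" for x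
  proof (rule LIMSEQ_I)
    fix e :: real assume "0 < e"
    then obtain K where "\<And>m x. m \<ge> K \<and> x \<in> S \<Longrightarrow> norm (\<Xi> (k m) x - \<xi> x) < e" using lim0 by blast
    moreover have "x \<in> S" using that by (simp add: S_def)
    ultimately show "\<exists>K. \<forall>m\<ge>K. norm (\<Xi> (k m) x - \<xi> x) < e" by blast
  qed
  show ?thesis
  proof (rule that[of \<xi>])
    show "dc_on (ball 0 (r / 8)) N D R (\<lambda>x. \<xi> x $ i)" for i
    proof (rule dc_on_limit[OF open_ball])
      show "dc_on (ball 0 (r / 8)) N D R (\<lambda>x. \<Xi> (k m) x $ i)" for m
        using r nn tame_pos[OF N] by (intro dc_on_mono[OF \<Xi>dc]) (auto intro: less_imp_le)
      show "(\<lambda>m. \<Xi> (k m) z $ i) \<longlonglongrightarrow> \<xi> z $ i" if "z \<in> ball 0 (r / 8)" for z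
        using that by (intro tendsto_vec_nth lim) simp
    qed
    show "\<xi> 0 = 0" using lim[of 0] r by (simp add: \<Xi>0 LIMSEQ_const_iff)
    fix x :: "real^'n" assume x: "norm x < r / 8"
    have x4: "norm x < r / 4" using x r by simp
    have "(\<lambda>m. norm (x + \<Xi> (k m) x)) \<longlonglongrightarrow> norm (x + \<xi> x)" by (intro tendsto_intros lim x)
    moreover have "norm (x + \<Xi> (k m) x) \<le> 3 * norm x" for m
      using P_in(2)[of "Suc (k m)" "Suc (k m)" x] x4 by (simp add: P_def \<Xi>_def)
    ultimately have "norm (x + \<xi> x) \<le> 3 * norm x" by (intro LIMSEQ_le_const2[of "\<lambda>m. norm (x + \<Xi> (k m) x)"]) auto
    hence inr: "norm (x + \<xi> x) < r" using x norm_ge_zero[of x] by linarith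
    have "isCont f (x + \<xi> x)" using inr by (intro has_grad_isCont smooth_has_grad0[OF f]) simp
    hence 1: "(\<lambda>m. f (x + \<Xi> (k m) x)) \<longlonglongrightarrow> f (x + \<xi> x)"
      by (rule isCont_tendsto_compose) (intro tendsto_intros lim x)
    define e where "e m = B' * inverse (real (Suc m)) + C * (1 / 2) ^ Suc m" for m
    have "(\<lambda>m. B' * inverse (real (Suc m)) + C * (1 / 2) ^ Suc m) \<longlonglongrightarrow> B' * 0 + C * 0"
      by (intro tendsto_add tendsto_mult tendsto_const LIMSEQ_inverse_real_of_nat LIMSEQ_Suc[OF LIMSEQ_power_zero]) simp
    hence "e \<longlonglongrightarrow> 0" unfolding e_def[abs_def] by simp
    hence ek: "(\<lambda>m. e (k m)) \<longlonglongrightarrow> 0" using LIMSEQ_subseq_LIMSEQ[OF _ k, of e 0] unfolding o_def by blast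
    have "norm (f (x + \<Xi> (k m) x) - (f x + u x)) \<le> e (k m)" for m
      using err1[OF x4, of "k m"] by (simp add: e_def inverse_eq_divide)
    hence "(\<lambda>m. f (x + \<Xi> (k m) x) - (f x + u x)) \<longlonglongrightarrow> 0"
      by (intro Lim_null_comparison[OF always_eventually ek]) blast
    hence "(\<lambda>m. f (x + \<Xi> (k m) x)) \<longlonglongrightarrow> f x + u x" by (simp add: LIM_zero_iff)
    from LIMSEQ_unique[OF 1 this] inr show "norm (x + \<xi> x) < r \<and> f (x + \<xi> x) = f x + u x" by simp
  qed
qed

section \<open>Germs of Denjoy-Carleman class\<close>

definition dc_germ :: "(nat \<Rightarrow> real) \<Rightarrow> (real^'n::finite \<Rightarrow> real) \<Rightarrow> bool" where
  "dc_germ N u \<longleftrightarrow> (\<exists>R\<ge>0. \<exists>D\<ge>0. \<exists>r>0. dc_on (ball 0 r) N D R u)"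

text \<open>
  The bounds tend to 0 on shrinking balls while the growth rate \<open>R\<close> stays the same. This is the
  quantitative form of flatness at the origin that the smallness conditions above ask for.
\<close>

definition flat_germ :: "(nat \<Rightarrow> real) \<Rightarrow> (real^'n::finite \<Rightarrow> real) \<Rightarrow> bool" where
  "flat_germ N u \<longleftrightarrow> (\<exists>R\<ge>0. \<forall>\<epsilon>>0. \<exists>r>0. dc_on (ball 0 r) N \<epsilon> R u)"

lemma dc_on_ball_mono:
  assumes "dc_on (ball 0 r) N D R u" "tame N" "0 < r'" "r' \<le> r" "0 \<le> D" "D \<le> D'" "0 \<le> R" "R \<le> R'"
  shows "dc_on (ball 0 r') N D' R' u"
  using assms tame_pos[OF assms(2)] by (intro dc_on_mono[OF assms(1)]) (auto intro: less_imp_le)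

lemma germ_eq_radius:
  fixes u :: "real^'n::finite \<Rightarrow> 'b"
  assumes "germ_eq u v" obtains r where "r > 0" "\<And>x. norm x < r \<Longrightarrow> u x = v x"
  using assms unfolding germ_eq_def eventually_nhds_metric by auto

lemma germ_eqI_radius:
  fixes u :: "real^'n::finite \<Rightarrow> 'b"
  assumes "r > 0" "\<And>x. norm x < r \<Longrightarrow> u x = v x" shows "germ_eq u v"
  unfolding germ_eq_def eventually_nhds_metric using assms by auto

lemma dc_germ_cong:
  fixes u :: "real^'n::finite \<Rightarrow> real"
  assumes "germ_eq u v" "dc_germ N u" "tame N" shows "dc_germ N v"
proof -
  obtain R D r where u: "R \<ge> 0" "D \<ge> 0" "r > 0" "dc_on (ball 0 r) N D R u" using assms(2) unfolding dc_germ_def by blast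
  obtain r' where r': "r' > 0" "\<And>x. norm x < r' \<Longrightarrow> u x = v x" using germ_eq_radius[OF assms(1)] by blast
  have "dc_on (ball 0 (min r r')) N D R u" using u r' assms(3) by (intro dc_on_ball_mono[OF u(4)]) auto
  hence "dc_on (ball 0 (min r r')) N D R v" by (rule dc_on_cong[rotated]) (use r'(2) in auto)
  thus ?thesis unfolding dc_germ_def using u r' by (metis min_less_iff_conj)
qed

lemma dc_germ_common:
  fixes u :: "'i \<Rightarrow> real^'n::finite \<Rightarrow> real"
  assumes "finite I" "tame N" "\<And>i. i \<in> I \<Longrightarrow> dc_germ N (u i)"
  shows "\<exists>R\<ge>0. \<exists>D\<ge>0. \<exists>r>0. \<forall>i\<in>I. dc_on (ball 0 r) N D R (u i)"
  using assms(1,3)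
proof (induction I rule: finite_induct)
  case empty thus ?case by (auto intro!: exI[of _ 0] exI[of _ 1])
next
  case (insert i I)
  then obtain R D r where 1: "R \<ge> 0" "D \<ge> 0" "r > 0" "\<forall>i\<in>I. dc_on (ball 0 r) N D R (u i)" by auto
  have "dc_germ N (u i)" using insert.prems by simp
  then obtain R' D' r' where 2: "R' \<ge> 0" "D' \<ge> 0" "r' > 0" "dc_on (ball 0 r') N D' R' (u i)" unfolding dc_germ_def by auto
  have "dc_on (ball 0 (min r r')) N (max D D') (max R R') (u k)" if "k \<in> insert i I" for k
  proof (cases "k = i")
    case True
    have "dc_on (ball 0 (min r r')) N (max D D') (max R R') (u i)"
      by (rule dc_on_ball_mono[OF 2(4) assms(2)]) (use 1(1-3) 2(1-3) in auto)
    thus ?thesis using True by simp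
  next
    case False
    hence "dc_on (ball 0 r) N D R (u k)" using 1 that by auto
    thus ?thesis by (rule dc_on_ball_mono) (use 1(1-3) 2(1-3) assms(2) in auto)
  qed
  moreover have "0 \<le> max R R'" "0 \<le> max D D'" "0 < min r r'" using 1 2 by auto
  ultimately show ?case by blast
qed

lemma flat_germ_common:
  fixes u :: "'i \<Rightarrow> real^'n::finite \<Rightarrow> real"
  assumes "finite I" "tame N" "\<And>i. i \<in> I \<Longrightarrow> flat_germ N (u i)"
  shows "\<exists>R\<ge>0. \<forall>\<epsilon>>0. \<exists>r>0. \<forall>i\<in>I. dc_on (ball 0 r) N \<epsilon> R (u i)"
  using assms(1,3)
proof (induction I rule: finite_induct)
  case empty thus ?case by (auto intro!: exI[of _ 0] exI[of _ 1])
next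
  case (insert i I)
  then obtain R where 1: "R \<ge> 0" "\<And>\<epsilon>. \<epsilon> > 0 \<Longrightarrow> \<exists>r>0. \<forall>i\<in>I. dc_on (ball 0 r) N \<epsilon> R (u i)" by auto
  have "flat_germ N (u i)" using insert.prems by simp
  then obtain R' where 2: "R' \<ge> 0" "\<And>\<epsilon>. \<epsilon> > 0 \<Longrightarrow> \<exists>r>0. dc_on (ball 0 r) N \<epsilon> R' (u i)" unfolding flat_germ_def by auto
  have "\<exists>r>0. \<forall>k\<in>insert i I. dc_on (ball 0 r) N \<epsilon> (max R R') (u k)" if \<epsilon>: "\<epsilon> > 0" for \<epsilon>
  proof -
    obtain r where r: "r > 0" "\<forall>i\<in>I. dc_on (ball 0 r) N \<epsilon> R (u i)" using 1(2)[OF \<epsilon>] by blast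
    obtain r' where r': "r' > 0" "dc_on (ball 0 r') N \<epsilon> R' (u i)" using 2(2)[OF \<epsilon>] by blast
    have "dc_on (ball 0 (min r r')) N \<epsilon> (max R R') (u k)" if "k \<in> insert i I" for k
    proof (cases "k = i")
      case True
      have "dc_on (ball 0 (min r r')) N \<epsilon> (max R R') (u i)"
        by (rule dc_on_ball_mono[OF r'(2) assms(2)]) (use 1(1) 2(1) r(1) r'(1) \<epsilon> in auto)
      thus ?thesis using True by simp
    next
      case False
      hence "dc_on (ball 0 r) N \<epsilon> R (u k)" using r that by auto
      thus ?thesis by (rule dc_on_ball_mono) (use 1(1) 2(1) r(1) r'(1) \<epsilon> assms(2) in auto)
    qed
    moreover have "0 < min r r'" using r r' by simp
    ultimately show ?thesis by blast
  qed
  thus ?case using 1(1) by (intro exI[of _ "max R R'"]) auto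
qed

lemma dc_germ_const: assumes "tame N" shows "dc_germ N (\<lambda>x. c)"
  unfolding dc_germ_def using dc_on_const[of "ball 0 1" c "\<bar>c\<bar>" 0 N] assms
  by (intro exI[of _ 0] exI[of _ "\<bar>c\<bar>"] exI[of _ 1] conjI) auto

lemma dc_germ_sum:
  fixes u :: "'i \<Rightarrow> real^'n::finite \<Rightarrow> real"
  assumes "tame N" "\<And>i. i \<in> I \<Longrightarrow> dc_germ N (u i)"
  shows "dc_germ N (\<lambda>x. \<Sum>i\<in>I. u i x)"
proof (cases "finite I")
  case True
  obtain R D r where 1: "R \<ge> 0" "D \<ge> 0" "r > 0" "\<forall>i\<in>I. dc_on (ball 0 r) N D R (u i)"
    using dc_germ_common[of I N u, OF True assms] by blast
  have "dc_on (ball 0 r) N (\<Sum>i\<in>I. D) R (\<lambda>x. \<Sum>i\<in>I. u i x)" using 1 assms by (intro dc_on_sum) auto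
  moreover have "0 \<le> (\<Sum>i\<in>I. D)" using 1 by (intro sum_nonneg)
  ultimately show ?thesis unfolding dc_germ_def using 1 by blast
qed (simp add: dc_germ_const assms)

lemma flat_germ_sum:
  fixes u :: "'i \<Rightarrow> real^'n::finite \<Rightarrow> real"
  assumes "finite I" "tame N" "\<And>i. i \<in> I \<Longrightarrow> flat_germ N (u i)"
  shows "flat_germ N (\<lambda>x. \<Sum>i\<in>I. u i x)"
proof -
  obtain R where 1: "R \<ge> 0" "\<And>\<epsilon>. \<epsilon> > 0 \<Longrightarrow> \<exists>r>0. \<forall>i\<in>I. dc_on (ball 0 r) N \<epsilon> R (u i)"
    using flat_germ_common[of I N u, OF assms] by blast
  have "\<exists>r>0. dc_on (ball 0 r) N \<epsilon> R (\<lambda>x. \<Sum>i\<in>I. u i x)" if \<epsilon>: "\<epsilon> > 0" for \<epsilon>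
  proof -
    define c where "c = real (card I) + 1"
    have c: "c > 0" by (simp add: c_def)
    obtain r where r: "r > 0" "\<forall>i\<in>I. dc_on (ball 0 r) N (\<epsilon> / c) R (u i)" using 1(2)[of "\<epsilon> / c"] \<epsilon> c by auto
    have S: "dc_on (ball 0 r) N (\<Sum>i\<in>I. \<epsilon> / c) R (\<lambda>x. \<Sum>i\<in>I. u i x)"
      by (rule dc_on_sum[OF open_ball 1(1) assms(2)]) (use r(2) in blast)
    have "(\<Sum>i\<in>I. \<epsilon> / c) \<le> \<epsilon>" "0 \<le> (\<Sum>i\<in>I. \<epsilon> / c)"
      using \<epsilon> c by (simp_all add: c_def divide_simps)
    hence "dc_on (ball 0 r) N \<epsilon> R (\<lambda>x. \<Sum>i\<in>I. u i x)"
      by (intro dc_on_mono_const[OF S assms(2)]) (use 1(1) in auto)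
    thus ?thesis using r by blast
  qed
  thus ?thesis unfolding flat_germ_def using 1(1) by blast
qed

lemma flat_germ_add: "tame N \<Longrightarrow> flat_germ N u \<Longrightarrow> flat_germ N v \<Longrightarrow> flat_germ N (\<lambda>x. u x + v x)"
  using flat_germ_sum[of UNIV N "\<lambda>i::bool. if i then u else v"] by (simp add: UNIV_bool add.commute)

lemma dc_germ_mult:
  fixes u v :: "real^'n::finite \<Rightarrow> real"
  assumes "tame N" "dc_germ N u" "dc_germ N v" shows "dc_germ N (\<lambda>x. u x * v x)"
proof -
  obtain R D r where 1: "R \<ge> 0" "D \<ge> 0" "r > 0" "\<forall>w\<in>{u, v}. dc_on (ball 0 r) N D R w"
    using dc_germ_common[of "{u, v}" N "\<lambda>w. w"] assms by auto
  have "dc_on (ball 0 r) N (8 * D * D) R (\<lambda>x. u x * v x)" using 1 assms(1) by (intro dc_on_mult) auto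
  moreover have "0 \<le> 8 * D * D" using 1 by simp
  ultimately show ?thesis unfolding dc_germ_def using 1 by blast
qed

lemma flat_germ_mult:
  fixes u v :: "real^'n::finite \<Rightarrow> real"
  assumes "tame N" "dc_germ N u" "flat_germ N v" shows "flat_germ N (\<lambda>x. u x * v x)"
proof -
  obtain R D r where 1: "R \<ge> 0" "D \<ge> 0" "r > 0" "dc_on (ball 0 r) N D R u" using assms(2) unfolding dc_germ_def by blast
  obtain R' where 2: "R' \<ge> 0" "\<And>\<epsilon>. \<epsilon> > 0 \<Longrightarrow> \<exists>r>0. dc_on (ball 0 r) N \<epsilon> R' v" using assms(3) unfolding flat_germ_def by blast
  have "\<exists>r>0. dc_on (ball 0 r) N \<epsilon> (max R R') (\<lambda>x. u x * v x)" if \<epsilon>: "\<epsilon> > 0" for \<epsilon>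
  proof -
    define e where "e = \<epsilon> / (8 * D + 1)"
    have e: "e > 0" using \<epsilon> 1(2) by (simp add: e_def add_nonneg_pos)
    obtain r' where r': "r' > 0" "dc_on (ball 0 r') N e R' v" using 2(2)[OF e] by blast
    define s where "s = min r r'"
    have s: "s > 0" "s \<le> r" "s \<le> r'" using 1 r' by (auto simp: s_def)
    have us: "dc_on (ball 0 s) N D (max R R') u"
      by (rule dc_on_ball_mono[OF 1(4) assms(1) s(1,2)]) (use 1(1,2) in auto)
    have vs: "dc_on (ball 0 s) N e (max R R') v"
      by (rule dc_on_ball_mono[OF r'(2) assms(1) s(1,3)]) (use 2(1) e in auto)
    have uv: "dc_on (ball 0 s) N (8 * D * e) (max R R') (\<lambda>x. u x * v x)"
      by (rule dc_on_mult[OF us vs assms(1)]) (use 1(1,2) e in auto)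
    have "8 * D * e \<le> \<epsilon>"
    proof -
      have "8 * D * e \<le> (8 * D + 1) * e" using e by (intro mult_right_mono) auto
      also have "\<dots> = \<epsilon>" using 1(2) by (simp add: e_def)
      finally show ?thesis .
    qed
    hence "dc_on (ball 0 s) N \<epsilon> (max R R') (\<lambda>x. u x * v x)"
      by (intro dc_on_mono_const[OF uv assms(1)]) (use 1(1,2) e in auto)
    thus ?thesis using s by blast
  qed
  thus ?thesis unfolding flat_germ_def using 1(1) by (intro exI[of _ "max R R'"]) auto
qed

lemma dc_germ_prod:
  fixes u :: "'i \<Rightarrow> real^'n::finite \<Rightarrow> real"
  assumes "tame N" "\<And>i. i \<in> I \<Longrightarrow> dc_germ N (u i)"
  shows "dc_germ N (\<lambda>x. \<Prod>i\<in>I. u i x)"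
  using assms(2) by (induction I rule: infinite_finite_induct) (simp_all add: dc_germ_const dc_germ_mult assms(1))

lemma dc_germ_det:
  fixes A :: "real^'n::finite \<Rightarrow> real^'p::finite^'p"
  assumes "tame N" "\<And>i j. dc_germ N (\<lambda>x. A x $ i $ j)"
  shows "dc_germ N (\<lambda>x. det (A x))"
  unfolding det_def by (intro dc_germ_sum dc_germ_mult dc_germ_prod dc_germ_const assms)

lemma flat_germ_zero:
  fixes u :: "real^'n::finite \<Rightarrow> real"
  assumes "tame N" "flat_germ N u" shows "u 0 = 0"
proof -
  obtain R where R: "\<And>\<epsilon>. \<epsilon> > 0 \<Longrightarrow> \<exists>r>0. dc_on (ball 0 r) N \<epsilon> R u" using assms(2) unfolding flat_germ_def by blast
  have "\<bar>u 0\<bar> \<le> \<epsilon>" if \<epsilon>: "\<epsilon> > 0" for \<epsilon>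
  proof -
    obtain r where "r > 0" "dc_on (ball 0 r) N \<epsilon> R u" using R[OF \<epsilon>] by blast
    thus ?thesis using dc_on_norm_le[of "ball 0 r" N \<epsilon> R u 0] assms(1) by simp
  qed
  thus ?thesis using field_le_epsilon[of "\<bar>u 0\<bar>" 0] by simp
qed

lemma analytic_germ_dc_germ:
  fixes f :: "real^'n::finite \<Rightarrow> real"
  assumes "f \<in> analytic_germs" "tame N" shows "dc_germ N f"
proof -
  obtain s D R where s: "s > 0" "D \<ge> 0" "R \<ge> 0" "dc_on (ball 0 s) (\<lambda>_. 1) D R f" using analytic_germ_dc_on[OF assms(1)] by blast
  have "dc_on (ball 0 s) N D R f"
    using s tame_ge_1[OF assms(2)] by (intro dc_on_mono[OF s(4)]) auto
  thus ?thesis unfolding dc_germ_def using s by blast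
qed

lemma germ_eq_pd:
  fixes u :: "real^'n::finite \<Rightarrow> real"
  assumes "germ_eq u v" shows "germ_eq (pd i u) (pd i v)"
proof -
  obtain r where r: "r > 0" "\<And>x. norm x < r \<Longrightarrow> u x = v x" using germ_eq_radius[OF assms] by blast
  have "pd i u x = pd i v x" if "norm x < r" for x
    using r that by (intro pd_cong[of "ball 0 r"]) auto
  thus ?thesis using r by (intro germ_eqI_radius)
qed

section \<open>Division of flat functions by analytic functions\<close>

lemma set_dist_ge:
  assumes "set_dist a Z \<ge> ereal c" "z \<in> Z" shows "dist a z \<ge> c"
proof -
  have "set_dist a Z \<le> ereal (dist a z)" unfolding set_dist_def using assms(2) by (rule INF_lower)
  with assms(1) have "ereal c \<le> ereal (dist a z)" by (rule order_trans)
  thus ?thesis by simp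
qed

text \<open>
  A decay of second order in the distance to \<open>Y\<close> is enough to differentiate at points of \<open>Y\<close> with
  derivative 0; induction on the order of differentiation does the rest.
\<close>

lemma smooth_flat_extension:
  fixes q :: "real^'n::finite \<Rightarrow> real"
  assumes Y: "closed Y" "0 \<in> Y" and q0: "\<And>x. x \<in> Y \<Longrightarrow> q x = 0" and sq: "smooth (ball 0 r - Y) q"
    and dec: "\<And>x l. norm x < r \<Longrightarrow> x \<notin> Y \<Longrightarrow> \<bar>pds l q x\<bar> \<le> B l * (infdist x Y)\<^sup>2"
  shows "smooth (ball 0 r) q" "\<And>x l. norm x < r \<Longrightarrow> \<bar>pds l q x\<bar> \<le> B l * (infdist x Y)\<^sup>2"
proof -
  have step: "has_grad (pds l q) y \<and> (\<forall>i. pd i (pds l q) y = 0)"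
    if z: "\<And>y. y \<in> Y \<Longrightarrow> norm y < r \<Longrightarrow> pds l q y = 0" and y: "y \<in> Y" "norm y < r" for l y
  proof -
    have *: "(pds l q has_derivative (\<lambda>h. \<Sum>i\<in>UNIV. h $ i * 0)) (at y)"
    proof (rule has_derivative_quadratic)
      show "bounded_linear (\<lambda>h::real^'n. \<Sum>i\<in>UNIV. h $ i * 0)" by (rule bounded_linear_form)
      show "r - norm y > 0" using y by simp
      fix x assume "x \<in> ball y (r - norm y)"
      hence xr: "norm x < r" using norm_triangle_ineq2[of x y] by (simp add: dist_norm norm_minus_commute)
      have "\<bar>pds l q x\<bar> \<le> \<bar>B l\<bar> * (norm (x - y))\<^sup>2"
      proof (cases "x \<in> Y")
        case True thus ?thesis using z xr by simp
      next
        case False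
        have "\<bar>pds l q x\<bar> \<le> B l * (infdist x Y)\<^sup>2" by (rule dec[OF xr False])
        also have "\<dots> \<le> \<bar>B l\<bar> * (norm (x - y))\<^sup>2"
          using infdist_le[OF y(1), of x] infdist_nonneg[of x Y] by (intro mult_mono power_mono) (auto simp: dist_norm)
        finally show ?thesis .
      qed
      thus "norm (pds l q x - pds l q y - (\<Sum>i\<in>UNIV. (x - y) $ i * 0)) \<le> \<bar>B l\<bar> * (norm (x - y))\<^sup>2"
        using z y by simp
    qed
    show ?thesis using has_gradI[OF *] pd_eqI[OF *] by blast
  qed
  have z: "pds l q y = 0" if "y \<in> Y" "norm y < r" for l y
    using that
  proof (induction l arbitrary: y)
    case Nil thus ?case using q0 by simp
  next
    case (Cons i l)
    show ?case unfolding pds_Cons using step[OF Cons.IH Cons.prems] by blast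
  qed
  show "smooth (ball 0 r) q" unfolding smooth_def
  proof (intro conjI allI ballI)
    fix l :: "'n list" and x assume x: "x \<in> ball (0::real^'n) r"
    show "has_grad (pds l q) x"
    proof (cases "x \<in> Y")
      case True thus ?thesis using step[OF z, of x l] x by simp
    next
      case False thus ?thesis using smooth_has_grad[OF sq, of x l] x by simp
    qed
  qed simp
  show "\<bar>pds l q x\<bar> \<le> B l * (infdist x Y)\<^sup>2" if "norm x < r" for x l
  proof (cases "x \<in> Y")
    case True thus ?thesis using z[OF True that] by simp
  next
    case False thus ?thesis by (rule dec[OF that])
  qed
qed

text \<open>
  In the Leibniz rule for \<open>b \<cdot> (1 / g)\<close> the derivative of order \<open>k\<close> of \<open>1 / g\<close> costs \<open>\<rho>\<^sup>-\<^sup>(\<^sup>k\<^sup>+\<^sup>m\<^sup>)\<close>. The flat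
  factor pays \<open>\<rho>\<^sup>k\<^sup>+\<^sup>m\<^sup>+\<^sup>2 N\<^sub>k\<^sub>+\<^sub>m\<^sub>+\<^sub>2\<close>; the two extra powers of \<open>\<rho>\<close>, together with \<open>\<rho> \<le> K d\<close>, give the factor
  \<open>d\<^sup>2\<close> that makes the extension by 0 smooth and the bounds small near the origin. The sequence \<open>M\<close> is
  absorbed by \<open>M\<^sub>i N\<^sub>k \<le> K\<^sup>i\<^sup>+\<^sup>1 N\<^sub>i N\<^sub>k \<le> K\<^sup>i\<^sup>+\<^sup>1 N\<^sub>i\<^sub>+\<^sub>k\<close>.
\<close>

lemma flat_division:
  fixes b g :: "real^'n::finite \<Rightarrow> real" and G :: "complex^'n \<Rightarrow> complex"
  assumes \<theta>: "admissible \<theta>" and M: "tame M" "non_quasianalytic M" and tr: "is_theta_transform M \<theta> N"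
    and Y: "closed Y" "0 \<in> Y"
    and g: "dc_germ N g" and G: "holomorphic_extension g G"
    and far: "\<forall>\<^sub>F x in nhds 0. set_dist (complex_vec x) {z. G z = 0} \<ge> ereal (\<theta> (infdist x Y))"
    and b: "r0 > 0" "C > 0" "smooth (ball 0 r0) b"
      "\<And>x l. norm x < r0 \<Longrightarrow> \<bar>pds l b x\<bar> \<le> C ^ (length l + 1) * fact (length l) * M (length l)"
      "\<And>y l. y \<in> Y \<Longrightarrow> norm y < r0 \<Longrightarrow> pds l b y = 0"
  shows "flat_germ N (\<lambda>x. if x \<in> Y then 0 else b x * inverse (g x))"
    and "germ_eq b (\<lambda>x. g x * (if x \<in> Y then 0 else b x * inverse (g x)))"
proof -
  have N: "tame N" using tr by (simp add: is_theta_transform_def)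
  define q where "q x = (if x \<in> Y then 0 else b x * inverse (g x))" for x
  obtain rg where rg: "rg > 0" "smooth (ball 0 rg) g"
    using g unfolding dc_germ_def dc_on_def by blast
  have GA: "G \<in> analytic_germs" and Gg: "\<forall>\<^sub>F x in nhds 0. G (complex_vec x) = complex_of_real (g x)"
    using G by (auto simp: holomorphic_extension_def)
  obtain rG where rG: "rG > 0" "smooth (ball 0 rG) G"
    using analytic_germ_dc_on[OF GA] dc_on_smooth by metis
  obtain r1 where r1: "r1 > 0" "\<And>x. norm x < r1 \<Longrightarrow> G (complex_vec x) = complex_of_real (g x)"
    using Gg unfolding eventually_nhds_metric by auto
  obtain r2 where r2: "r2 > 0" "\<And>x. norm x < r2 \<Longrightarrow> set_dist (complex_vec x) {z. G z = 0} \<ge> ereal (\<theta> (infdist x Y))"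
    using far unfolding eventually_nhds_metric by auto
  define s where "s = min rg (min rG r1)"
  have s: "s > 0" "s \<le> rg" "s \<le> rG" "s \<le> r1" using rg rG r1 by (auto simp: s_def)
  obtain r3 E3 m where r3: "0 < r3" "r3 \<le> s" "1 \<le> E3"
    and rec: "\<And>x \<rho> l. norm x < r3 \<Longrightarrow> 0 < \<rho> \<Longrightarrow> \<rho> \<le> r3 \<Longrightarrow> (\<And>z. G z = 0 \<Longrightarrow> dist (complex_vec x) z \<ge> \<rho>) \<Longrightarrow>
      g x \<noteq> 0 \<and> \<bar>pds l (\<lambda>x. inverse (g x)) x\<bar> \<le> E3 ^ (length l + 1) * fact (length l) / \<rho> ^ (length l + m)"
    using reciprocal_bound[OF smooth_subset[OF rg(2) open_ball subset_ball[OF s(2)]]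
        smooth_subset[OF rG(2) open_ball subset_ball[OF s(3)]] s(1) r1(2)[OF less_le_trans[OF _ s(4)]]] by blast
  obtain \<tau> K where \<tau>: "\<tau> > 0" "K \<ge> 1" "\<And>t. 0 < t \<Longrightarrow> t < \<tau> \<Longrightarrow> 0 < \<theta> t" "\<And>t. 0 < t \<Longrightarrow> t < \<tau> \<Longrightarrow> \<theta> t \<le> K * t"
      "\<And>j. M j \<le> K ^ Suc j * N j"
      "\<And>B. B \<ge> 0 \<Longrightarrow> \<exists>E \<tau>'. E \<ge> 1 \<and> \<tau>' > 0 \<and> (\<forall>t k. 0 < t \<and> t < \<tau>' \<longrightarrow> h_seq M (B * t) \<le> (E * \<theta> t) ^ k * N k)"
    using theta_comparison[OF \<theta> M tr] by blast
  obtain E1 where E1: "E1 \<ge> 1" "\<And>x l. norm x < r0 / 2 \<Longrightarrow> \<bar>pds l b x\<bar> \<le> E1 ^ (length l + 1) * fact (length l) * M (length l) * h_seq M (E1 * infdist x Y)"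
    using flat_decay[OF b(3) M(1) b(2) Y b(4,5)] by blast
  obtain E2 \<tau>' where E2: "E2 \<ge> 1" "\<tau>' > 0" "\<And>t k. 0 < t \<Longrightarrow> t < \<tau>' \<Longrightarrow> h_seq M (E1 * t) \<le> (E2 * \<theta> t) ^ k * N k"
    using \<tau>(6)[of E1] E1(1) by auto
  obtain A where A: "A > 0" "\<And>j k. N (j + k) \<le> A ^ (j + k) * N j * N k" using N unfolding tame_def by blast
  define E where "E = max (max (max K A) (max E1 E2)) E3"
  have E: "1 \<le> E" "K \<le> E" "A \<le> E" "E1 \<le> E" "E2 \<le> E" "E3 \<le> E" using r3(3) by (auto simp: E_def)
  define r where "r = Min {r0 / 2, r2, r3, \<tau>, \<tau>', r3 / K}"
  have r: "0 < r" "r \<le> r0 / 2" "r \<le> r2" "r \<le> r3" "r \<le> \<tau>" "r \<le> \<tau>'" "r \<le> r3 / K"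
  proof -
    show "0 < r" using b(1) r2(1) r3(1) \<tau>(1,2) E2(2) by (simp add: r_def)
  qed (unfold r_def, (rule Min_le; simp)+)
  have infd: "infdist x Y \<le> norm x" for x using infdist_le[OF Y(2), of x] by simp
  have Ypos: "infdist x Y > 0" if "x \<notin> Y" for x
    using in_closed_iff_infdist_zero[OF Y(1)] Y(2) that infdist_nonneg[of x Y] by (metis empty_iff order_le_less)
  have th: "0 < \<theta> (infdist x Y)" "\<theta> (infdist x Y) \<le> K * infdist x Y" "\<theta> (infdist x Y) \<le> r3"
    "\<And>z. G z = 0 \<Longrightarrow> dist (complex_vec x) z \<ge> \<theta> (infdist x Y)" if x: "norm x < r" "x \<notin> Y" for x
  proof -
    have d: "0 < infdist x Y" "infdist x Y < r" using Ypos[OF x(2)] infd[of x] x by auto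
    show "0 < \<theta> (infdist x Y)" using d r by (intro \<tau>) auto
    show 2: "\<theta> (infdist x Y) \<le> K * infdist x Y" using d r by (intro \<tau>) auto
    have "K * infdist x Y \<le> K * (r3 / K)" using d r \<tau>(2) by (intro mult_left_mono) auto
    thus "\<theta> (infdist x Y) \<le> r3" using 2 \<tau>(2) by simp
    show "dist (complex_vec x) z \<ge> \<theta> (infdist x Y)" if "G z = 0" for z
      using set_dist_ge[OF r2(2)[of x]] that x r by simp
  qed
  have gn: "g x \<noteq> 0" if "norm x < r" "x \<notin> Y" for x
    using rec[of x "\<theta> (infdist x Y)" "[]"] th[OF that] that r by auto
  define U where "U = ball 0 r - Y"
  have U: "open U" "U \<subseteq> ball 0 r0" "U \<subseteq> ball 0 rg"
    using Y(1) r b(1) r3(2) s by (auto simp: U_def)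
  have sb: "smooth U b" by (rule smooth_subset[OF b(3) U(1,2)])
  have sg: "smooth U (\<lambda>x. inverse (g x))"
    by (rule smooth_inverse[OF smooth_subset[OF rg(2) U(1,3)]]) (use gn in \<open>auto simp: U_def\<close>)
  have qU: "q x = b x * inverse (g x)" if "x \<in> U" for x using that by (simp add: U_def q_def)
  have sq: "smooth U q"
    using smooth_cong[of U q "\<lambda>x. b x * inverse (g x)", OF qU] smooth_mult[OF sb sg] by blast
  \<comment> \<open>the exponents come from collecting the powers of \<open>E\<close> in the estimate of \<open>dec\<close> below\<close>
  define H where "H = E ^ (2 * m + 10) * N (m + 2)"
  define F where "F = 2 * E ^ 5"
  have H: "H \<ge> 1" unfolding H_def using E(1) tame_ge_1[OF N, of "m + 2"] mult_mono[of 1 "E ^ (2 * m + 10)" 1 "N (m + 2)"] by simp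
  have "1 \<le> E ^ 5" by (rule one_le_power[OF E(1)])
  hence F: "F \<ge> 1" unfolding F_def by linarith
  have dec: "\<bar>pds l q x\<bar> \<le> (H * F ^ length l * fact (length l) * N (length l)) * (infdist x Y)\<^sup>2" if x: "norm x < r" "x \<notin> Y" for x l
  proof -
    define j where "j = length l"
    define d where "d = infdist x Y"
    define \<rho> where "\<rho> = \<theta> d"
    have d: "0 < d" "d < r" using Ypos[OF x(2)] infd[of x] x by (auto simp: d_def)
    have \<rho>: "0 < \<rho>" "\<rho> \<le> K * d" using th[OF x] by (auto simp: \<rho>_def d_def)
    have xU: "x \<in> U" using x by (simp add: U_def)
    have hM: "h_seq M (E1 * d) \<le> (E2 * \<rho>) ^ k * N k" for k using E2(3)[of d k] d r by (simp add: \<rho>_def)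
    have "pds l q x = pds l (\<lambda>x. b x * inverse (g x)) x" by (rule pds_cong[OF U(1) qU xU])
    also have "norm \<dots> \<le> (\<Sum>i\<le>j. real (j choose i) * (E1 ^ (i + 1) * fact i * M i * h_seq M (E1 * d)) * (E3 ^ (j - i + 1) * fact (j - i) / \<rho> ^ (j - i + m)))"
      unfolding j_def
    proof (rule leibniz_bound[OF sb sg xU])
      show "norm (pds l' b x) \<le> E1 ^ (length l' + 1) * fact (length l') * M (length l') * h_seq M (E1 * d)" for l'
        using E1(2)[of x l'] x r by (simp add: d_def)
      show "norm (pds l' (\<lambda>x. inverse (g x)) x) \<le> E3 ^ (length l' + 1) * fact (length l') / \<rho> ^ (length l' + m)" for l'
        using rec[of x \<rho> l'] th[OF x] x r by (simp add: \<rho>_def d_def)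
    qed
    also have "\<dots> \<le> (\<Sum>i\<le>j. fact j * (H * (E ^ 5) ^ j * N j * d\<^sup>2))"
    proof (rule sum_mono)
      fix i assume "i \<in> {..j}"
      hence i: "i \<le> j" by simp
      define k where "k = j - i"
      have j: "j = i + k" using i by (simp add: k_def)
      have pos: "0 < M i" "0 < N i" "0 < N k" "0 < N j" "0 < N (m + 2)" using tame_pos[OF M(1)] tame_pos[OF N] by auto
      have "real (j choose i) * (E1 ^ (i + 1) * fact i * M i * h_seq M (E1 * d)) * (E3 ^ (k + 1) * fact k / \<rho> ^ (k + m)) =
        (real (j choose i) * fact i * fact k) * (E1 ^ (i + 1) * M i * E3 ^ (k + 1) * (h_seq M (E1 * d) / \<rho> ^ (k + m)))"
        by simp
      also have "real (j choose i) * fact i * fact k = fact j" using binomial_fact[OF i, where 'a=real] by (simp add: k_def)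
      also have "h_seq M (E1 * d) / \<rho> ^ (k + m) \<le> E2 ^ (k + m + 2) * N (k + (m + 2)) * \<rho>\<^sup>2"
      proof -
        have "h_seq M (E1 * d) \<le> (E2 * \<rho>) ^ (k + m + 2) * N (k + m + 2)" by (rule hM)
        also have "\<dots> = (E2 ^ (k + m + 2) * N (k + (m + 2)) * \<rho>\<^sup>2) * \<rho> ^ (k + m)"
          by (simp add: power_mult_distrib power_add power2_eq_square add_ac mult_ac)
        finally show ?thesis using \<rho> by (simp add: pos_divide_le_eq)
      qed
      also have "E2 ^ (k + m + 2) * N (k + (m + 2)) * \<rho>\<^sup>2 \<le> E ^ (k + m + 2) * (E ^ (k + (m + 2)) * N k * N (m + 2)) * (E\<^sup>2 * d\<^sup>2)"
      proof (intro mult_mono)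
        show "E2 ^ (k + m + 2) \<le> E ^ (k + m + 2)" using E E2 by (intro power_mono) auto
        have "A ^ (k + (m + 2)) * (N k * N (m + 2)) \<le> E ^ (k + (m + 2)) * (N k * N (m + 2))"
          using E A pos by (intro mult_right_mono power_mono) auto
        thus "N (k + (m + 2)) \<le> E ^ (k + (m + 2)) * N k * N (m + 2)" using A(2)[of k "m + 2"] by (simp add: mult_ac)
        have "\<rho>\<^sup>2 \<le> (K * d)\<^sup>2" using \<rho> by (intro power_mono) auto
        also have "\<dots> \<le> (E * d)\<^sup>2" using E \<tau>(2) d by (intro power_mono mult_right_mono) auto
        finally show "\<rho>\<^sup>2 \<le> E\<^sup>2 * d\<^sup>2" by (simp add: power_mult_distrib)
      qed (use E E2 pos tame_pos[OF N, of "k + (m + 2)"] in \<open>auto intro!: mult_nonneg_nonneg\<close>)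
      also have "fact j * (E1 ^ (i + 1) * M i * E3 ^ (k + 1) * (E ^ (k + m + 2) * (E ^ (k + (m + 2)) * N k * N (m + 2)) * (E\<^sup>2 * d\<^sup>2)))
        \<le> fact j * (E ^ (i + 1) * (E ^ Suc i * N i) * E ^ (k + 1) * (E ^ (k + m + 2) * (E ^ (k + (m + 2)) * N k * N (m + 2)) * (E\<^sup>2 * d\<^sup>2)))"
      proof (intro mult_left_mono mult_right_mono mult_mono)
        show "E1 ^ (i + 1) \<le> E ^ (i + 1)" using E E1 by (intro power_mono) auto
        show "E3 ^ (k + 1) \<le> E ^ (k + 1)" using E r3 by (intro power_mono) auto
        have "K ^ Suc i * N i \<le> E ^ Suc i * N i" using E \<tau>(2) pos by (intro mult_right_mono power_mono) auto
        thus "M i \<le> E ^ Suc i * N i" using \<tau>(5)[of i] by simp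
      qed (use E E1 r3 pos d in \<open>auto intro!: mult_nonneg_nonneg\<close>)
      also have "\<dots> = fact j * (E ^ (2 * m + 9) * E ^ (2 * i + 3 * k) * N (m + 2) * (N i * N k) * d\<^sup>2)"
      proof -
        have "E ^ (2 * m + 9) * E ^ (2 * i + 3 * k) = E ^ (i + 1) * E ^ Suc i * E ^ (k + 1) * E ^ (k + m + 2) * E ^ (k + (m + 2)) * E\<^sup>2"
          unfolding power_add[symmetric] by (rule arg_cong[of _ _ "power E"]) simp
        thus ?thesis by (simp add: mult_ac)
      qed
      also have "\<dots> \<le> fact j * (E ^ (2 * m + 10) * (E ^ 5) ^ j * N (m + 2) * N j * d\<^sup>2)"
      proof (intro mult_left_mono mult_right_mono mult_mono)
        show "E ^ (2 * m + 9) \<le> E ^ (2 * m + 10)" using E by (intro power_increasing) auto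
        show "E ^ (2 * i + 3 * k) \<le> (E ^ 5) ^ j" unfolding power_mult[symmetric] j using E by (intro power_increasing) auto
        show "N i * N k \<le> N j" unfolding j by (rule tame_mult_le[OF N])
      qed (use E pos d in \<open>auto intro!: mult_nonneg_nonneg\<close>)
      finally show "real (j choose i) * (E1 ^ (i + 1) * fact i * M i * h_seq M (E1 * d)) * (E3 ^ (j - i + 1) * fact (j - i) / \<rho> ^ (j - i + m)) \<le> fact j * (H * (E ^ 5) ^ j * N j * d\<^sup>2)"
        using E1 r3 pos by (simp add: H_def k_def mult_ac)
    qed
    also have "\<dots> = (real j + 1) * (fact j * (H * (E ^ 5) ^ j * N j * d\<^sup>2))" by simp
    also have "\<dots> \<le> 2 ^ j * (fact j * (H * (E ^ 5) ^ j * N j * d\<^sup>2))"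
    proof (intro mult_right_mono)
      show "real j + 1 \<le> 2 ^ j" by (induction j) (auto intro: order_trans)
    qed (use E H tame_pos[OF N, of j] d in \<open>auto intro!: mult_nonneg_nonneg\<close>)
    also have "\<dots> = (H * F ^ j * fact j * N j) * d\<^sup>2" by (simp add: F_def power_mult_distrib mult_ac)
    finally show ?thesis by (simp add: j_def d_def)
  qed
  have q0: "q x = 0" if "x \<in> Y" for x using that by (simp add: q_def)
  note ext = smooth_flat_extension[OF Y q0 sq[unfolded U_def] dec]
  show "flat_germ N (\<lambda>x. if x \<in> Y then 0 else b x * inverse (g x))"
    unfolding q_def[symmetric] flat_germ_def
  proof (rule exI[of _ "8 * F"], intro conjI allI impI)
    show "0 \<le> 8 * F" using F by simp
    fix \<epsilon> :: real assume \<epsilon>: "\<epsilon> > 0"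
    define r' where "r' = min r (min 1 (\<epsilon> / H))"
    have r': "r' > 0" "r' \<le> r" "r' \<le> 1" "r' \<le> \<epsilon> / H" using r \<epsilon> H by (auto simp: r'_def)
    have "\<bar>pds l q x\<bar> \<le> \<epsilon> * (8 * F) ^ length l * wt (length l) * N (length l)" if x: "norm x < r'" for x l
    proof -
      define j where "j = length l"
      have "\<bar>pds l q x\<bar> \<le> (H * F ^ j * fact j * N j) * (infdist x Y)\<^sup>2" unfolding j_def by (rule ext(2)) (use x r' in auto)
      also have "\<dots> \<le> (H * F ^ j * fact j * N j) * (\<epsilon> / H)"
      proof (rule mult_left_mono)
        have "(infdist x Y)\<^sup>2 \<le> (infdist x Y) * 1" unfolding power2_eq_square
          using infd[of x] x r' infdist_nonneg[of x Y] by (intro mult_left_mono) auto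
        thus "(infdist x Y)\<^sup>2 \<le> \<epsilon> / H" using infd[of x] x r' by simp
      qed (use H F tame_pos[OF N, of j] in \<open>auto intro!: mult_nonneg_nonneg\<close>)
      also have "\<dots> = \<epsilon> * F ^ j * fact j * N j" using H by simp
      also have "\<dots> \<le> \<epsilon> * F ^ j * (8 ^ j * wt j) * N j"
        using \<epsilon> F tame_pos[OF N, of j] by (intro mult_right_mono mult_left_mono fact_le_wt) auto
      finally show ?thesis by (simp add: j_def power_mult_distrib mult_ac)
    qed
    moreover have "smooth (ball 0 r') q" by (rule smooth_subset[OF ext(1)]) (use r' in auto)
    ultimately show "\<exists>r>0. dc_on (ball 0 r) N \<epsilon> (8 * F) q" using r' unfolding dc_on_def by (intro exI[of _ r']) auto
  qed
  show "germ_eq b (\<lambda>x. g x * (if x \<in> Y then 0 else b x * inverse (g x)))"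
    unfolding q_def[symmetric]
  proof (rule germ_eqI_radius[OF r(1)])
    fix x :: "real^'n" assume x: "norm x < r"
    show "b x = g x * q x"
    proof (cases "x \<in> Y")
      case True thus ?thesis using b(5)[OF True, of "[]"] x r b(1) by (simp add: q_def)
    next
      case False thus ?thesis using gn[OF x] by (simp add: q_def)
    qed
  qed
qed

section \<open>Ideals and the Fitting ideal\<close>

lemma analytic_germs_const: "(\<lambda>x. c) \<in> (analytic_germs :: (real^'n::finite \<Rightarrow> real) set)"
proof -
  have "((\<lambda>J. (if J = (\<lambda>_. 0) then c else 0) * (\<Prod>i\<in>UNIV. (x $ i) ^ J i)) has_sum c) UNIV" for x :: "real^'n"
    by (rule has_sum_finite_neutralI[of "{\<lambda>_. 0}"]) auto
  thus ?thesis unfolding analytic_germs_def by (auto intro!: exI[of _ "\<lambda>J. if J = (\<lambda>_. 0) then c else 0"])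
qed

text \<open>
  The generators form a set, so components of \<open>\<psi>\<close> that coincide are listed once; an index is chosen
  for each generator and the other coefficients are set to 0.
\<close>

lemma component_ideal_coefficients:
  fixes \<psi> :: "real^'n::finite \<Rightarrow> real^'p::finite"
  assumes "v \<in> component_ideal \<psi>"
  shows "\<exists>\<alpha>. (\<forall>i. \<alpha> i \<in> analytic_germs) \<and> germ_eq v (\<lambda>x. \<Sum>i\<in>UNIV. \<alpha> i x * \<psi> x $ i)"
proof -
  from assms obtain T a where T: "finite T" "T \<subseteq> range (\<lambda>j x. \<psi> x $ j)" "\<forall>s\<in>T. a s \<in> analytic_germs"
    "germ_eq v (\<lambda>x. \<Sum>s\<in>T. a s x *\<^sub>R s x)"
    unfolding component_ideal_def generated_def by blast
  have "\<forall>s\<in>T. \<exists>j. s = (\<lambda>x. \<psi> x $ j)" using T(2) by blast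
  then obtain \<iota> where \<iota>: "\<And>s. s \<in> T \<Longrightarrow> s = (\<lambda>x. \<psi> x $ \<iota> s)" by metis
  have inj: "inj_on \<iota> T"
  proof (rule inj_onI)
    fix s s' assume s: "s \<in> T" "s' \<in> T" and eq: "\<iota> s = \<iota> s'"
    have "s = (\<lambda>x. \<psi> x $ \<iota> s)" by (rule \<iota>[OF s(1)])
    also have "\<dots> = (\<lambda>x. \<psi> x $ \<iota> s')" by (simp only: eq)
    also have "\<dots> = s'" by (rule \<iota>[OF s(2), symmetric])
    finally show "s = s'" .
  qed
  define \<alpha> where "\<alpha> i = (if i \<in> \<iota> ` T then a (\<lambda>x. \<psi> x $ i) else (\<lambda>x. 0))" for i
  have "\<alpha> i \<in> analytic_germs" for i
  proof (cases "i \<in> \<iota> ` T")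
    case True
    then obtain s where s: "s \<in> T" "i = \<iota> s" by blast
    have "\<alpha> i = a s" using True \<iota>[OF s(1)] by (simp add: \<alpha>_def s(2)[symmetric])
    thus ?thesis using T(3) s(1) by simp
  qed (simp add: \<alpha>_def analytic_germs_const)
  moreover have "(\<Sum>s\<in>T. a s x *\<^sub>R s x) = (\<Sum>i\<in>UNIV. \<alpha> i x * \<psi> x $ i)" for x
  proof -
    have "(\<Sum>i\<in>UNIV. \<alpha> i x * \<psi> x $ i) = (\<Sum>i\<in>\<iota> ` T. \<alpha> i x * \<psi> x $ i)"
      by (rule sum.mono_neutral_right) (auto simp: \<alpha>_def)
    also have "\<dots> = (\<Sum>s\<in>T. \<alpha> (\<iota> s) x * \<psi> x $ \<iota> s)" by (simp add: sum.reindex[OF inj])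
    also have "\<dots> = (\<Sum>s\<in>T. a s x *\<^sub>R s x)"
    proof (rule sum.cong[OF refl])
      fix s assume s: "s \<in> T"
      have "\<alpha> (\<iota> s) = a s" using s \<iota>[OF s] by (simp add: \<alpha>_def)
      moreover have "\<psi> x $ \<iota> s = s x" using \<iota>[OF s] by metis
      ultimately show "\<alpha> (\<iota> s) x * \<psi> x $ \<iota> s = a s x *\<^sub>R s x" by simp
    qed
    finally show ?thesis by simp
  qed
  ultimately show ?thesis using T(4) by auto
qed

text \<open>
  Cramer's rule for the transposed system, with the inserted row expanded linearly. On the right the
  vector \<open>\<psi>\<close> occurs only through its products with the columns of \<open>A\<close>, which for the columns of the
  Fitting matrix are first order derivatives of \<open>f\<close> or 0.
\<close>

lemma cramer_row_expansion:
  fixes A :: "real^'p::finite^'p" and \<psi> :: "real^'p"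
  shows "\<psi> $ k * det A = (\<Sum>l\<in>UNIV. (\<Sum>i\<in>UNIV. \<psi> $ i * A $ i $ l) * det (\<chi> i. if i = k then axis l 1 else A $ i))"
proof -
  define \<sigma> where "\<sigma> l = (\<Sum>i\<in>UNIV. \<psi> $ i * A $ i $ l)" for l
  have row: "(\<Sum>i\<in>UNIV. \<psi> $ i *s row i A) = (\<Sum>l\<in>UNIV. \<sigma> l *s axis l 1)"
    by (simp add: vec_eq_iff \<sigma>_def row_def axis_def if_distrib sum.delta cong: if_cong)
  have "\<psi> $ k * det A = det (\<chi> i. if i = k then (\<Sum>i\<in>UNIV. \<psi> $ i *s row i A) else row i A)"
    by (rule cramer_lemma_transpose[symmetric])
  also have "\<dots> = det (\<chi> i. if i = k then (\<Sum>l\<in>UNIV. \<sigma> l *s axis l 1) else row i A)" by (simp only: row)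
  also have "\<dots> = (\<Sum>l\<in>UNIV. det (\<chi> i. if i = k then \<sigma> l *s axis l 1 else row i A))"
    by (rule det_linear_row_sum[of UNIV k "\<lambda>i l. \<sigma> l *s axis l 1" "\<lambda>i. row i A"]) simp
  also have "\<dots> = (\<Sum>l\<in>UNIV. \<sigma> l * det (\<chi> i. if i = k then axis l 1 else row i A))"
    by (rule sum.cong[OF refl]) (rule det_row_mul[of k _ "\<lambda>i. axis _ 1" "\<lambda>i. row i A"])
  finally have *: "\<psi> $ k * det A = (\<Sum>l\<in>UNIV. \<sigma> l * det (\<chi> i. if i = k then axis l 1 else row i A))" .
  have "row i A = A $ i" for i by (simp add: row_def vec_eq_iff)
  thus ?thesis using * by (simp only: \<sigma>_def)
qed

text \<open>
  In the expansion of \<open>\<psi>\<^sub>k\<close> times a minor, a column \<open>h j\<close> contributes \<open>\<partial>\<^sub>j f\<close> and a column from the kernel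
  contributes 0.
\<close>

lemma fitting_multiplier:
  fixes \<psi> :: "real^'n::finite \<Rightarrow> real^'p::finite" and f :: "real^'n \<Rightarrow> real"
  assumes K: "is_fitting_ideal \<psi> (grad f) K" and g: "g \<in> K" and N: "tame N"
  shows "dc_germ N g \<and> (\<exists>C. (\<forall>k j. dc_germ N (C k j)) \<and>
    (\<forall>\<^sub>F x in nhds 0. \<forall>k. g x * \<psi> x $ k = (\<Sum>j\<in>UNIV. C k j x * pd j f x)))"
proof -
  obtain h r kk where h: "\<And>j. h j \<in> analytic_map_germs" "\<And>j. germ_eq (sigma_map \<psi> (h j)) (\<lambda>x. grad f x $ j)"
    and kk: "\<And>i. i < r \<Longrightarrow> kk i \<in> analytic_map_germs" "generated (kk ` {..<r}) = sigma_kernel \<psi>"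
    and KK: "K = generated (maximal_minors h r kk)"
    using K unfolding is_fitting_ideal_def by blast
  have hS: "\<forall>\<^sub>F x in nhds 0. sigma_map \<psi> (h j) x = pd j f x" for j
    using h(2)[of j] by (simp add: germ_eq_def grad_def partial_eq_pd)
  have kS: "\<forall>\<^sub>F x in nhds 0. sigma_map \<psi> (kk i) x = 0" if "i < r" for i
  proof -
    have "kk i \<in> generated (kk ` {..<r})"
      unfolding generated_def germ_eq_def using that analytic_germs_const[of 1]
      by (intro CollectI exI[of _ "{kk i}"] exI[of _ "\<lambda>_ _. 1"]) auto
    thus ?thesis using kk(2) by (auto simp: sigma_kernel_def germ_eq_def)
  qed
  have minor: "dc_germ N s \<and> (\<exists>C. (\<forall>k j. dc_germ N (C k j)) \<and>
      (\<forall>\<^sub>F x in nhds 0. \<forall>k. s x * \<psi> x $ k = (\<Sum>j\<in>UNIV. C k j x * pd j f x)))"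
    if s: "s \<in> maximal_minors h r kk" for s
  proof -
    obtain c :: "'p \<Rightarrow> 'n + nat" where c: "range c \<subseteq> UNIV <+> {..<r}" "s = (\<lambda>x. det (\<chi> i l. case_sum h kk (c l) x $ i))"
      using s unfolding maximal_minors_def by blast
    define col where "col l = case_sum h kk (c l)" for l
    define A where "A x = (\<chi> i l. col l x $ i)" for x
    have sA: "s x = det (A x)" for x by (simp add: c(2) A_def col_def)
    have col: "dc_germ N (\<lambda>x. col l x $ i)" for l i
    proof -
      have "col l \<in> analytic_map_germs"
      proof (cases "c l")
        case (Inl j) thus ?thesis using h(1) by (simp add: col_def)
      next
        case (Inr i)
        hence "i < r" using range_subsetD[OF c(1), of l] by (auto simp: Plus_def)
        thus ?thesis using kk(1) Inr by (simp add: col_def)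
      qed
      thus ?thesis using N by (intro analytic_germ_dc_germ) (auto simp: analytic_map_germs_def)
    qed
    define S where "S l x = (\<Sum>i\<in>UNIV. \<psi> x $ i * A x $ i $ l)" for l x
    define \<delta> where "\<delta> l j = (if c l = Inl j then 1 else 0 :: real)" for l j
    have S: "\<forall>\<^sub>F x in nhds 0. S l x = (\<Sum>j\<in>UNIV. \<delta> l j * pd j f x)" for l
    proof -
      have Seq: "S l x = sigma_map \<psi> (col l) x" for x by (simp add: S_def sigma_map_def A_def mult.commute)
      show ?thesis
      proof (cases "c l")
        case (Inl j)
        have "(\<Sum>j'\<in>UNIV. \<delta> l j' * pd j' f x) = pd j f x" for x
          by (simp add: \<delta>_def Inl if_distrib if_distribR sum.delta cong: if_cong)
        thus ?thesis using hS[of j] by (simp add: Seq col_def Inl)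
      next
        case (Inr i)
        hence "i < r" using range_subsetD[OF c(1), of l] by (auto simp: Plus_def)
        thus ?thesis using kS[of i] by (simp add: Seq col_def Inr \<delta>_def)
      qed
    qed
    define E where "E k l x = det (\<chi> i. if i = k then axis l 1 else A x $ i)" for k l x
    have E: "dc_germ N (E k l)" for k l
      unfolding E_def
    proof (rule dc_germ_det[OF N])
      fix i j
      show "dc_germ N (\<lambda>x. (\<chi> i. if i = k then axis l 1 else A x $ i) $ i $ j)"
        using col by (cases "i = k") (simp_all add: A_def dc_germ_const N)
    qed
    define C where "C k j x = (\<Sum>l\<in>UNIV. \<delta> l j * E k l x)" for k j x
    have "dc_germ N (C k j)" for k j
      unfolding C_def by (rule dc_germ_sum[OF N]) (rule dc_germ_mult[OF N dc_germ_const[OF N] E])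
    moreover have "dc_germ N s" unfolding sA[abs_def] by (rule dc_germ_det[OF N]) (simp add: A_def col)
    moreover have "\<forall>\<^sub>F x in nhds 0. \<forall>k. s x * \<psi> x $ k = (\<Sum>j\<in>UNIV. C k j x * pd j f x)"
    proof -
      have "\<forall>\<^sub>F x in nhds 0. \<forall>l. S l x = (\<Sum>j\<in>UNIV. \<delta> l j * pd j f x)" by (rule eventually_all_finite[OF S])
      thus ?thesis
      proof eventually_elim
        case (elim x)
        show ?case
        proof
          fix k
          have "s x * \<psi> x $ k = (\<Sum>l\<in>UNIV. S l x * E k l x)"
            using cramer_row_expansion[of "\<psi> x" k "A x"] by (simp add: sA S_def E_def mult.commute)
          also have "\<dots> = (\<Sum>l\<in>UNIV. \<Sum>j\<in>UNIV. \<delta> l j * pd j f x * E k l x)"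
            using elim by (simp add: sum_distrib_right)
          also have "\<dots> = (\<Sum>j\<in>UNIV. C k j x * pd j f x)"
            by (subst sum.swap) (simp add: C_def sum_distrib_left sum_distrib_right mult_ac)
          finally show "s x * \<psi> x $ k = (\<Sum>j\<in>UNIV. C k j x * pd j f x)" .
        qed
      qed
    qed
    ultimately show ?thesis by blast
  qed
  obtain T a where T: "finite T" "T \<subseteq> maximal_minors h r kk" "\<And>s. s \<in> T \<Longrightarrow> a s \<in> analytic_germs"
    "germ_eq g (\<lambda>x. \<Sum>s\<in>T. a s x *\<^sub>R s x)"
    using g unfolding KK generated_def by blast
  have "\<forall>s\<in>T. \<exists>C. (\<forall>k j. dc_germ N (C k j)) \<and> (\<forall>\<^sub>F x in nhds 0. \<forall>k. s x * \<psi> x $ k = (\<Sum>j\<in>UNIV. C k j x * pd j f x))"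
    using minor T(2) by blast
  from bchoice[OF this] obtain C where CC: "\<forall>s\<in>T. (\<forall>k j. dc_germ N (C s k j)) \<and>
    (\<forall>\<^sub>F x in nhds 0. \<forall>k. s x * \<psi> x $ k = (\<Sum>j\<in>UNIV. C s k j x * pd j f x))" ..
  have C: "dc_germ N (C s k j)" "\<forall>\<^sub>F x in nhds 0. \<forall>k. s x * \<psi> x $ k = (\<Sum>j\<in>UNIV. C s k j x * pd j f x)"
    if "s \<in> T" for s k j
    using CC that by (simp_all only:)
  have aN: "dc_germ N (a s)" "dc_germ N s" if "s \<in> T" for s
    using that T minor by (auto intro: analytic_germ_dc_germ N)
  have gN: "dc_germ N (\<lambda>x. \<Sum>s\<in>T. a s x *\<^sub>R s x)"
    unfolding real_scaleR_def by (rule dc_germ_sum[OF N]) (rule dc_germ_mult[OF N aN])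
  have g1: "dc_germ N g"
    by (rule dc_germ_cong[OF _ gN N]) (use T(4) in \<open>simp add: germ_eq_def eq_commute\<close>)
  have "\<forall>\<^sub>F x in nhds 0. \<forall>s\<in>T. \<forall>k. s x * \<psi> x $ k = (\<Sum>j\<in>UNIV. C s k j x * pd j f x)"
    using C(2) by (intro eventually_ball_finite T) auto
  hence "\<forall>\<^sub>F x in nhds 0. \<forall>k. g x * \<psi> x $ k = (\<Sum>j\<in>UNIV. (\<Sum>s\<in>T. a s x * C s k j x) * pd j f x)"
    using T(4)[unfolded germ_eq_def]
  proof eventually_elim
    case (elim x)
    show ?case
    proof
      fix k
      have "g x * \<psi> x $ k = (\<Sum>s\<in>T. a s x * (s x * \<psi> x $ k))"
        unfolding elim(2) sum_distrib_right by (simp add: mult_ac)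
      also have "\<dots> = (\<Sum>s\<in>T. a s x * (\<Sum>j\<in>UNIV. C s k j x * pd j f x))"
        using elim(1) by (intro sum.cong) auto
      also have "\<dots> = (\<Sum>j\<in>UNIV. (\<Sum>s\<in>T. a s x * C s k j x) * pd j f x)"
        unfolding sum_distrib_left by (subst sum.swap) (simp add: sum_distrib_left sum_distrib_right mult_ac)
      finally show "g x * \<psi> x $ k = (\<Sum>j\<in>UNIV. (\<Sum>s\<in>T. a s x * C s k j x) * pd j f x)" .
    qed
  qed
  moreover have "dc_germ N (\<lambda>x. \<Sum>s\<in>T. a s x * C s k j x)" for k j
    by (rule dc_germ_sum[OF N]) (rule dc_germ_mult[OF N aN(1) C(1)])
  ultimately show ?thesis using g1 by (intro conjI exI[of _ "\<lambda>k j x. \<Sum>s\<in>T. a s x * C s k j x"]) auto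
qed

section \<open>The Neumann series\<close>

primrec neumann :: "real \<Rightarrow> ('p::finite \<Rightarrow> real) \<Rightarrow> ('p \<Rightarrow> 'p \<Rightarrow> real) \<Rightarrow> nat \<Rightarrow> 'p \<Rightarrow> real" where
  "neumann t e P 0 = e"
| "neumann t e P (Suc q) = (\<lambda>k'. - t * (\<Sum>k\<in>UNIV. neumann t e P q k * P k k'))"

text \<open>
  Each term of the series cancels \<open>g \<eta>\<^sub>q \<cdot> \<psi>\<close> and leaves \<open>g \<eta>\<^sub>q\<^sub>+\<^sub>1 \<cdot> \<psi>\<close>, where \<open>\<eta>\<^sub>q = e (- t P)\<^sup>q\<close>:
  replace \<open>g \<psi>\<close> by \<open>C \<nabla>f = C \<nabla>(f + t u) - t C \<nabla>u\<close> and \<open>\<nabla>u\<close> by \<open>g W \<psi>\<close>.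
\<close>

lemma neumann_telescope:
  fixes F U :: "'n::finite \<Rightarrow> real" and \<psi> e :: "'p::finite \<Rightarrow> real" and C :: "'p \<Rightarrow> 'n \<Rightarrow> real" and W :: "'n \<Rightarrow> 'p \<Rightarrow> real"
  assumes gF: "\<And>k. g * \<psi> k = (\<Sum>j\<in>UNIV. C k j * F j)" and gU: "\<And>j. U j = g * (\<Sum>k\<in>UNIV. W j k * \<psi> k)"
    and P: "\<And>k k'. P k k' = (\<Sum>j\<in>UNIV. C k j * W j k')"
  shows "(\<Sum>j\<in>UNIV. (\<Sum>q<Q. \<Sum>k\<in>UNIV. neumann t e P q k * C k j) * (F j + t * U j)) =
    g * (\<Sum>k\<in>UNIV. e k * \<psi> k) - g * (\<Sum>k\<in>UNIV. neumann t e P Q k * \<psi> k)"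
proof (induction Q)
  case (Suc Q)
  define \<eta> where "\<eta> = neumann t e P Q"
  have "(\<Sum>j\<in>UNIV. (\<Sum>k\<in>UNIV. \<eta> k * C k j) * F j) = (\<Sum>k\<in>UNIV. \<eta> k * (\<Sum>j\<in>UNIV. C k j * F j))"
    unfolding sum_distrib_left sum_distrib_right by (subst sum.swap) (simp add: mult_ac)
  also have "\<dots> = g * (\<Sum>k\<in>UNIV. \<eta> k * \<psi> k)" 
    unfolding gF[symmetric] sum_distrib_left by (simp add: mult_ac)
  finally have 1: "(\<Sum>j\<in>UNIV. (\<Sum>k\<in>UNIV. \<eta> k * C k j) * F j) = g * (\<Sum>k\<in>UNIV. \<eta> k * \<psi> k)" .
  have "(\<Sum>j\<in>UNIV. (\<Sum>k\<in>UNIV. \<eta> k * C k j) * (t * U j)) = (\<Sum>j\<in>UNIV. \<Sum>k'\<in>UNIV. \<Sum>k\<in>UNIV. t * g * (\<eta> k * C k j * W j k' * \<psi> k'))"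
    by (simp add: gU sum_distrib_left sum_distrib_right mult_ac)
  also have "\<dots> = (\<Sum>k'\<in>UNIV. \<Sum>j\<in>UNIV. \<Sum>k\<in>UNIV. t * g * (\<eta> k * C k j * W j k' * \<psi> k'))" by (rule sum.swap)
  also have "\<dots> = (\<Sum>k'\<in>UNIV. \<Sum>k\<in>UNIV. \<Sum>j\<in>UNIV. t * g * (\<eta> k * C k j * W j k' * \<psi> k'))"
    by (rule sum.cong[OF refl], rule sum.swap)
  also have "\<dots> = - (g * (\<Sum>k'\<in>UNIV. neumann t e P (Suc Q) k' * \<psi> k'))"
    by (simp add: P \<eta>_def sum_distrib_left sum_distrib_right sum_negf mult_ac)
  finally have 2: "(\<Sum>j\<in>UNIV. (\<Sum>k\<in>UNIV. \<eta> k * C k j) * (t * U j)) = - (g * (\<Sum>k'\<in>UNIV. neumann t e P (Suc Q) k' * \<psi> k'))" .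
  have "(\<Sum>j\<in>UNIV. (\<Sum>q<Suc Q. \<Sum>k\<in>UNIV. neumann t e P q k * C k j) * (F j + t * U j)) =
    (\<Sum>j\<in>UNIV. (\<Sum>q<Q. \<Sum>k\<in>UNIV. neumann t e P q k * C k j) * (F j + t * U j)) +
    ((\<Sum>j\<in>UNIV. (\<Sum>k\<in>UNIV. \<eta> k * C k j) * F j) + (\<Sum>j\<in>UNIV. (\<Sum>k\<in>UNIV. \<eta> k * C k j) * (t * U j)))"
    unfolding sum.distrib[symmetric] by (rule sum.cong[OF refl]) (simp add: \<eta>_def distrib_left distrib_right)
  thus ?case unfolding Suc.IH 1 2 by (simp add: \<eta>_def)
qed simp

text \<open>
  A product costs a factor 8 and the sum has one term for each component, so the condition on \<open>\<delta>\<close> makes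
  every step halve the constant.
\<close>

lemma neumann_dc_on:
  fixes e :: "'p::finite \<Rightarrow> real^'n::finite \<Rightarrow> real" and P :: "'p \<Rightarrow> 'p \<Rightarrow> real^'n \<Rightarrow> real"
  assumes e: "\<And>k. dc_on U N \<epsilon> R (e k)" and P: "\<And>k k'. dc_on U N \<delta> R (P k k')"
    and t: "\<bar>t\<bar> \<le> 1" and \<delta>: "16 * real CARD('p) * \<delta> \<le> 1" "0 \<le> \<delta>" "0 \<le> \<epsilon>" "0 \<le> R" and N: "tame N" and U: "open U"
  shows "dc_on U N (\<epsilon> * (1 / 2) ^ q) R (\<lambda>x. neumann t (\<lambda>k. e k x) (\<lambda>k k'. P k k' x) q k)"
proof (induction q arbitrary: k)
  case 0 show ?case using e by simp
next
  case (Suc q)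
  define D where "D = \<epsilon> * (1 / 2) ^ q"
  have D: "0 \<le> D" using \<delta> by (simp add: D_def)
  define v where "v k x = neumann t (\<lambda>k. e k x) (\<lambda>k k'. P k k' x) q k" for k x
  have v: "dc_on U N D R (v k)" for k unfolding v_def[abs_def] D_def by (rule Suc.IH)
  have S: "dc_on U N (\<Sum>k\<in>(UNIV::'p set). 8 * D * \<delta>) R (\<lambda>x. \<Sum>k'\<in>UNIV. v k' x * P k' k x)"
  proof (rule dc_on_sum[where D="\<lambda>_. 8 * D * \<delta>" and f="\<lambda>k' x. v k' x * P k' k x", OF U \<delta>(4) N])
    show "dc_on U N (8 * D * \<delta>) R (\<lambda>x. v k' x * P k' k x)" for k'
      by (rule dc_on_mult[OF v P N D \<delta>(2) \<delta>(4)])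
  qed
  have "dc_on U N (norm (- t) * (\<Sum>k\<in>(UNIV::'p set). 8 * D * \<delta>)) R (\<lambda>x. - t * (\<Sum>k'\<in>UNIV. v k' x * P k' k x))"
    by (rule dc_on_cmult[OF S])
  moreover have "norm (- t) * (\<Sum>k\<in>(UNIV::'p set). 8 * D * \<delta>) \<le> \<epsilon> * (1 / 2) ^ Suc q"
  proof -
    have "norm (- t) * (\<Sum>k\<in>(UNIV::'p set). 8 * D * \<delta>) \<le> 1 * (\<Sum>k\<in>(UNIV::'p set). 8 * D * \<delta>)"
      using t D \<delta> by (intro mult_right_mono sum_nonneg) auto
    also have "\<dots> = (D / 2) * (16 * real CARD('p) * \<delta>)" by simp
    also have "\<dots> \<le> (D / 2) * 1" using D by (intro mult_left_mono \<delta>) auto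
    finally show ?thesis by (simp add: D_def)
  qed
  moreover have "0 \<le> norm (- t) * (\<Sum>k\<in>(UNIV::'p set). 8 * D * \<delta>)" using D \<delta> by (intro mult_nonneg_nonneg sum_nonneg) auto
  ultimately have "dc_on U N (\<epsilon> * (1 / 2) ^ Suc q) R (\<lambda>x. - t * (\<Sum>k'\<in>UNIV. v k' x * P k' k x))"
    using dc_on_mono_const[of U N "norm (- t) * (\<Sum>k\<in>(UNIV::'p set). 8 * D * \<delta>)" R] N \<delta>(4) by blast
  thus ?case by (simp add: v_def)
qed

lemma geometric_lessThan_le_2: "(\<Sum>q<Q. (1 / 2 :: real) ^ q) \<le> 2"
proof (cases Q)
  case (Suc k) thus ?thesis using geometric_le_2[of k] by (simp add: lessThan_Suc_atMost)
qed simp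

section \<open>The deformation argument\<close>

lemma smooth_locally_bounded:
  fixes h :: "real^'n::finite \<Rightarrow> real"
  assumes "smooth (ball 0 r) h" "s < r"
  shows "\<exists>B. \<forall>x i j. norm x < s \<longrightarrow> \<bar>h x\<bar> \<le> B \<and> \<bar>pd i h x\<bar> \<le> B \<and> \<bar>pd j (pd i h) x\<bar> \<le> B"
proof -
  have "\<exists>b. \<forall>x. norm x \<le> s \<longrightarrow> \<bar>pds l h x\<bar> \<le> b" for l
  proof -
    have "bounded (pds l h ` cball 0 s)"
      by (intro compact_imp_bounded compact_continuous_image compact_cball
          continuous_on_subset[OF smooth_cont[OF smooth_pds[OF assms(1)]]]) (use assms in auto)
    then obtain a where a: "\<forall>y\<in>pds l h ` cball 0 s. norm y \<le> a" unfolding bounded_iff by blast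
    show ?thesis using a by (intro exI[of _ a]) auto
  qed
  then obtain b where b: "\<And>l x. norm x \<le> s \<Longrightarrow> \<bar>pds l h x\<bar> \<le> b l" by metis
  define L where "L = {l :: 'n list. set l \<subseteq> UNIV \<and> length l \<le> 2}"
  have L: "finite L" unfolding L_def by (rule finite_lists_length_le) simp
  have "b l \<le> Max (b ` L)" if "length l \<le> 2" for l
    using L that by (intro Max_ge) (auto simp: L_def)
  hence B: "\<bar>pds l h x\<bar> \<le> Max (b ` L)" if "length l \<le> 2" "norm x \<le> s" for l x
    using b[of x l] that by (meson order_trans)
  show ?thesis
  proof (intro exI[of _ "Max (b ` L)"] allI impI)
    fix x :: "real^'n" and i j assume x: "norm x < s"
    show "\<bar>h x\<bar> \<le> Max (b ` L) \<and> \<bar>pd i h x\<bar> \<le> Max (b ` L) \<and> \<bar>pd j (pd i h) x\<bar> \<le> Max (b ` L)"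
      using B[of "[]" x] B[of "[i]" x] B[of "[j, i]" x] x by (simp add: pds_Cons)
  qed
qed

text \<open>
  The inverse is again bounded by the composition argument, with a growth rate larger than
  that of \<open>\<xi>\<close>; hence the second smallness condition on \<open>D\<close>.
\<close>

lemma near_identity_dc_diffeo:
  fixes \<xi> :: "real^'n::finite \<Rightarrow> real^'n"
  assumes \<xi>: "\<And>i. dc_on (ball 0 r) N D R (\<lambda>x. \<xi> x $ i)" and r: "r > 0" and \<xi>0: "\<xi> 0 = 0" and N: "tame N"
    and nn: "0 \<le> D" "0 \<le> R" and D: "(real CARD('n))\<^sup>2 * D * R * N 1 \<le> 1" "32 * real CARD('n) * N 1 * (R + 1) * D \<le> 1"
  shows "(\<lambda>x. x + \<xi> x) \<in> dc_diffeo_germs N"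
proof -
  have N1: "N 1 \<ge> 1" by (rule tame_ge_1[OF N])
  define c where "c = 16 * real CARD('n) * N 1 * (R + 1)"
  have "0 < 16 * real CARD('n) * N 1 * (R + 1)" using N1 nn by (intro mult_pos_pos) auto
  hence c: "c > 0" by (simp only: c_def)
  define \<mu> where "\<mu> = 1 / c"
  obtain \<eta> where \<eta>: "\<And>i. smooth (ball 0 (r / 4)) (\<lambda>x. \<eta> x $ i)" "\<eta> 0 = 0"
    "\<And>x. norm x < r / 4 \<Longrightarrow> (x + \<eta> x) + \<xi> (x + \<eta> x) = x"
    "\<And>x. norm x < r / 8 \<Longrightarrow> (x + \<xi> x) + \<eta> (x + \<xi> x) = x"
  proof (rule near_identity_inverse[OF \<xi> r \<xi>0 N nn _ D(1)])
    show "0 \<le> 16 * c" using c by simp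
    show "16 \<le> \<mu> * (16 * c)" using c by (simp add: \<mu>_def)
    have "2 * D * c \<le> 1" using D(2) by (simp add: c_def mult_ac)
    thus "2 * D \<le> \<mu>" using c by (simp add: \<mu>_def field_simps)
    have "16 * real CARD('n) * N 1 * R \<le> c" using N1 nn unfolding c_def by (intro mult_left_mono) auto
    thus "16 * real CARD('n) * N 1 * \<mu> * R \<le> 1" using c by (simp add: \<mu>_def field_simps)
  qed blast
  have sm: "(\<lambda>x. (x + h x) $ i) \<in> smooth_germs" if "\<And>i. smooth (ball 0 s) (\<lambda>x. h x $ i)" "s > 0"
    for h :: "real^'n \<Rightarrow> real^'n" and s i
  proof -
    have "smooth (ball 0 s) (\<lambda>x. x $ i + h x $ i)" by (intro smooth_add smooth_coord that) simp
    thus ?thesis unfolding smooth_germs_def smooth_on_eq_smooth using that(2) by (auto intro!: exI[of _ "ball 0 s"])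
  qed
  have 1: "(\<lambda>x. x + \<xi> x) \<in> smooth_map_germs"
    unfolding smooth_map_germs_def using sm[OF dc_on_smooth[OF \<xi>] r] \<xi>0 by simp
  have 2: "(\<lambda>x. x + \<eta> x) \<in> smooth_map_germs"
    unfolding smooth_map_germs_def using sm[OF \<eta>(1)] r \<eta>(2) by simp
  have 3: "germ_eq ((\<lambda>x. x + \<eta> x) \<circ> (\<lambda>x. x + \<xi> x)) id" using r \<eta>(4) by (intro germ_eqI_radius[of "r / 8"]) auto
  have 4: "germ_eq ((\<lambda>x. x + \<xi> x) \<circ> (\<lambda>x. x + \<eta> x)) id" using r \<eta>(3) by (intro germ_eqI_radius[of "r / 4"]) auto
  have "(\<lambda>x. (x + \<xi> x) $ i) \<in> dc_class N" for i
  proof -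
    define R' where "R' = max R (8 / r)"
    have R': "0 \<le> R'" "R \<le> R'" "8 \<le> R' * r" using nn r by (auto simp: R'_def max_def field_simps)
    have "dc_on (ball 0 r) N r R' (\<lambda>x::real^'n. x $ i)"
    proof (rule dc_on_coord[OF open_ball _ R'(3) _ R'(1) N])
      fix x :: "real^'n" assume "x \<in> ball 0 r"
      thus "norm (x $ i) \<le> r" using norm_vec_nth_le[of x i] by simp
    qed (use r in simp)
    moreover have "dc_on (ball 0 r) N D R' (\<lambda>x. \<xi> x $ i)"
      by (rule dc_on_mono_const[OF \<xi> N nn(1) order_refl nn(2) R'(2)])
    ultimately have "dc_on (ball 0 r) N (r + D) R' (\<lambda>x. x $ i + \<xi> x $ i)" by (rule dc_on_add)
    hence *: "dc_on (ball 0 r) N (r + D) R' (\<lambda>x. (x + \<xi> x) $ i)" by simp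
    show ?thesis by (rule dc_classI[OF * r N]) (use r nn R' in auto)
  qed
  with 1 2 3 4 show ?thesis unfolding dc_diffeo_germs_def diffeo_germs_def by blast
qed

text \<open>
  The constants are chosen in this order: the growth rate \<open>\<rho>\<close> common to all data, then the growth rate \<open>R\<close>
  of the flow as a multiple of \<open>\<rho> + 1\<close>, then \<open>D\<close> so small that the fields, the flow and its inverse meet the
  smallness conditions, then \<open>\<epsilon>\<close>, and finally a ball on which the flat germs have bounds with \<open>\<epsilon>\<close>.
\<close>

lemma deformation:
  fixes f u g :: "real^'n::finite \<Rightarrow> real" and \<psi> :: "real^'n \<Rightarrow> real^'p::finite"
    and C :: "'p \<Rightarrow> 'n \<Rightarrow> real^'n \<Rightarrow> real" and W :: "'n \<Rightarrow> 'p \<Rightarrow> real^'n \<Rightarrow> real" and e :: "'p \<Rightarrow> real^'n \<Rightarrow> real"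
  assumes N: "tame N" and f: "r0 > 0" "smooth (ball 0 r0) f" "smooth (ball 0 r0) u"
    and g: "dc_germ N g" and \<psi>: "\<And>k. dc_germ N (\<lambda>x. \<psi> x $ k)" and C: "\<And>k j. dc_germ N (C k j)"
    and W: "\<And>j k. flat_germ N (W j k)" and e: "\<And>k. flat_germ N (e k)"
    and gf: "\<forall>\<^sub>F x in nhds 0. \<forall>k. g x * \<psi> x $ k = (\<Sum>j\<in>UNIV. C k j x * pd j f x)"
    and du: "\<forall>\<^sub>F x in nhds 0. \<forall>j. pd j u x = g x * (\<Sum>k\<in>UNIV. W j k x * \<psi> x $ k)"
    and u: "\<forall>\<^sub>F x in nhds 0. u x = g x * (\<Sum>k\<in>UNIV. e k x * \<psi> x $ k)"
  shows "\<exists>\<Phi>\<in>dc_diffeo_germs N. germ_eq (\<lambda>x. f x + u x) (f \<circ> \<Phi>)"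
proof -
  define P where "P k k' x = (\<Sum>j\<in>UNIV. C k j x * W j k' x)" for k k' x
  have P: "flat_germ N (P k k')" for k k'
    unfolding P_def by (intro flat_germ_sum flat_germ_mult N C W) simp
  define n where "n = real CARD('n)"
  define p where "p = real CARD('p)"
  have n: "n \<ge> 1" and p: "p \<ge> 1" by (simp_all add: n_def p_def Suc_leI)
  have N1: "N 1 \<ge> 1" by (rule tame_ge_1[OF N])
  obtain Rc Dc rc where c: "Rc \<ge> 0" "Dc \<ge> 0" "rc > 0" "\<And>k j. dc_on (ball 0 rc) N Dc Rc (C k j)"
    "\<And>k. dc_on (ball 0 rc) N Dc Rc (\<lambda>x. \<psi> x $ k)" "dc_on (ball 0 rc) N Dc Rc g"
  proof -
    define S where "S = insert g (range (\<lambda>(k, j). C k j) \<union> range (\<lambda>k x. \<psi> x $ k))"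
    have "\<exists>R\<ge>0. \<exists>D\<ge>0. \<exists>r>0. \<forall>h\<in>S. dc_on (ball 0 r) N D R h"
      using g C \<psi> by (intro dc_germ_common[of S N "\<lambda>h. h"] N) (auto simp: S_def)
    then obtain R D r where "R \<ge> 0" "D \<ge> 0" "r > 0" "\<forall>h\<in>S. dc_on (ball 0 r) N D R h" by blast
    thus ?thesis by (intro that[of R D r]) (auto simp: S_def)
  qed
  obtain Rf where Rf: "Rf \<ge> 0" "\<And>\<epsilon>. \<epsilon> > 0 \<Longrightarrow> \<exists>r>0. (\<forall>k. dc_on (ball 0 r) N \<epsilon> Rf (e k)) \<and> (\<forall>k k'. dc_on (ball 0 r) N \<epsilon> Rf (P k k'))"
  proof -
    define S where "S = range e \<union> range (\<lambda>(k, k'). P k k')"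
    have "\<exists>R\<ge>0. \<forall>\<epsilon>>0. \<exists>r>0. \<forall>h\<in>S. dc_on (ball 0 r) N \<epsilon> R h"
      using e P by (intro flat_germ_common[of S N "\<lambda>h. h"] N) (auto simp: S_def)
    then obtain R where R: "R \<ge> 0" "\<And>\<epsilon>. \<epsilon> > 0 \<Longrightarrow> \<exists>r>0. \<forall>h\<in>S. dc_on (ball 0 r) N \<epsilon> R h" by blast
    show ?thesis
    proof (rule that[OF R(1)])
      fix \<epsilon> :: real assume "\<epsilon> > 0"
      then obtain r where "r > 0" "\<forall>h\<in>S. dc_on (ball 0 r) N \<epsilon> R h" using R(2) by blast
      thus "\<exists>r>0. (\<forall>k. dc_on (ball 0 r) N \<epsilon> R (e k)) \<and> (\<forall>k k'. dc_on (ball 0 r) N \<epsilon> R (P k k'))"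
        by (intro exI[of _ r]) (auto simp: S_def)
    qed
  qed
  define \<rho> where "\<rho> = max Rc Rf"
  have \<rho>: "0 \<le> \<rho>" "Rc \<le> \<rho>" "Rf \<le> \<rho>" using c(1) by (auto simp: \<rho>_def)
  \<comment> \<open>\<open>1 / a\<close> serves as \<open>\<mu>\<close> for the flow; the four terms of \<open>A\<close> collect the smallness conditions on \<open>D\<close>\<close>
  define a where "a = 16 * n * N 1 * (\<rho> + 1)"
  have "0 < 16 * n * N 1 * (\<rho> + 1)" using N1 n \<rho> by (intro mult_pos_pos) auto
  hence a: "a > 0" by (simp only: a_def)
  define R where "R = 16 * a"
  have R: "0 \<le> R" using a by (simp add: R_def)
  define A where "A = 2 * a + n\<^sup>2 * \<rho> * N 1 + n\<^sup>2 * R * N 1 + 32 * n * N 1 * (R + 1)"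
  have A_ge: "2 * a \<le> A" "n\<^sup>2 * \<rho> * N 1 \<le> A" "n\<^sup>2 * R * N 1 \<le> A" "32 * n * N 1 * (R + 1) \<le> A"
  proof -
    have "0 \<le> n\<^sup>2 * \<rho> * N 1" "0 \<le> n\<^sup>2 * R * N 1" "0 \<le> 32 * n * N 1 * (R + 1)" using N1 n \<rho> R by simp_all
    thus "2 * a \<le> A" "n\<^sup>2 * \<rho> * N 1 \<le> A" "n\<^sup>2 * R * N 1 \<le> A" "32 * n * N 1 * (R + 1) \<le> A"
      unfolding A_def using a by linarith+
  qed
  have A: "A > 0" using A_ge(1) a by linarith
  define D where "D = 1 / A"
  have D: "D > 0" using A by (simp add: D_def)
  have small: "c * D \<le> 1" if "c \<le> A" for c using that A by (simp add: D_def field_simps)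
  define \<epsilon> where "\<epsilon> = min (D / (16 * p * (Dc + 1))) (1 / (16 * p))"
  have "0 < p * (Dc + 1)" using p c(2) by (intro mult_pos_pos) auto
  hence \<epsilon>: "\<epsilon> > 0" "\<epsilon> \<le> D / (16 * p * (Dc + 1))" "\<epsilon> \<le> 1 / (16 * p)" using D p by (auto simp: \<epsilon>_def mult.assoc)
  have \<epsilon>2: "16 * p * \<epsilon> \<le> 1" using \<epsilon>(3) p by (simp add: field_simps)
  have \<epsilon>3: "16 * p * \<epsilon> * Dc \<le> D"
  proof -
    have "16 * p * \<epsilon> * Dc \<le> 16 * p * \<epsilon> * (Dc + 1)" using p \<epsilon> by (intro mult_left_mono) auto
    also have "\<dots> = \<epsilon> * (16 * p * (Dc + 1))" by simp
    also have "\<dots> \<le> D" using \<epsilon>(2) \<open>0 < p * (Dc + 1)\<close> by (simp add: pos_le_divide_eq mult.assoc)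
    finally show ?thesis .
  qed
  obtain rf where rf: "rf > 0" "\<And>k. dc_on (ball 0 rf) N \<epsilon> Rf (e k)" "\<And>k k'. dc_on (ball 0 rf) N \<epsilon> Rf (P k k')"
    using Rf(2)[OF \<epsilon>(1)] by blast
  obtain r1 where r1: "r1 > 0" "\<And>x. norm x < r1 \<Longrightarrow> (\<forall>k. g x * \<psi> x $ k = (\<Sum>j\<in>UNIV. C k j x * pd j f x)) \<and>
      (\<forall>j. pd j u x = g x * (\<Sum>k\<in>UNIV. W j k x * \<psi> x $ k)) \<and> u x = g x * (\<Sum>k\<in>UNIV. e k x * \<psi> x $ k)"
    using eventually_conj[OF gf eventually_conj[OF du u]] unfolding eventually_nhds_metric by auto
  define r where "r = Min {1, r0 / 2, r1, rc, rf}"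
  have r: "0 < r" "r \<le> 1" "r \<le> r0 / 2" "r \<le> r1" "r \<le> rc" "r \<le> rf"
  proof -
    show "0 < r" using f(1) r1(1) c(3) rf(1) by (simp add: r_def)
  qed (unfold r_def, (rule Min_le; simp)+)
  have rr0: "r < r0" "r \<le> r0" using r f(1) by auto
  obtain B1 where B1: "\<And>x i j. norm x < r \<Longrightarrow> \<bar>pd j (pd i f) x\<bar> \<le> B1"
    using smooth_locally_bounded[OF f(2) rr0(1)] by blast
  obtain B2 where B2: "\<And>x i j. norm x < r \<Longrightarrow> \<bar>pd i u x\<bar> \<le> B2 \<and> \<bar>pd j (pd i u) x\<bar> \<le> B2"
    using smooth_locally_bounded[OF f(3) rr0(1)] by blast
  define B where "B = max B1 B2"
  have Ck: "dc_on (ball 0 r) N Dc \<rho> (C k j)" for k j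
    by (rule dc_on_ball_mono[OF c(4) N r(1) r(5) c(2) order_refl c(1) \<rho>(2)])
  have ek: "dc_on (ball 0 r) N \<epsilon> \<rho> (e k)" for k
    by (rule dc_on_ball_mono[OF rf(2) N r(1) r(6) less_imp_le[OF \<epsilon>(1)] order_refl Rf(1) \<rho>(3)])
  have Pk: "dc_on (ball 0 r) N \<epsilon> \<rho> (P k k')" for k k'
    by (rule dc_on_ball_mono[OF rf(3) N r(1) r(6) less_imp_le[OF \<epsilon>(1)] order_refl Rf(1) \<rho>(3)])
  define \<eta> where "\<eta> t q k x = neumann t (\<lambda>k. e k x) (\<lambda>k k'. P k k' x) q k" for t q k x
  have \<eta>: "dc_on (ball 0 r) N (\<epsilon> * (1 / 2) ^ q) \<rho> (\<eta> t q k)" if "0 \<le> t" "t \<le> 1" for t q k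
    unfolding \<eta>_def
    by (rule neumann_dc_on[OF ek Pk]) (use that \<epsilon>2 \<epsilon>(1) \<rho>(1) N in \<open>auto simp: p_def\<close>)
  define Z where "Z t Q x = (\<chi> j. \<Sum>q<Q. \<Sum>k\<in>UNIV. \<eta> t q k x * C k j x)" for t Q x
  have Zdc: "dc_on (ball 0 r) N D \<rho> (\<lambda>x. Z t Q x $ j)" if t: "0 \<le> t" "t \<le> 1" for t Q j
  proof -
    have T: "dc_on (ball 0 r) N (8 * (\<epsilon> * (1 / 2) ^ q) * Dc) \<rho> (\<lambda>x. \<eta> t q k x * C k j x)" for q k
      by (rule dc_on_mult[OF \<eta>[OF t] Ck N _ c(2) \<rho>(1)]) (use \<epsilon>(1) in simp)
    have "dc_on (ball 0 r) N (\<Sum>q<Q. \<Sum>k\<in>(UNIV::'p set). 8 * (\<epsilon> * (1 / 2) ^ q) * Dc) \<rho> (\<lambda>x. \<Sum>q<Q. \<Sum>k\<in>UNIV. \<eta> t q k x * C k j x)"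
    proof (rule dc_on_sum[where f="\<lambda>q x. \<Sum>k\<in>UNIV. \<eta> t q k x * C k j x" and D="\<lambda>q. \<Sum>k\<in>(UNIV::'p set). 8 * (\<epsilon> * (1 / 2) ^ q) * Dc", OF open_ball \<rho>(1) N])
      show "dc_on (ball 0 r) N (\<Sum>k\<in>(UNIV::'p set). 8 * (\<epsilon> * (1 / 2) ^ q) * Dc) \<rho> (\<lambda>x. \<Sum>k\<in>UNIV. \<eta> t q k x * C k j x)" for q
        by (rule dc_on_sum[where f="\<lambda>k x. \<eta> t q k x * C k j x" and D="\<lambda>k. 8 * (\<epsilon> * (1 / 2) ^ q) * Dc", OF open_ball \<rho>(1) N]) (rule T)
    qed
    moreover have "(\<Sum>q<Q. \<Sum>k\<in>(UNIV::'p set). 8 * (\<epsilon> * (1 / 2) ^ q) * Dc) \<le> D"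
    proof -
      have "(\<Sum>q<Q. \<Sum>k\<in>(UNIV::'p set). 8 * (\<epsilon> * (1 / 2) ^ q) * Dc) = (8 * p * \<epsilon> * Dc) * (\<Sum>q<Q. (1 / 2) ^ q)"
        by (simp add: p_def sum_distrib_left mult_ac)
      also have "\<dots> \<le> (8 * p * \<epsilon> * Dc) * 2"
        using p \<epsilon> c(2) by (intro mult_left_mono geometric_lessThan_le_2) auto
      finally show ?thesis using \<epsilon>3 by simp
    qed
    moreover have "0 \<le> (\<Sum>q<Q. \<Sum>k\<in>(UNIV::'p set). 8 * (\<epsilon> * (1 / 2) ^ q) * Dc)" using \<epsilon>(1) c(2) by (intro sum_nonneg) simp
    ultimately have "dc_on (ball 0 r) N D \<rho> (\<lambda>x. \<Sum>q<Q. \<Sum>k\<in>UNIV. \<eta> t q k x * C k j x)"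
      using dc_on_mono_const[OF _ N _ _ \<rho>(1) order_refl] by blast
    thus ?thesis by (simp add: Z_def)
  qed
  have e0: "e k 0 = 0" for k by (rule flat_germ_zero[OF N e])
  have \<eta>0: "\<eta> t q k 0 = 0" for t q k
  proof -
    have "neumann t (\<lambda>k. e k 0) P' q k = 0" for P' by (induction q arbitrary: k) (simp_all add: e0)
    thus ?thesis by (simp add: \<eta>_def)
  qed
  have res: "\<bar>(\<Sum>i\<in>UNIV. Z t Q x $ i * (pd i f x + t * pd i u x)) - u x\<bar> \<le> (p * Dc * Dc * \<epsilon>) * (1 / 2) ^ Q"
    if t: "0 \<le> t" "t \<le> 1" and x: "norm x < r" for t Q x
  proof -
    have "norm x < r1" using x r by simp
    note id = r1(2)[OF this]
    have "(\<Sum>i\<in>UNIV. Z t Q x $ i * (pd i f x + t * pd i u x)) = g x * (\<Sum>k\<in>UNIV. e k x * \<psi> x $ k) - g x * (\<Sum>k\<in>UNIV. \<eta> t Q k x * \<psi> x $ k)"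
      unfolding Z_def \<eta>_def vec_lambda_beta
      by (rule neumann_telescope[where W="\<lambda>j k. W j k x"]) (use id in \<open>auto simp: P_def\<close>)
    hence "(\<Sum>i\<in>UNIV. Z t Q x $ i * (pd i f x + t * pd i u x)) - u x = - (g x * (\<Sum>k\<in>UNIV. \<eta> t Q k x * \<psi> x $ k))" using id by simp
    hence "\<bar>(\<Sum>i\<in>UNIV. Z t Q x $ i * (pd i f x + t * pd i u x)) - u x\<bar> = \<bar>g x\<bar> * \<bar>\<Sum>k\<in>UNIV. \<eta> t Q k x * \<psi> x $ k\<bar>" by (simp add: abs_mult)
    also have "\<dots> \<le> Dc * (\<Sum>k\<in>(UNIV::'p set). \<epsilon> * (1 / 2) ^ Q * Dc)"
    proof (rule mult_mono)
      have xc: "x \<in> ball 0 rc" "x \<in> ball 0 r" using x r by auto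
      show "\<bar>g x\<bar> \<le> Dc" using dc_on_norm_le[OF c(6) xc(1) N] by simp
      have "norm (\<Sum>k\<in>UNIV. \<eta> t Q k x * \<psi> x $ k) \<le> (\<Sum>k\<in>(UNIV::'p set). \<epsilon> * (1 / 2) ^ Q * Dc)"
      proof (rule sum_norm_le)
        fix k
        have "norm (\<eta> t Q k x) * norm (\<psi> x $ k) \<le> \<epsilon> * (1 / 2) ^ Q * Dc"
          using dc_on_norm_le[OF \<eta>[OF t] xc(2) N] dc_on_norm_le[OF c(5) xc(1) N] \<epsilon>(1) by (intro mult_mono) auto
        thus "norm (\<eta> t Q k x * \<psi> x $ k) \<le> \<epsilon> * (1 / 2) ^ Q * Dc" by (simp only: norm_mult)
      qed
      thus "\<bar>\<Sum>k\<in>UNIV. \<eta> t Q k x * \<psi> x $ k\<bar> \<le> (\<Sum>k\<in>(UNIV::'p set). \<epsilon> * (1 / 2) ^ Q * Dc)" by simp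
    qed (use c(2) in auto)
    also have "\<dots> = (p * Dc * Dc * \<epsilon>) * (1 / 2) ^ Q" by (simp add: p_def mult_ac)
    finally show ?thesis .
  qed
  define \<mu> where "\<mu> = 1 / a"
  obtain \<xi> where \<xi>: "\<And>i. dc_on (ball 0 (r / 8)) N D R (\<lambda>x. \<xi> x $ i)" "\<xi> 0 = 0"
    "\<And>x. norm x < r / 8 \<Longrightarrow> norm (x + \<xi> x) < r \<and> f (x + \<xi> x) = f x + u x"
  proof (rule euler_flow[of r f u B N D \<rho> Z "p * Dc * Dc * \<epsilon>" R \<mu>])
    show "smooth (ball 0 r) f" "smooth (ball 0 r) u"
      using f(2,3) rr0 by (auto intro!: smooth_subset[of "ball 0 r0"])
    show "\<bar>pd j (pd i f) x\<bar> \<le> B" if "norm x < r" for x i j using B1[OF that, of j i] by (simp add: B_def le_max_iff_disj)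
    show "\<bar>pd j (pd i u) x\<bar> \<le> B" if "norm x < r" for x i j using B2[OF that, of i j] by (simp add: B_def le_max_iff_disj)
    show "\<bar>pd i u x\<bar> \<le> B" if "norm x < r" for x i using B2[OF that, of i] by (simp add: B_def le_max_iff_disj)
    show "Z t Q 0 = 0" for t Q by (simp add: Z_def \<eta>0 vec_eq_iff)
    show "(real CARD('n))\<^sup>2 * D * \<rho> * N 1 \<le> 1" using small[OF A_ge(2)] by (simp add: n_def mult_ac)
    show "16 \<le> \<mu> * R" using a by (simp add: \<mu>_def R_def)
    show "2 * D \<le> \<mu>" using small[OF A_ge(1)] a by (simp add: \<mu>_def field_simps)
    have "16 * n * N 1 * \<rho> \<le> a" using N1 n \<rho> unfolding a_def by (intro mult_left_mono) auto
    thus "16 * real CARD('n) * N 1 * \<mu> * \<rho> \<le> 1" using a by (simp add: \<mu>_def n_def field_simps)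
  qed (use r N Zdc res D \<rho> R in auto)
  have "(\<lambda>x. x + \<xi> x) \<in> dc_diffeo_germs N"
  proof (rule near_identity_dc_diffeo[OF \<xi>(1) _ \<xi>(2) N _ R])
    show "(real CARD('n))\<^sup>2 * D * R * N 1 \<le> 1" using small[OF A_ge(3)] by (simp add: n_def mult_ac)
    show "32 * real CARD('n) * N 1 * (R + 1) * D \<le> 1" using small[OF A_ge(4)] by (simp add: n_def)
  qed (use r D in auto)
  moreover have "germ_eq (\<lambda>x. f x + u x) (f \<circ> (\<lambda>x. x + \<xi> x))"
    using \<xi>(3) r(1) by (intro germ_eqI_radius[of "r / 8"]) auto
  ultimately show ?thesis by blast
qed

section \<open>Smooth germs and flat ideals\<close>

lemma smooth_germs_radius:
  assumes "u \<in> smooth_germs" obtains r where "r > 0" "smooth (ball 0 r) u"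
proof -
  from assms obtain U where U: "0 \<in> U" "smooth U u" unfolding smooth_germs_def smooth_on_eq_smooth by blast
  obtain r where "r > 0" "ball 0 r \<subseteq> U" using U(1) smooth_open[OF U(2)] by (auto simp: open_contains_ball)
  thus ?thesis using that smooth_subset[OF U(2) open_ball] by blast
qed

lemma smooth_germsI: "r > 0 \<Longrightarrow> smooth (ball 0 r) u \<Longrightarrow> u \<in> smooth_germs"
  unfolding smooth_germs_def smooth_on_eq_smooth by (auto intro!: exI[of _ "ball 0 r"])

lemma smooth_germs_has_grad:
  assumes "u \<in> smooth_germs" shows "\<forall>\<^sub>F x in nhds 0. has_grad u x"
proof -
  obtain r where r: "r > 0" "smooth (ball 0 r) u" using smooth_germs_radius[OF assms] .
  thus ?thesis unfolding eventually_nhds_metric using smooth_has_grad0[OF r(2)] by (intro exI[of _ r]) auto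
qed

lemma smooth_germs_cong:
  fixes u :: "real^'n::finite \<Rightarrow> real"
  assumes "germ_eq u v" "v \<in> smooth_germs" shows "u \<in> smooth_germs"
proof -
  obtain r where r: "r > 0" "smooth (ball 0 r) v" using smooth_germs_radius[OF assms(2)] .
  obtain r' where r': "r' > 0" "\<And>x. norm x < r' \<Longrightarrow> u x = v x" using germ_eq_radius[OF assms(1)] by blast
  have "smooth (ball 0 (min r r')) v" by (rule smooth_subset[OF r(2)]) auto
  hence "smooth (ball 0 (min r r')) u" by (subst smooth_cong[of _ u v]) (use r'(2) in auto)
  thus ?thesis using r(1) r'(1) smooth_germsI[of "min r r'" u] by simp
qed

lemma smooth_germs_mult:
  fixes u v :: "real^'n::finite \<Rightarrow> real"
  assumes "u \<in> smooth_germs" "v \<in> smooth_germs" shows "(\<lambda>x. u x * v x) \<in> smooth_germs"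
proof -
  obtain r where r: "r > 0" "smooth (ball 0 r) u" using smooth_germs_radius[OF assms(1)] .
  obtain r' where r': "r' > 0" "smooth (ball 0 r') v" using smooth_germs_radius[OF assms(2)] .
  have "smooth (ball 0 (min r r')) (\<lambda>x. u x * v x)"
    by (rule smooth_mult[OF smooth_subset[OF r(2)] smooth_subset[OF r'(2)]]) auto
  thus ?thesis using r(1) r'(1) smooth_germsI[of "min r r'"] by simp
qed

lemma smooth_germs_sum:
  fixes u :: "'i \<Rightarrow> real^'n::finite \<Rightarrow> real"
  assumes "\<And>i. i \<in> I \<Longrightarrow> u i \<in> smooth_germs" shows "(\<lambda>x. \<Sum>i\<in>I. u i x) \<in> smooth_germs"
  using assms
proof (induction I rule: infinite_finite_induct)
  case (insert i I)
  obtain r where r: "r > 0" "smooth (ball 0 r) (u i)" using smooth_germs_radius[of "u i"] insert.prems by blast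
  obtain r' where r': "r' > 0" "smooth (ball 0 r') (\<lambda>x. \<Sum>i\<in>I. u i x)" using smooth_germs_radius insert by blast
  have "smooth (ball 0 (min r r')) (\<lambda>x. u i x + (\<Sum>i\<in>I. u i x))"
    by (rule smooth_add[OF smooth_subset[OF r(2)] smooth_subset[OF r'(2)]]) auto
  thus ?case using r(1) r'(1) smooth_germsI[of "min r r'"] insert.hyps by simp
qed (auto intro!: smooth_germsI[of 1] smooth_const)

lemma dc_germ_smooth_germs: "dc_germ N u \<Longrightarrow> u \<in> smooth_germs"
  unfolding dc_germ_def using smooth_germsI dc_on_smooth by blast

lemma has_grad_sum:
  assumes "\<And>l. l \<in> I \<Longrightarrow> has_grad (F l) x"
  shows "has_grad (\<lambda>x. \<Sum>l\<in>I. F l x) x" "pd j (\<lambda>x. \<Sum>l\<in>I. F l x) x = (\<Sum>l\<in>I. pd j (F l) x)"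
proof -
  have "has_grad (\<lambda>x. \<Sum>l\<in>I. F l x) x \<and> pd j (\<lambda>x. \<Sum>l\<in>I. F l x) x = (\<Sum>l\<in>I. pd j (F l) x)"
    using assms
  proof (induction I rule: infinite_finite_induct)
    case (insert i I)
    hence IH: "has_grad (\<lambda>x. \<Sum>l\<in>I. F l x) x" "pd j (\<lambda>x. \<Sum>l\<in>I. F l x) x = (\<Sum>l\<in>I. pd j (F l) x)" by auto
    have "has_grad (F i) x" using insert.prems by simp
    from has_grad_add[OF this IH(1)] IH(2) insert.hyps show ?case by simp
  qed (simp_all add: has_grad_const)
  thus "has_grad (\<lambda>x. \<Sum>l\<in>I. F l x) x" "pd j (\<lambda>x. \<Sum>l\<in>I. F l x) x = (\<Sum>l\<in>I. pd j (F l) x)" by auto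
qed

text \<open>
  One more derivative turns \<open>j! M\<^sub>j\<close> into \<open>(j + 1)! M\<^sub>j\<^sub>+\<^sub>1\<close>, which differs by a geometric factor since \<open>M\<close>
  has moderate growth.
\<close>

lemma dc_class_pd_bound:
  fixes b :: "real^'n::finite \<Rightarrow> real"
  assumes M: "tame M" and C: "C > 0"
    and bd: "\<And>l. \<bar>pds l b x\<bar> \<le> C ^ (length l + 1) * fact (length l) * M (length l)"
    and A: "\<And>j k. M (j + k) \<le> A ^ (j + k) * M j * M k" "A > 0"
  shows "\<bar>pds l (pd i b) x\<bar> \<le> (2 * (max 1 C)\<^sup>2 * max 1 A * M 1) ^ (length l + 1) * fact (length l) * M (length l)"
proof -
  define c a q where "c = max 1 C" and "a = max 1 A" and "q = length l"
  have c: "1 \<le> c" "C \<le> c" and a: "1 \<le> a" "A \<le> a" by (auto simp: c_def a_def)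
  have M1: "1 \<le> M 1" by (rule tame_ge_1[OF M])
  have Mq: "0 < M q" by (rule tame_pos[OF M])
  have "\<bar>pds l (pd i b) x\<bar> \<le> C ^ (q + 2) * fact (q + 1) * M (q + 1)"
    using bd[of "l @ [i]"] by (simp add: pds_snoc q_def)
  also have "\<dots> \<le> c ^ (q + 2) * (2 ^ (q + 1) * fact q) * (a ^ (q + 1) * M q * M 1)"
  proof (intro mult_mono)
    show "C ^ (q + 2) \<le> c ^ (q + 2)" using C c by (intro power_mono) auto
    have "real q + 1 \<le> 2 ^ (q + 1)" by (induction q) auto
    hence "(real q + 1) * fact q \<le> 2 ^ (q + 1) * (fact q :: real)" by (intro mult_right_mono) auto
    thus "fact (q + 1) \<le> (2 ^ (q + 1) * fact q :: real)" by (simp add: add.commute)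
    have "A ^ (q + 1) * (M q * M 1) \<le> a ^ (q + 1) * (M q * M 1)"
      using A(2) a M1 Mq by (intro mult_right_mono power_mono) auto
    thus "M (q + 1) \<le> a ^ (q + 1) * M q * M 1" using A(1)[of q 1] by (simp add: mult_ac)
  qed (use c a M1 Mq tame_pos[OF M, of "q + 1"] in auto)
  also have "\<dots> = (c ^ (q + 2) * 2 ^ (q + 1) * a ^ (q + 1) * M 1) * (fact q * M q)" by (simp add: mult_ac)
  also have "\<dots> \<le> ((c\<^sup>2) ^ (q + 1) * 2 ^ (q + 1) * a ^ (q + 1) * M 1 ^ (q + 1)) * (fact q * M q)"
  proof (intro mult_right_mono mult_mono)
    show "c ^ (q + 2) \<le> (c\<^sup>2) ^ (q + 1)" unfolding power_mult[symmetric] using c by (intro power_increasing) auto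
    show "M 1 \<le> M 1 ^ (q + 1)" using power_increasing[of 1 "q + 1" "M 1"] M1 by simp
  qed (use c a M1 Mq in auto)
  also have "\<dots> = (2 * c\<^sup>2 * a * M 1) ^ (q + 1) * fact q * M q" by (simp only: power_mult_distrib mult_ac)
  finally show ?thesis by (simp only: c_def a_def q_def)
qed

text \<open>
  The derivatives of \<open>b\<close> have to be divided too, because they occur in those of the products \<open>a b\<close>.
\<close>

lemma flat_ideal_division:
  fixes b g :: "real^'n::finite \<Rightarrow> real" and G :: "complex^'n \<Rightarrow> complex"
  assumes \<theta>: "admissible \<theta>" and M: "tame M" "non_quasianalytic M" and tr: "is_theta_transform M \<theta> N"
    and Y: "closed Y" "0 \<in> Y"
    and g: "dc_germ N g" and G: "holomorphic_extension g G"
    and far: "\<forall>\<^sub>F x in nhds 0. set_dist (complex_vec x) {z. G z = 0} \<ge> ereal (\<theta> (infdist x Y))"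
    and b: "b \<in> flat_ideal Y M"
  shows "b \<in> smooth_germs" "\<exists>q. flat_germ N q \<and> germ_eq b (\<lambda>x. g x * q x)"
    "\<exists>q. flat_germ N q \<and> germ_eq (pd j b) (\<lambda>x. g x * q x)"
proof -
  obtain r C where r: "r > 0" "C > 0" "smooth (ball 0 r) b"
    "\<And>x l. x \<in> ball 0 r \<Longrightarrow> \<bar>pds l b x\<bar> \<le> C ^ (length l + 1) * fact (length l) * M (length l)"
    using b dc_classD[of b M] unfolding flat_ideal_def by blast
  show "b \<in> smooth_germs" using r by (intro smooth_germsI)
  have "\<forall>\<^sub>F x in nhds 0. x \<in> Y \<longrightarrow> (\<forall>J. mderiv J b x = 0)" using b by (simp add: flat_ideal_def)
  then obtain r' where r': "r' > 0" "\<And>x. norm x < r' \<Longrightarrow> x \<in> Y \<longrightarrow> (\<forall>J. mderiv J b x = 0)"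
    unfolding eventually_nhds_metric by auto
  define s where "s = min r r'"
  have s: "s > 0" "s \<le> r" "s \<le> r'" using r r' by (auto simp: s_def)
  have flat: "pds l b y = 0" if y: "y \<in> Y" "norm y < s" for y l
    using mderiv_eq_pds(1)[OF r(3), of y l] r'(2)[of y] y s by simp
  have sb: "smooth (ball 0 s) b" by (rule smooth_subset[OF r(3) open_ball subset_ball[OF s(2)]])
  have bd: "\<bar>pds l b x\<bar> \<le> C ^ (length l + 1) * fact (length l) * M (length l)" if "norm x < s" for x l
    using r(4)[of x l] that s by simp
  show "\<exists>q. flat_germ N q \<and> germ_eq b (\<lambda>x. g x * q x)"
    using flat_division[OF \<theta> M tr Y g G far s(1) r(2) sb bd flat] by blast
  obtain A where A: "A > 0" "\<And>j k. M (j + k) \<le> A ^ (j + k) * M j * M k" using M(1) unfolding tame_def by blast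
  define C' where "C' = 2 * (max 1 C)\<^sup>2 * max 1 A * M 1"
  have "0 < max 1 C" "0 < max 1 A" by auto
  hence C': "C' > 0" unfolding C'_def using tame_pos[OF M(1), of 1] by (intro mult_pos_pos zero_less_power) auto
  have sb': "smooth (ball 0 s) (pd j b)" by (rule smooth_pd[OF sb])
  have bd': "\<bar>pds l (pd j b) x\<bar> \<le> C' ^ (length l + 1) * fact (length l) * M (length l)" if "norm x < s" for x l
    unfolding C'_def by (rule dc_class_pd_bound[OF M(1) r(2) bd[OF that] A(2,1)])
  have flat': "pds l (pd j b) y = 0" if "y \<in> Y" "norm y < s" for y l
    unfolding pds_snoc[symmetric] by (rule flat[OF that])
  show "\<exists>q. flat_germ N q \<and> germ_eq (pd j b) (\<lambda>x. g x * q x)"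
    using flat_division[OF \<theta> M tr Y g G far s(1) C' sb' bd' flat'] by blast
qed

theorem theorem2:
  fixes \<psi> :: "real^'n::finite \<Rightarrow> real^'p::finite"
    and f g :: "real^'n \<Rightarrow> real"
    and G :: "complex^'n \<Rightarrow> complex"
    and K :: "(real^'n \<Rightarrow> real) set"
    and Y :: "(real^'n) set"
    and \<theta> :: "real \<Rightarrow> real"
    and M M\<theta> :: "nat \<Rightarrow> real"
  assumes "\<psi> \<in> analytic_map_germs" and "\<psi> 0 = 0"
    and "f \<in> primitive_ideal (component_ideal \<psi>)"
    and "is_fitting_ideal \<psi> (grad f) K"
    and "closed Y" and "0 \<in> Y"
    and "admissible \<theta>"
    and "g \<in> K"
    and "holomorphic_extension g G"
    and "\<forall>\<^sub>F x in nhds 0. set_dist (complex_vec x) {z. G z = 0} \<ge> ereal (\<theta> (infdist x Y))"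
    and "tame M" and "non_quasianalytic M"
    and "is_theta_transform M \<theta> M\<theta>"
  shows "\<forall>u \<in> product_module (primitive_ideal (component_ideal \<psi>)) (flat_ideal Y M).
           \<exists>\<Phi> \<in> dc_diffeo_germs M\<theta>. germ_eq (\<lambda>x. f x + u x) (f \<circ> \<Phi>)"
proof
  fix u assume "u \<in> product_module (primitive_ideal (component_ideal \<psi>)) (flat_ideal Y M)"
  then obtain m :: nat and a b where ab: "\<And>l. l < m \<Longrightarrow> a l \<in> primitive_ideal (component_ideal \<psi>)"
    "\<And>l. l < m \<Longrightarrow> b l \<in> flat_ideal Y M" and u: "germ_eq u (\<lambda>x. \<Sum>l<m. a l x * b l x)"
    unfolding product_module_def by blast
  have N: "tame M\<theta>" using assms(13) by (simp add: is_theta_transform_def)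
  have \<psi>: "dc_germ M\<theta> (\<lambda>x. \<psi> x $ k)" for k
    using assms(1) by (intro analytic_germ_dc_germ N) (simp add: analytic_map_germs_def)
  have g: "dc_germ M\<theta> g" and "\<exists>C. (\<forall>k j. dc_germ M\<theta> (C k j)) \<and>
    (\<forall>\<^sub>F x in nhds 0. \<forall>k. g x * \<psi> x $ k = (\<Sum>j\<in>UNIV. C k j x * pd j f x))"
    using fitting_multiplier[OF assms(4,8) N] by blast+
  then obtain C where C: "\<And>k j. dc_germ M\<theta> (C k j)"
    "\<forall>\<^sub>F x in nhds 0. \<forall>k. g x * \<psi> x $ k = (\<Sum>j\<in>UNIV. C k j x * pd j f x)" by blast
  have ideal_dc: "dc_germ M\<theta> v" if v: "v \<in> component_ideal \<psi>" for v
  proof -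
    obtain \<alpha> where \<alpha>: "\<forall>i. \<alpha> i \<in> analytic_germs" "germ_eq v (\<lambda>x. \<Sum>i\<in>UNIV. \<alpha> i x * \<psi> x $ i)"
      using component_ideal_coefficients[OF v] by blast
    have "dc_germ M\<theta> (\<lambda>x. \<Sum>i\<in>UNIV. \<alpha> i x * \<psi> x $ i)"
      by (rule dc_germ_sum[OF N]) (rule dc_germ_mult[OF N analytic_germ_dc_germ[OF _ N] \<psi>], use \<alpha>(1) in blast)
    moreover have "germ_eq (\<lambda>x. \<Sum>i\<in>UNIV. \<alpha> i x * \<psi> x $ i) v" using \<alpha>(2) by (simp add: germ_eq_def eq_commute)
    ultimately show ?thesis using dc_germ_cong N by blast
  qed
  have fs: "f \<in> smooth_germs"
    by (rule dc_germ_smooth_germs[OF ideal_dc]) (use assms(3) in \<open>simp add: primitive_ideal_def\<close>)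
  have as: "a l \<in> smooth_germs" if "l < m" for l
    by (rule dc_germ_smooth_germs[OF ideal_dc]) (use ab(1)[OF that] in \<open>simp add: primitive_ideal_def\<close>)
  note div = flat_ideal_division[OF assms(7,11,12,13,5,6) g assms(9,10) ab(2)]
  have us: "u \<in> smooth_germs"
    by (rule smooth_germs_cong[OF u]) (intro smooth_germs_sum smooth_germs_mult as div(1); simp)
  have "\<forall>l\<in>{..<m}. \<exists>\<alpha>. (\<forall>i. \<alpha> i \<in> analytic_germs) \<and> germ_eq (a l) (\<lambda>x. \<Sum>i\<in>UNIV. \<alpha> i x * \<psi> x $ i)"
    using ab(1) by (intro ballI component_ideal_coefficients) (simp add: primitive_ideal_def)
  from bchoice[OF this] obtain \<alpha> where \<alpha>: "\<forall>l\<in>{..<m}. (\<forall>i. \<alpha> l i \<in> analytic_germs) \<and> germ_eq (a l) (\<lambda>x. \<Sum>i\<in>UNIV. \<alpha> l i x * \<psi> x $ i)" ..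
  have "\<forall>p\<in>{..<m} \<times> UNIV. \<exists>\<beta>. (\<forall>i. \<beta> i \<in> analytic_germs) \<and> germ_eq (pd (snd p) (a (fst p))) (\<lambda>x. \<Sum>i\<in>UNIV. \<beta> i x * \<psi> x $ i)"
    using ab(1) by (intro ballI component_ideal_coefficients) (auto simp: primitive_ideal_def partial_eq_pd[symmetric])
  from bchoice[OF this] obtain \<beta> where \<beta>: "\<forall>p\<in>{..<m} \<times> UNIV. (\<forall>i. \<beta> p i \<in> analytic_germs) \<and> germ_eq (pd (snd p) (a (fst p))) (\<lambda>x. \<Sum>i\<in>UNIV. \<beta> p i x * \<psi> x $ i)" ..
  have "\<forall>l\<in>{..<m}. \<exists>q. flat_germ M\<theta> q \<and> germ_eq (b l) (\<lambda>x. g x * q x)" using div(2) by blast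
  from bchoice[OF this] obtain q where q: "\<forall>l\<in>{..<m}. flat_germ M\<theta> (q l) \<and> germ_eq (b l) (\<lambda>x. g x * q l x)" ..
  have "\<forall>p\<in>{..<m} \<times> UNIV. \<exists>q. flat_germ M\<theta> q \<and> germ_eq (pd (snd p) (b (fst p))) (\<lambda>x. g x * q x)" using div(3) by auto
  from bchoice[OF this] obtain q' where q': "\<forall>p\<in>{..<m} \<times> UNIV. flat_germ M\<theta> (q' p) \<and> germ_eq (pd (snd p) (b (fst p))) (\<lambda>x. g x * q' p x)" ..
  define e where "e k x = (\<Sum>l<m. \<alpha> l k x * q l x)" for k x
  define W where "W j k x = (\<Sum>l<m. \<beta> (l, j) k x * q l x + \<alpha> l k x * q' (l, j) x)" for j k x
  have \<alpha>N: "dc_germ M\<theta> (\<alpha> l k)" and \<beta>N: "dc_germ M\<theta> (\<beta> (l, j) k)" if "l < m" for l k j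
    using \<alpha> \<beta> that by (auto intro!: analytic_germ_dc_germ N)
  have qN: "flat_germ M\<theta> (q l)" and q'N: "flat_germ M\<theta> (q' (l, j))" if "l < m" for l j
    using q q' that by auto
  have e: "flat_germ M\<theta> (e k)" for k
    unfolding e_def[abs_def]
    by (rule flat_germ_sum[OF finite_lessThan N]) (rule flat_germ_mult[OF N \<alpha>N qN]; simp)
  have W: "flat_germ M\<theta> (W j k)" for j k
    unfolding W_def[abs_def]
    by (rule flat_germ_sum[OF finite_lessThan N])
      (rule flat_germ_add[OF N flat_germ_mult[OF N \<beta>N qN] flat_germ_mult[OF N \<alpha>N q'N]]; simp)
  have ev: "\<forall>\<^sub>F x in nhds 0. \<forall>l\<in>{..<m}. a l x = (\<Sum>i\<in>UNIV. \<alpha> l i x * \<psi> x $ i) \<and> b l x = g x * q l x \<and> has_grad (a l) x \<and> has_grad (b l) x"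
    using \<alpha> q smooth_germs_has_grad[OF as] smooth_germs_has_grad[OF div(1)]
    by (intro eventually_ball_finite ballI eventually_conj) (auto simp: germ_eq_def)
  have ev': "\<forall>\<^sub>F x in nhds 0. \<forall>p\<in>{..<m} \<times> UNIV. pd (snd p) (a (fst p)) x = (\<Sum>i\<in>UNIV. \<beta> p i x * \<psi> x $ i) \<and> pd (snd p) (b (fst p)) x = g x * q' p x"
    using \<beta> q' by (intro eventually_ball_finite ballI eventually_conj) (auto simp: germ_eq_def)
  have ue: "\<forall>\<^sub>F x in nhds 0. u x = g x * (\<Sum>k\<in>UNIV. e k x * \<psi> x $ k)"
    using u[unfolded germ_eq_def] ev
  proof eventually_elim
    case (elim x)
    have "u x = (\<Sum>l<m. (\<Sum>k\<in>UNIV. \<alpha> l k x * \<psi> x $ k) * (g x * q l x))"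
      unfolding elim(1) using elim(2) by (intro sum.cong) auto
    also have "\<dots> = (\<Sum>l<m. \<Sum>k\<in>UNIV. g x * (\<alpha> l k x * q l x * \<psi> x $ k))"
      by (simp add: sum_distrib_left sum_distrib_right mult_ac)
    also have "\<dots> = (\<Sum>k\<in>UNIV. \<Sum>l<m. g x * (\<alpha> l k x * q l x * \<psi> x $ k))" by (rule sum.swap)
    also have "\<dots> = g x * (\<Sum>k\<in>UNIV. e k x * \<psi> x $ k)"
      by (simp add: e_def sum_distrib_left sum_distrib_right)
    finally show ?case .
  qed
  have "\<forall>\<^sub>F x in nhds 0. pd j u x = pd j (\<lambda>x. \<Sum>l<m. a l x * b l x) x" for j
    using germ_eq_pd[OF u, of j] by (simp add: germ_eq_def)
  hence "\<forall>\<^sub>F x in nhds 0. \<forall>j. pd j u x = pd j (\<lambda>x. \<Sum>l<m. a l x * b l x) x" by (rule eventually_all_finite)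
  hence du: "\<forall>\<^sub>F x in nhds 0. \<forall>j. pd j u x = g x * (\<Sum>k\<in>UNIV. W j k x * \<psi> x $ k)"
    using ev ev'
  proof eventually_elim
    case (elim x)
    show ?case
    proof
      fix j
      have hg: "has_grad (a l) x" "has_grad (b l) x" if "l < m" for l using elim(2) that by auto
      have "pd j u x = pd j (\<lambda>x. \<Sum>l<m. a l x * b l x) x" using elim(1) by blast
      also have "\<dots> = (\<Sum>l<m. pd j (\<lambda>x. a l x * b l x) x)"
        by (rule has_grad_sum(2)[where F="\<lambda>l x. a l x * b l x"]) (rule has_grad_mult(1)[OF hg]; simp)
      also have "\<dots> = (\<Sum>l<m. pd j (a l) x * b l x + a l x * pd j (b l) x)"
        by (rule sum.cong[OF refl]) (rule has_grad_mult(2)[OF hg]; simp)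
      also have "\<dots> = (\<Sum>l<m. (\<Sum>k\<in>UNIV. \<beta> (l, j) k x * \<psi> x $ k) * (g x * q l x) + (\<Sum>k\<in>UNIV. \<alpha> l k x * \<psi> x $ k) * (g x * q' (l, j) x))"
      proof (rule sum.cong[OF refl])
        fix l assume l: "l \<in> {..<m}"
        have "pd j (a l) x = (\<Sum>k\<in>UNIV. \<beta> (l, j) k x * \<psi> x $ k)" "pd j (b l) x = g x * q' (l, j) x"
          using bspec[OF elim(3), of "(l, j)"] l by simp_all
        moreover have "a l x = (\<Sum>k\<in>UNIV. \<alpha> l k x * \<psi> x $ k)" "b l x = g x * q l x" using elim(2) l by blast+
        ultimately show "pd j (a l) x * b l x + a l x * pd j (b l) x =
          (\<Sum>k\<in>UNIV. \<beta> (l, j) k x * \<psi> x $ k) * (g x * q l x) + (\<Sum>k\<in>UNIV. \<alpha> l k x * \<psi> x $ k) * (g x * q' (l, j) x)"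
          by (simp only:)
      qed
      also have "\<dots> = (\<Sum>l<m. \<Sum>k\<in>UNIV. g x * ((\<beta> (l, j) k x * q l x + \<alpha> l k x * q' (l, j) x) * \<psi> x $ k))"
        unfolding sum_distrib_right sum.distrib[symmetric] by (intro sum.cong refl) (simp add: algebra_simps)
      also have "\<dots> = (\<Sum>k\<in>UNIV. \<Sum>l<m. g x * ((\<beta> (l, j) k x * q l x + \<alpha> l k x * q' (l, j) x) * \<psi> x $ k))" by (rule sum.swap)
      also have "\<dots> = g x * (\<Sum>k\<in>UNIV. W j k x * \<psi> x $ k)"
        by (simp add: W_def sum_distrib_left sum_distrib_right)
      finally show "pd j u x = g x * (\<Sum>k\<in>UNIV. W j k x * \<psi> x $ k)" .
    qed
  qed
  obtain r1 where r1: "r1 > 0" "smooth (ball 0 r1) f" using smooth_germs_radius[OF fs] .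
  obtain r2 where r2: "r2 > 0" "smooth (ball 0 r2) u" using smooth_germs_radius[OF us] .
  have "smooth (ball 0 (min r1 r2)) f" "smooth (ball 0 (min r1 r2)) u" "0 < min r1 r2"
    using r1 r2 by (auto intro: smooth_subset[OF r1(2)] smooth_subset[OF r2(2)])
  thus "\<exists>\<Phi>\<in>dc_diffeo_germs M\<theta>. germ_eq (\<lambda>x. f x + u x) (f \<circ> \<Phi>)"
    using deformation[OF N _ _ _ g \<psi> C(1) W e C(2) du ue] by blast
qed

end
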